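(* Let $d\ge 1$, $\lambda>0$, and suppose that $f$ is analytic inside the polyellipse $\mathcal{E}_{\boldsymbol{\rho}}=\bigotimes_{j=1}^d\mathcal{E}_{\rho_j}$, where $\boldsymbol{\rho}=(\rho_1,\dots,\rho_d)$ with $\rho_i>1$ for $i=1,\dots,d$. Then the multivariate Gegenbauer coefficients $a_{\mathbf{k}}$, $\mathbf{k}=(k_1,\dots,k_d)\in\mathbb{N}_0^d$, of $f$ satisfy $$|a_{\mathbf{k}}|\le \frac{\mathcal{B}_f\,L(\mathcal{E}_{\boldsymbol{\rho}})}{\pi^d\,\boldsymbol{\rho}^{\mathbf{k}}}\prod_{\substack{1\le i\le d\\ k_i=0}}\overline{D}_{\rho_i}^{(\lambda)}\prod_{\substack{1\le j\le d\\ k_j\ne 0}}k_j^{1-\lambda}D_{\rho_j}^{(\lambda)},\qquad \mathcal{B}_f=\max_{\mathbf{z}\in\mathcal{E}_{\boldsymbol{\rho}}}|f(\mathbf{z})|.$$ In addition, apart from some constant factor, this bound is optimal as $k_j\to+\infty$ for $j=1,\dots,d$.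
   Context: $\Omega_d=[-1,1]^d$. $C_n^{(\lambda)}$ is the Gegenbauer polynomial of degree $n$, orthogonal on $[-1,1]$ with respect to $\omega_\lambda(x)=(1-x^2)^{\lambda-1/2}$, normalized by $C_n^{(\lambda)}(1)=\frac{\Gamma(n+2\lambda)}{n!\,\Gamma(2\lambda)}$; $h_n^{(\lambda)}=\int_{-1}^1 C_n^{(\lambda)}(x)^2\omega_\lambda(x)\,dx=\frac{2^{1-2\lambda}\pi}{\Gamma(\lambda)^2}\frac{\Gamma(n+2\lambda)}{\Gamma(n+1)(n+\lambda)}$. Multivariate versions are products: $C_{\mathbf{k}}^{(\lambda)}(\mathbf{x})=\prod_j C_{k_j}^{(\lambda)}(x_j)$, $\omega_\lambda(\mathbf{x})=\prod_j\omega_\lambda(x_j)$, $h_{\mathbf{k}}^{(\lambda)}=\prod_j h_{k_j}^{(\lambda)}$, $\boldsymbol{\rho}^{\mathbf{k}}=\prod_j\rho_j^{k_j}$. The multivariate Gegenbauer coefficients of $f$ are $a_{\mathbf{k}}=\frac{1}{h_{\mathbf{k}}^{(\lambda)}}\int_{\Omega_d}f(\mathbf{x})C_{\mathbf{k}}^{(\lambda)}(\mathbf{x})\omega_\lambda(\mathbf{x})\,d\mathbf{x}$. For $\rho>1$ the Bernstein ellipse is $\mathcal{E}_\rho=\{z\in\mathbb{C}: z=\frac12(u+u^{-1}),\ |u|=\rho\}$; $L(\mathcal{E}_\rho)$ is the length of its circumference, and $L(\mathcal{E}_{\boldsymbol{\rho}})=\prod_{i=1}^d L(\mathcal{E}_{\rho_i})$.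 Constants: $\overline{D}_\rho^{(\lambda)}=\frac1\rho(1+\rho^{-2})^{\lambda-1}$ if $\lambda\ge1$ and $\frac1\rho(1-\rho^{-2})^{\lambda-1}$ if $0<\lambda<1$; $D_\rho^{(\lambda)}=\frac{\Gamma(\lambda)}{\rho}e^{1/12}(1+\rho^{-2})^{\lambda-1}$ if $\lambda\ge1$ and $\frac{\Gamma(\lambda)}{\rho}\exp\!\left(\frac1{12}+\frac{1-\lambda}{2\lambda}\right)(1-\rho^{-2})^{\lambda-1}$ if $0<\lambda<1$. Empty products equal $1$. *)

theory Defs
  imports "HOL-Analysis.Analysis" "HOL-Computational_Algebra.Polynomial"
begin

(* powr sends 0 to 0, so the weight is 0 at the two endpoints (also for lam \<le> 1/2);
   this is a null set and affects no integral below. *)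
definition gegenbauer_weight :: "real \<Rightarrow> real \<Rightarrow> real" where
  "gegenbauer_weight lam x = (1 - x\<^sup>2) powr (lam - 1/2)"

definition is_gegenbauer_family :: "real \<Rightarrow> (nat \<Rightarrow> real poly) \<Rightarrow> bool" where
  "is_gegenbauer_family lam C \<longleftrightarrow>
     (\<forall>n. degree (C n) = n) \<and>
     (\<forall>m n. m \<noteq> n \<longrightarrow>
        (LINT x:{-1..1}|lborel. poly (C m) x * poly (C n) x * gegenbauer_weight lam x) = 0) \<and>
     (\<forall>n. poly (C n) 1 = Gamma (real n + 2 * lam) / (fact n * Gamma (2 * lam)))"

(* For lam > 0 there is exactly one such family. *)
definition gegenbauer :: "real \<Rightarrow> nat \<Rightarrow> real poly" where
  "gegenbauer lam = (THE C. is_gegenbauer_family lam C)"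

definition gegenbauer_h :: "real \<Rightarrow> nat \<Rightarrow> real" where
  "gegenbauer_h lam n =
     (LINT x:{-1..1}|lborel. (poly (gegenbauer lam n) x)\<^sup>2 * gegenbauer_weight lam x)"

definition mgegenbauer :: "real \<Rightarrow> nat^'d \<Rightarrow> real^'d \<Rightarrow> real" where
  "mgegenbauer lam k x = (\<Prod>j\<in>UNIV. poly (gegenbauer lam (k $ j)) (x $ j))"

definition mgegenbauer_weight :: "real \<Rightarrow> real^'d \<Rightarrow> real" where
  "mgegenbauer_weight lam x = (\<Prod>j\<in>UNIV. gegenbauer_weight lam (x $ j))"

definition mgegenbauer_h :: "real \<Rightarrow> nat^'d \<Rightarrow> real" where
  "mgegenbauer_h lam k = (\<Prod>j\<in>UNIV. gegenbauer_h lam (k $ j))"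

definition hypercube :: "(real^'d) set" where
  "hypercube = {x. \<forall>j. -1 \<le> x $ j \<and> x $ j \<le> 1}"

definition gegenbauer_coeff :: "real \<Rightarrow> (complex^'d \<Rightarrow> complex) \<Rightarrow> nat^'d \<Rightarrow> complex" where
  "gegenbauer_coeff lam f k =
     1 / of_real (mgegenbauer_h lam k) *
     (LINT x:hypercube|lborel.
        f (\<chi> j. of_real (x $ j)) * of_real (mgegenbauer lam k x) * of_real (mgegenbauer_weight lam x))"

definition bernstein_ellipse :: "real \<Rightarrow> complex set" where
  "bernstein_ellipse r = {z. \<exists>u. norm u = r \<and> z = (u + inverse u) / 2}"

definition bernstein_path :: "real \<Rightarrow> real \<Rightarrow> complex" where
  "bernstein_path r t =
     (let u = of_real r * exp (2 * of_real pi * \<i> * of_real t) in (u + inverse u) / 2)"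

lemma path_image_bernstein_path:
  assumes "r > 0"
  shows "path_image (bernstein_path r) = bernstein_ellipse r"
proof -
  have "(\<exists>t\<in>{0..1}. u = of_real r * exp (2 * of_real pi * \<i> * of_real t))" if "norm u = r" for u :: complex
  proof
    show "Arg2pi u / (2 * pi) \<in> {0..1}"
      using Arg2pi_ge_0[of u] Arg2pi_lt_2pi[of u] by (auto simp: field_simps)
    show "u = of_real r * exp (2 * of_real pi * \<i> * of_real (Arg2pi u / (2 * pi)))"
      using Arg2pi_eq[of u] that by simp
  qed
  moreover have "norm (of_real r * exp (2 * of_real pi * \<i> * of_real t)) = r" for t
    using assms by (simp add: norm_mult)
  ultimately show ?thesis
    unfolding path_image_def bernstein_path_def bernstein_ellipse_def Let_def image_iff set_eq_iff
      mem_Collect_eq image_def by metis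
qed

(* For r > 1 the path runs through the ellipse exactly once. *)
definition bernstein_length :: "real \<Rightarrow> real" where
  "bernstein_length r =
     integral {0..1} (\<lambda>t. norm (vector_derivative (bernstein_path r) (at t within {0..1})))"

definition polyellipse :: "real^'d \<Rightarrow> (complex^'d) set" where
  "polyellipse \<rho> = {z. \<forall>j. z $ j \<in> bernstein_ellipse (\<rho> $ j)}"

definition polyellipse_inside :: "real^'d \<Rightarrow> (complex^'d) set" where
  "polyellipse_inside \<rho> = {z. \<forall>j. z $ j \<in> inside (bernstein_ellipse (\<rho> $ j))}"

definition polyellipse_length :: "real^'d \<Rightarrow> real" where
  "polyellipse_length \<rho> = (\<Prod>j\<in>UNIV. bernstein_length (\<rho> $ j))"

(* Several-variable counterpart of analytic_on: near every point of S the function has a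
   complex-linear Frechet derivative. *)
definition manalytic_on :: "(complex^'d \<Rightarrow> complex) \<Rightarrow> (complex^'d) set \<Rightarrow> bool" where
  "manalytic_on f S \<longleftrightarrow>
     (\<forall>z\<in>S. \<exists>e>0. \<forall>w\<in>ball z e. \<exists>a::complex^'d.
        (f has_derivative (\<lambda>h. \<Sum>j\<in>UNIV. a $ j * h $ j)) (at w))"

(* The maximum of |f| over the polyellipse only controls f inside if the boundary values are
   tied to the interior ones, so f is taken to be continuous up to the boundary. *)
definition analytic_inside_polyellipse :: "real^'d \<Rightarrow> (complex^'d \<Rightarrow> complex) \<Rightarrow> bool" where
  "analytic_inside_polyellipse \<rho> f \<longleftrightarrow>
     manalytic_on f (polyellipse_inside \<rho>) \<and>
     continuous_on {z. \<forall>j. z $ j \<in> bernstein_ellipse (\<rho> $ j) \<union> inside (bernstein_ellipse (\<rho> $ j))} f"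

(* The supremum is attained when f is continuous on the compact set polyellipse \<rho>. *)
definition max_on_polyellipse :: "real^'d \<Rightarrow> (complex^'d \<Rightarrow> complex) \<Rightarrow> real" where
  "max_on_polyellipse \<rho> f = (SUP z\<in>polyellipse \<rho>. norm (f z))"

definition Dbar :: "real \<Rightarrow> real \<Rightarrow> real" where
  "Dbar lam r =
     (if lam \<ge> 1 then 1 / r * (1 + r powi (-2)) powr (lam - 1)
      else 1 / r * (1 - r powi (-2)) powr (lam - 1))"

definition Dconst :: "real \<Rightarrow> real \<Rightarrow> real" where
  "Dconst lam r =
     (if lam \<ge> 1 then Gamma lam / r * exp (1/12) * (1 + r powi (-2)) powr (lam - 1)
      else Gamma lam / r * exp (1/12 + (1 - lam) / (2 * lam)) * (1 - r powi (-2)) powr (lam - 1))"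

definition gegenbauer_coeff_bound ::
    "real \<Rightarrow> real^'d \<Rightarrow> (complex^'d \<Rightarrow> complex) \<Rightarrow> nat^'d \<Rightarrow> real" where
  "gegenbauer_coeff_bound lam \<rho> f k =
     max_on_polyellipse \<rho> f * polyellipse_length \<rho> /
       (pi ^ CARD('d) * (\<Prod>j\<in>UNIV. (\<rho> $ j) ^ (k $ j))) *
     (\<Prod>i\<in>{i. k $ i = 0}. Dbar lam (\<rho> $ i)) *
     (\<Prod>j\<in>{j. k $ j \<noteq> 0}. real (k $ j) powr (1 - lam) * Dconst lam (\<rho> $ j))"

end

theory Submission
  imports Defs "HOL-Complex_Analysis.Cauchy_Integral_Formula"
begin

text \<open>
  By Cauchy's formula on the ellipse, the one-variable coefficient of \<open>\<phi>\<close> is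
  \<open>1/(2\<pi>i) \<oint> \<phi>(z) Q\<^sub>n(z) dz\<close> with \<open>Q\<^sub>n(z) = 1/h\<^sub>n \<integral> C\<^sub>n(x) \<omega>(x) / (z - x) dx\<close>. For
  \<open>z = (u + 1/u)/2\<close> the Cauchy kernel expands as \<open>1/(z - x) = 2 \<Sum> u\<^bsup>-m-1\<^esup> U\<^sub>m(x)\<close> in Chebyshev
  polynomials of the second kind. The Gegenbauer coefficients of \<open>U\<^sub>m\<close> satisfy a three-term
  recurrence that is solved in closed form, and they are moments of a Beta weight. Summing
  the binomial series under the Beta integral gives Euler's integral
  \<open>Q\<^sub>n(z) = 2 (n + \<lambda>) u\<^bsup>-n-1\<^esup> \<integral>\<^sub>0\<^sup>1 t\<^sup>n (1 - t)\<^bsup>\<lambda>-1\<^esup> (1 - t/u\<^sup>2)\<^bsup>\<lambda>-1\<^esup> dt\<close>, from which the bound on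
  \<open>Q\<^sub>n\<close> is read off; log-convexity of the Gamma function supplies the remaining constant.
  In several variables the integration over \<open>[-1,1]\<close> is replaced by integration over the
  ellipse one coordinate at a time. The bound is attained up to a constant by the products of
  the \<open>U\<^bsub>k\<^sub>j\<^esub>(z\<^sub>j)\<close>, whose coefficient of index \<open>k\<close> is \<open>\<Prod> k\<^sub>j! / (\<lambda>)\<^bsub>k\<^sub>j\<^esub>\<close>.
\<close>

section \<open>Gegenbauer polynomials from the three-term recurrence\<close>

text \<open>The kernel is expanded in the \<open>U_m\<close> because they are elementary in
  \<open>u\<close>, namely \<open>(u^(m+1) - u^(-m-1)) / (u - 1/u)\<close>, and satisfy
  \<open>|U_m| <= m + 1\<close> on \<open>[-1,1]\<close>. The series therefore converges absolutely
  for every \<open>l > 0\<close> alike, and the dependence on \<open>l\<close> sits only in the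
  integrals of \<open>U_m C_n\<close> against the weight. These vanish unless
  \<open>m = n + 2k\<close>, which is the source of the decay \<open>u^(-n-1)\<close>. Of Euler's
  integrand only the modulus is estimated: \<open>|1 - t/u^2|\<close> lies between
  \<open>1 - rho^(-2)\<close> and \<open>1 + rho^(-2)\<close>, and the sign of \<open>l - 1\<close>
  decides which end bounds its power; hence the two cases in \<open>Dbar\<close> and
  \<open>Dconst\<close>. What remains is \<open>n! / (l)_n\<close>, the same number as the
  coefficient of index \<open>n\<close> of \<open>U_n\<close>, and this coincidence makes the bound
  sharp up to a constant. Since \<open>f\<close> is only continuous on the polyellipse, Cauchy's
  formula is needed with boundary values in one coordinate while the other coordinates may
  themselves lie on the boundary. As \<open>gegenbauer\<close> is a definite description, the
  recursive family \<open>geg\<close> has to be identified with it.\<close>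

fun geg :: "real \<Rightarrow> nat \<Rightarrow> real poly" where
  "geg l 0 = 1"
| "geg l (Suc 0) = [:0, 2 * l:]"
| "geg l (Suc (Suc n)) =
     smult (1 / (real n + 2))
       (smult (2 * (real n + 1 + l)) ([:0, 1:] * geg l (Suc n)) - smult (real n + 2 * l) (geg l n))"

lemma geg_rec:
  "(real n + 2) * poly (geg l (Suc (Suc n))) x =
     2 * (real n + 1 + l) * x * poly (geg l (Suc n)) x - (real n + 2 * l) * poly (geg l n) x"
  by (simp add: field_simps)

lemma geg_rec_deriv:
  "(real n + 2) * poly (pderiv (geg l (Suc (Suc n)))) x =
     2 * (real n + 1 + l) * (poly (geg l (Suc n)) x + x * poly (pderiv (geg l (Suc n))) x)
       - (real n + 2 * l) * poly (pderiv (geg l n)) x"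
  by (simp add: field_simps pderiv_smult pderiv_diff pderiv_mult pderiv_pCons del: mult_pCons_left)

text \<open>The recurrence read as the action of multiplication by \<open>x\<close> on the basis; at
  \<open>n = 0\<close> the missing \<open>C_(-1)\<close> is replaced by 0.\<close>

lemma x_mult_geg:
  "2 * (real n + l) * x * poly (geg l n) x =
     (real n + 1) * poly (geg l (Suc n)) x
     + (real n + 2 * l - 1) * (if n = 0 then 0 else poly (geg l (n - 1)) x)"
proof (cases n)
  case (Suc m)
  then show ?thesis
    using geg_rec[of m l x] by (simp add: algebra_simps del: geg.simps(3))
qed simp

text \<open>The two identities are proved together because each step needs both. Differentiating the
  three-term recurrence and eliminating the derivative of \<open>C_n\<close> by the first identity
  gives the second one for \<open>n + 1\<close>; the first one for \<open>n + 1\<close> is then pure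
  elimination.\<close>

lemma geg_deriv_rec:
  "poly (pderiv (geg l n)) x =
     x * poly (pderiv (geg l (Suc n))) x - (real n + 1) * poly (geg l (Suc n)) x"
  "poly (pderiv (geg l (Suc n))) x =
     x * poly (pderiv (geg l n)) x + (real n + 2 * l) * poly (geg l n) x"
proof (induction n)
  case 0
  { case 1 show ?case by (simp add: pderiv_pCons) }
  { case 2 show ?case by (simp add: pderiv_pCons) }
next
  case (Suc n)
  let ?C0 = "poly (geg l n) x" and ?C1 = "poly (geg l (Suc n)) x"
    and ?C2 = "poly (geg l (Suc (Suc n))) x"
  let ?D0 = "poly (pderiv (geg l n)) x" and ?D1 = "poly (pderiv (geg l (Suc n))) x"
    and ?D2 = "poly (pderiv (geg l (Suc (Suc n)))) x"
  define N where "N = real n"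
  note r = geg_rec[of n l x, folded N_def] geg_rec_deriv[of n l x, folded N_def]
  note IH = Suc(1,2)[folded N_def]
  have nz: "N + 2 \<noteq> 0" by (simp add: N_def)
  have "(N + 2) * ?D2 = (N + 2) * (x * ?D1 + (N + 1 + 2 * l) * ?C1)"
    unfolding r IH(1) by (simp add: algebra_simps)
  then have B: "?D2 = x * ?D1 + (N + 1 + 2 * l) * ?C1"
    using nz by simp
  have "x * ?D2 - (N + 2) * ?C2 = ?D1"
    using B r(1) IH by algebra
  then have A: "?D1 = x * ?D2 - (N + 2) * ?C2" by simp
  { case 1 from A show ?case by (simp add: N_def add_ac del: geg.simps(3)) }
  { case 2 from B show ?case by (simp add: N_def add_ac del: geg.simps(3)) }
qed

text \<open>For \<open>n > 0\<close> the two derivative relations combine to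
  \<open>(1 - x^2) C_n' = - n x C_n + (n - 1 + 2l) C_(n-1)\<close>; differentiating once more and
  using a relation again to remove \<open>C_(n-1)'\<close> yields the equation.\<close>

lemma geg_ode:
  "(1 - x\<^sup>2) * poly (pderiv (pderiv (geg l n))) x - (2 * l + 1) * x * poly (pderiv (geg l n)) x
     = - (real n * (real n + 2 * l)) * poly (geg l n) x"
proof (cases n)
  case (Suc m)
  let ?C = "geg l m" and ?D = "geg l (Suc m)"
  have *: "(1 - x\<^sup>2) * poly (pderiv ?D) x = - (real m + 1) * x * poly ?D x + (real m + 2 * l) * poly ?C x" for x
    using geg_deriv_rec[of l m x] by algebra
  have "[:1, 0, -1:] * pderiv ?D = smult (- (real m + 1)) ([:0, 1:] * ?D) + smult (real m + 2 * l) ?C"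
    by (intro poly_ext) (use * in \<open>simp add: algebra_simps power2_eq_square\<close>)
  then have "poly (pderiv ([:1, 0, -1:] * pderiv ?D)) x
      = poly (pderiv (smult (- (real m + 1)) ([:0, 1:] * ?D) + smult (real m + 2 * l) ?C)) x"
    by simp
  then have "(1 - x\<^sup>2) * poly (pderiv (pderiv ?D)) x - 2 * x * poly (pderiv ?D) x
      = - (real m + 1) * (poly ?D x + x * poly (pderiv ?D) x) + (real m + 2 * l) * poly (pderiv ?C) x"
    by (simp add: pderiv_smult pderiv_diff pderiv_add pderiv_mult pderiv_pCons algebra_simps power2_eq_square
        del: mult_pCons_left mult_smult_left)
  with geg_deriv_rec[of l m x] show ?thesis
    unfolding Suc of_nat_Suc by algebra
qed simp

text \<open>Each step multiplies the leading coefficient by \<open>2 (n + 1 + l) / (n + 2)\<close>;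
  carrying its positivity through the induction keeps the degree from dropping.\<close>

lemma degree_geg:
  assumes "l > 0"
  shows "degree (geg l n) = n \<and> coeff (geg l n) n > 0"
proof (induction n rule: induct_nat_012)
  case (ge2 n)
  have d: "degree (geg l n) \<le> n" "degree (geg l (Suc n)) \<le> Suc n"
    using ge2 by auto
  have 0: "coeff (geg l n) k = 0" if "k > n" for k
    using d that by (simp add: coeff_eq_0)
  have 1: "coeff (geg l (Suc n)) k = 0" if "k > Suc n" for k
    using d that by (simp add: coeff_eq_0)
  have "coeff (geg l (Suc (Suc n))) (Suc (Suc n))
      = 2 * (real n + 1 + l) / (real n + 2) * coeff (geg l (Suc n)) (Suc n)"
    by (simp add: 0 coeff_pCons del: of_nat_Suc)
  with ge2 assms have pos: "coeff (geg l (Suc (Suc n))) (Suc (Suc n)) > 0"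
    by (simp del: geg.simps(3))
  moreover have "degree (geg l (Suc (Suc n))) \<le> Suc (Suc n)"
    by (rule degree_le) (auto simp: 0 1 coeff_pCons split: nat.splits)
  moreover have "degree (geg l (Suc (Suc n))) \<ge> Suc (Suc n)"
    using pos by (intro le_degree) (simp del: geg.simps(3))
  ultimately show ?case by (meson le_antisym)
qed (use assms in auto)

lemma geg_at_1:
  "poly (geg l n) 1 = pochhammer (2 * l) n / fact n"
proof (induction n rule: induct_nat_012)
  case (ge2 n)
  have "(real n + 2) * poly (geg l (Suc (Suc n))) 1
     = (real n + 2) * (pochhammer (2 * l) (Suc (Suc n)) / fact (Suc (Suc n)))"
    unfolding geg_rec ge2 pochhammer_Suc fact_Suc by (simp add: divide_simps) (simp add: algebra_simps)
  then show ?case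
    by (metis add_is_0 mult_left_cancel numeral_eq_Suc of_nat_eq_0_iff of_nat_add of_nat_numeral zero_neq_numeral)
qed auto

section \<open>Orthogonality and uniqueness of the family\<close>

text \<open>The weight is extended by 0 so that weighted integrals are plain Lebesgue integrals over
  the line, the form in which Fubini's theorem and product measures apply.\<close>

definition gw :: "real \<Rightarrow> real \<Rightarrow> real" where
  "gw l x = indicator {-1..1} x * gegenbauer_weight l x"

lemma gw_nonneg: "gw l x \<ge> 0"
  by (simp add: gw_def gegenbauer_weight_def)

lemma gw_eq_0: "x \<notin> {-1..1} \<Longrightarrow> gw l x = 0"
  by (simp add: gw_def)

lemma gw_measurable [measurable]: "gw l \<in> borel_measurable borel"
  unfolding gw_def gegenbauer_weight_def by measurable

lemma beta_weight_lborel: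
  fixes a b :: real
  assumes "a > 0" "b > 0"
  defines "f \<equiv> \<lambda>t. indicator {0..1} t * (t powr (a - 1) * (1 - t) powr (b - 1))"
  shows "integrable lborel f" "(\<integral>t. f t \<partial>lborel) = Beta a b"
proof -
  have [measurable]: "f \<in> borel_measurable borel"
    unfolding f_def by measurable
  have "f = (\<lambda>t. if t \<in> {0..1} then t powr (a - 1) * (1 - t) powr (b - 1) else 0)"
    by (rule ext) (auto simp: f_def split: split_indicator)
  then have f: "(f has_integral Beta a b) UNIV"
    by (simp only:) (subst has_integral_restrict_UNIV, rule has_integral_Beta_real[OF assms(1,2)])
  moreover have "f t \<ge> 0" for t
    by (simp add: f_def)
  ultimately show int: "integrable lborel f"
    using nn_integral_has_integral_lborel[of f "Beta a b"]
    by (intro integrableI_nonneg) auto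
  show "(\<integral>t. f t \<partial>lborel) = Beta a b"
    using has_integral_unique[OF has_integral_integral_lborel[OF int] f] .
qed

text \<open>Under \<open>x = 2 t - 1\<close> the factor \<open>1 - x^2\<close> becomes
  \<open>4 t (1 - t)\<close>, so the weight is a multiple of the Beta density with both parameters
  \<open>l + 1/2\<close>.\<close>

lemma integrable_gw:
  assumes "l > 0"
  shows "integrable lborel (gw l)"
proof -
  define a where "a = l + 1/2"
  have a: "a > 0" using assms by (simp add: a_def)
  define b where "b t = indicator {0..1} t * (t powr (a - 1) * (1 - t) powr (a - 1))" for t :: real
  have "integrable lborel b"
    unfolding b_def by (rule beta_weight_lborel(1)[OF a a])
  then have "integrable lborel (\<lambda>x. b (1/2 + 1/2 * x))"
    by (rule lborel_integrable_real_affine) simp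
  then have "integrable lborel (\<lambda>x. 4 powr (a - 1) * b (1/2 + 1/2 * x))"
    by (rule integrable_mult_right)
  moreover have "4 powr (a - 1) * b (1/2 + 1/2 * x) = gw l x" for x
  proof (cases "x \<in> {-1..1}")
    case True
    then have "4 powr (a - 1) * b (1/2 + 1/2 * x) = (4 * ((1/2 + 1/2 * x) * (1/2 - 1/2 * x))) powr (a - 1)"
      by (simp add: b_def powr_mult)
    also have "4 * ((1/2 + 1/2 * x) * (1/2 - 1/2 * x)) = 1 - x\<^sup>2"
      by (simp add: field_simps power2_eq_square)
    finally show ?thesis using True by (simp add: gw_def gegenbauer_weight_def a_def)
  next
    case False
    then show ?thesis by (auto simp: b_def gw_def indicator_def)
  qed
  ultimately show ?thesis by (simp only:)
qed

lemma integrable_mult_gw: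
  fixes g :: "real \<Rightarrow> 'a::{banach, second_countable_topology, real_normed_field}"
  assumes "l > 0" and g: "continuous_on {-1..1} g"
  shows "integrable lborel (\<lambda>x. g x * of_real (gw l x))"
proof -
  obtain B where B: "norm (g x) \<le> B" if "x \<in> {-1..1}" for x
    using compact_continuous_image[OF g, THEN compact_imp_bounded]
    unfolding bounded_iff by (metis compact_Icc image_eqI)
  have m: "(\<lambda>x. indicator {-1..1} x *\<^sub>R g x) \<in> borel_measurable borel"
    using g by (intro borel_measurable_continuous_on_indicator) auto
  have eq: "g x * of_real (gw l x) = (indicator {-1..1} x *\<^sub>R g x) * of_real (gw l x)" for x
    by (auto simp: gw_def indicator_def)
  show ?thesis
  proof (rule Bochner_Integration.integrable_bound)
    show "integrable lborel (\<lambda>x. B * gw l x)"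
      using integrable_gw[OF assms(1)] by simp
    show "(\<lambda>x. g x * of_real (gw l x)) \<in> borel_measurable lborel"
      unfolding eq using m by measurable
    show "AE x in lborel. norm (g x * of_real (gw l x)) \<le> norm (B * gw l x)"
    proof (intro AE_I2)
      fix x show "norm (g x * of_real (gw l x)) \<le> norm (B * gw l x)"
      proof (cases "x \<in> {-1..1}")
        case True
        have "norm (g x) \<le> \<bar>B\<bar>" using B[OF True] by simp
        then show ?thesis by (auto simp: norm_mult abs_mult gw_nonneg intro!: mult_right_mono)
      qed (simp add: gw_eq_0)
    qed
  qed
qed

text \<open>The differential equation in Sturm-Liouville form: the derivative of
  \<open>(1 - x^2)^(l+1/2) C_n'\<close> is \<open>- n (n + 2l)\<close> times \<open>C_n\<close>
  times the weight, and the differentiated function vanishes at both endpoints.\<close>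

lemma gw_integral_geg:
  assumes "l > 0" "n > 0"
  shows "(\<integral>x. poly (geg l n) x * gw l x \<partial>lborel) = 0"
proof -
  define F where "F x = (1 - x\<^sup>2) powr (l + 1/2) * poly (pderiv (geg l n)) x" for x
  define c where "c = - (real n * (real n + 2 * l))"
  have "continuous_on {-1..1} F"
    unfolding F_def using assms
    by (intro continuous_on_mult continuous_on_powr' continuous_intros) (auto simp: abs_square_le_1 abs_le_iff)
  moreover have "(F has_vector_derivative c * (poly (geg l n) x * gegenbauer_weight l x)) (at x)"
    if x: "x \<in> {-1<..<1}" for x
  proof -
    have pos: "1 - x\<^sup>2 > 0" using x by (simp add: abs_square_less_1 abs_less_iff)
    have p: "(1 - x\<^sup>2) powr (l + 1/2) = (1 - x\<^sup>2) * (1 - x\<^sup>2) powr (l - 1/2)"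
      using pos powr_add[of "1 - x\<^sup>2" 1 "l - 1/2"] by (simp add: add.commute)
    have "(F has_real_derivative
        (l + 1/2) * (1 - x\<^sup>2) powr (l + 1/2 - 1) * (- 2 * x) * poly (pderiv (geg l n)) x +
        (1 - x\<^sup>2) powr (l + 1/2) * poly (pderiv (pderiv (geg l n))) x) (at x)"
      unfolding F_def using pos
      by (auto intro!: derivative_eq_intros poly_DERIV simp: powr_diff)
    also have "(l + 1/2) * (1 - x\<^sup>2) powr (l + 1/2 - 1) * (- 2 * x) * poly (pderiv (geg l n)) x +
        (1 - x\<^sup>2) powr (l + 1/2) * poly (pderiv (pderiv (geg l n))) x
        = (1 - x\<^sup>2) powr (l - 1/2) * ((1 - x\<^sup>2) * poly (pderiv (pderiv (geg l n))) x
            - (2 * l + 1) * x * poly (pderiv (geg l n)) x)"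
      unfolding p by (simp add: algebra_simps)
    also have "\<dots> = c * (poly (geg l n) x * gegenbauer_weight l x)"
      unfolding geg_ode by (simp add: c_def gegenbauer_weight_def)
    finally show ?thesis by (simp add: has_real_derivative_iff_has_vector_derivative)
  qed
  \<comment> \<open>For \<open>l < 1/2\<close> the weight is unbounded near the endpoints, so at the
    endpoints themselves only continuity of \<open>F\<close> is used.\<close>
  ultimately have "((\<lambda>x. c * (poly (geg l n) x * gegenbauer_weight l x)) has_integral F 1 - F (-1)) {-1..1}"
    by (intro fundamental_theorem_of_calculus_interior) auto
  then have *: "((\<lambda>x. c * (poly (geg l n) x * gw l x)) has_integral 0) UNIV"
  proof -
    assume "((\<lambda>x. c * (poly (geg l n) x * gegenbauer_weight l x)) has_integral F 1 - F (-1)) {-1..1}"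
    moreover have "(\<lambda>x. c * (poly (geg l n) x * gw l x)) =
        (\<lambda>x. if x \<in> {-1..1} then c * (poly (geg l n) x * gegenbauer_weight l x) else 0)"
      by (rule ext) (auto simp: gw_def split: split_indicator)
    moreover have "F 1 - F (-1) = 0" by (simp add: F_def)
    ultimately show ?thesis
      by (simp only:) (subst has_integral_restrict_UNIV, assumption)
  qed
  have int: "integrable lborel (\<lambda>x. poly (geg l n) x * gw l x)"
    using integrable_mult_gw[OF assms(1), of "poly (geg l n)"] by (simp add: continuous_intros)
  have "integrable lborel (\<lambda>x. c * (poly (geg l n) x * gw l x))"
    using int by (rule integrable_mult_right)
  then have "((\<lambda>x. c * (poly (geg l n) x * gw l x)) has_integral
      (\<integral>x. c * (poly (geg l n) x * gw l x) \<partial>lborel)) UNIV"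
    by (rule has_integral_integral_lborel)
  with * have "(\<integral>x. c * (poly (geg l n) x * gw l x) \<partial>lborel) = 0"
    using has_integral_unique by blast
  then show ?thesis
    using assms by (simp add: c_def add_pos_pos less_imp_neq[symmetric])
qed

definition gip :: "real \<Rightarrow> (real \<Rightarrow> real) \<Rightarrow> real" where
  "gip l f = (\<integral>x. f x * gw l x \<partial>lborel)"

lemma gip_linear:
  assumes "l > 0" "continuous_on UNIV f" "continuous_on UNIV g"
  shows "gip l (\<lambda>x. a * f x + b * g x) = a * gip l f + b * gip l g"
proof -
  have "integrable lborel (\<lambda>x. f x * gw l x)" "integrable lborel (\<lambda>x. g x * gw l x)"
    using integrable_mult_gw[OF assms(1) continuous_on_subset[OF assms(2)]]
      integrable_mult_gw[OF assms(1) continuous_on_subset[OF assms(3)]] by simp_all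
  then show ?thesis by (simp add: gip_def distrib_right mult.assoc)
qed

lemma gip_x_geg:
  assumes "l > 0" "continuous_on UNIV f"
  shows "2 * (real n + l) * gip l (\<lambda>x. f x * x * poly (geg l n) x) =
     (real n + 1) * gip l (\<lambda>x. f x * poly (geg l (Suc n)) x)
     + (real n + 2 * l - 1) * (if n = 0 then 0 else gip l (\<lambda>x. f x * poly (geg l (n - 1)) x))"
proof -
  have c: "continuous_on UNIV (\<lambda>x. f x * poly p x)" "continuous_on UNIV (\<lambda>x. f x * x * poly p x)" for p
    using assms by (intro continuous_intros; simp)+
  have "2 * (real n + l) * gip l (\<lambda>x. f x * x * poly (geg l n) x)
      = gip l (\<lambda>x. 2 * (real n + l) * (f x * x * poly (geg l n) x) + 0 * f x)"
    using assms c by (subst gip_linear) auto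
  also have "(\<lambda>x. 2 * (real n + l) * (f x * x * poly (geg l n) x) + 0 * f x)
     = (\<lambda>x. (real n + 1) * (f x * poly (geg l (Suc n)) x)
        + (if n = 0 then 0 else (real n + 2 * l - 1)) * (f x * poly (geg l (n - 1)) x))"
  proof
    fix x
    show "2 * (real n + l) * (f x * x * poly (geg l n) x) + 0 * f x =
       (real n + 1) * (f x * poly (geg l (Suc n)) x)
        + (if n = 0 then 0 else (real n + 2 * l - 1)) * (f x * poly (geg l (n - 1)) x)"
      using arg_cong[OF x_mult_geg[of n l x], of "\<lambda>y. f x * y"]
      by (cases "n = 0") (simp_all add: algebra_simps del: geg.simps(3))
  qed
  also have "gip l \<dots> = (real n + 1) * gip l (\<lambda>x. f x * poly (geg l (Suc n)) x)
        + (if n = 0 then 0 else (real n + 2 * l - 1)) * gip l (\<lambda>x. f x * poly (geg l (n - 1)) x)"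
    by (rule gip_linear) (use assms c in auto)
  finally show ?thesis by simp
qed

text \<open>Induction on the lower index with \<open>n\<close> free: the factor \<open>x\<close> in
  the recurrence for \<open>C_(m+2)\<close> is moved over to \<open>C_n\<close>, where it produces
  \<open>C_(n+1)\<close> and \<open>C_(n-1)\<close>, and both indices still exceed
  \<open>m + 1\<close>.\<close>

lemma geg_orth_less:
  assumes "l > 0" "m < n"
  shows "gip l (\<lambda>x. poly (geg l m) x * poly (geg l n) x) = 0"
  using assms(2)
proof (induction m arbitrary: n rule: induct_nat_012)
  case 0
  then show ?case using gw_integral_geg[OF assms(1), of n] by (simp add: gip_def)
next
  case 1
  have "2 * (real n + l) * gip l (\<lambda>x. 1 * x * poly (geg l n) x) = 0"
    unfolding gip_x_geg[OF assms(1) continuous_on_const]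
    using 1 gw_integral_geg[OF assms(1)] by (auto simp: gip_def simp del: geg.simps(3))
  then have "gip l (\<lambda>x. x * poly (geg l n) x) = 0"
    using assms(1) by simp
  moreover have "gip l (\<lambda>x. 2 * l * (x * poly (geg l n) x) + 0 * x)
       = 2 * l * gip l (\<lambda>x. x * poly (geg l n) x) + 0 * gip l (\<lambda>x. x)"
    by (rule gip_linear) (use assms in \<open>auto intro!: continuous_intros\<close>)
  ultimately show ?case by (simp add: algebra_simps)
next
  case (ge2 m)
  let ?M = "\<lambda>x. poly (geg l m) x * poly (geg l n) x"
  let ?X = "\<lambda>x. poly (geg l (Suc m)) x * x * poly (geg l n) x"
  have "2 * (real n + l) * gip l ?X = 0"
    by (subst gip_x_geg) (use assms ge2 in \<open>auto intro!: continuous_intros simp del: geg.simps(3)\<close>)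
  then have X: "gip l ?X = 0"
    using assms(1) by simp
  have "gip l (\<lambda>x. poly (geg l (Suc (Suc m))) x * poly (geg l n) x)
     = gip l (\<lambda>x. 2 * (real m + 1 + l) / (real m + 2) * ?X x
           + - ((real m + 2 * l) / (real m + 2)) * ?M x)"
    by (rule arg_cong[of _ _ "gip l"])
       (auto simp: diff_divide_distrib algebra_simps divide_inverse)
  also have "\<dots> = 2 * (real m + 1 + l) / (real m + 2) * gip l ?X
           + - ((real m + 2 * l) / (real m + 2)) * gip l ?M"
    by (rule gip_linear) (use assms in \<open>auto intro!: continuous_intros\<close>)
  also have "\<dots> = 0"
    using X ge2 by simp
  finally show ?case .
qed

lemma geg_orth:
  assumes "l > 0" "m \<noteq> n"
  shows "gip l (\<lambda>x. poly (geg l m) x * poly (geg l n) x) = 0"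
  using geg_orth_less[OF assms(1), of m n] geg_orth_less[OF assms(1), of n m] assms(2)
  by (cases "m < n") (auto simp: mult.commute)

lemma gip_set_integral:
  "(LINT x:{-1..1}|lborel. f x * gegenbauer_weight l x) = gip l f"
  unfolding gip_def set_lebesgue_integral_def gw_def
  by (intro Bochner_Integration.integral_cong) auto

text \<open>A vanishing integral would make \<open>p^2\<close> times the weight zero almost
  everywhere; off the finitely many roots this contradicts the positive weight on the open
  interval.\<close>

lemma gip_square_pos:
  assumes "l > 0" "p \<noteq> 0"
  shows "gip l (\<lambda>x. (poly p x)\<^sup>2) > 0"
proof -
  have int: "integrable lborel (\<lambda>x. (poly p x)\<^sup>2 * gw l x)"
    using integrable_mult_gw[OF assms(1), of "\<lambda>x. (poly p x)\<^sup>2"] by (simp add: continuous_intros)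
  have nn: "gip l (\<lambda>x. (poly p x)\<^sup>2) \<ge> 0"
    unfolding gip_def by (intro integral_nonneg_AE) (auto simp: gw_nonneg)
  moreover have "gip l (\<lambda>x. (poly p x)\<^sup>2) \<noteq> 0"
  proof
    assume "gip l (\<lambda>x. (poly p x)\<^sup>2) = 0"
    then have "AE x in lborel. (poly p x)\<^sup>2 * gw l x = 0"
      using int unfolding gip_def
      by (subst (asm) integral_nonneg_eq_0_iff_AE) (auto simp: gw_nonneg)
    moreover have "AE x in lborel. x \<notin> {x. poly p x = 0}"
      using poly_roots_finite[OF assms(2)]
      by (intro AE_not_in) (auto simp: null_sets_def intro: emeasure_lborel_countable countable_finite
          intro!: borel_closed finite_imp_closed)
    ultimately have "AE x in lborel. x \<notin> {-1<..<1::real}"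
    proof eventually_elim
      case (elim x)
      show ?case
      proof
        assume x: "x \<in> {-1<..<1}"
        then have "1 - x\<^sup>2 > 0" by (simp add: abs_square_less_1 abs_less_iff)
        with x have "gw l x > 0" by (auto simp: gw_def gegenbauer_weight_def)
        with elim show False by auto
      qed
    qed
    then have "emeasure lborel {-1<..<1::real} = 0"
      by (subst (asm) AE_iff_measurable[OF _ refl]) (auto simp: greaterThanLessThan_def Int_def)
    then show False by simp
  qed
  ultimately show ?thesis by simp
qed

text \<open>Strong induction on the degree, subtracting the multiple of \<open>C_d\<close> that
  removes the leading term, in place of an expansion of \<open>p\<close> in the basis
  \<open>C\<close>. The assumption \<open>C 0 \<noteq> 0\<close> excludes the zero polynomial, which
  also has degree 0.\<close>

lemma orth_lower_degree:
  assumes "l > 0" and deg: "\<And>n. degree (C n) = n"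
    and orth: "\<And>m. m < n \<Longrightarrow> gip l (\<lambda>x. poly (C m) x * poly q x) = 0" and "C 0 \<noteq> 0"
  shows "degree p < n \<Longrightarrow> gip l (\<lambda>x. poly p x * poly q x) = 0"
proof (induction "degree p" arbitrary: p rule: less_induct)
  case less
  let ?d = "degree p"
  have nz: "coeff (C ?d) ?d \<noteq> 0"
    using deg[of ?d] assms(4) by (cases "?d = 0") (metis degree_0 leading_coeff_0_iff)+
  define a where "a = coeff p ?d / coeff (C ?d) ?d"
  define r where "r = p - smult a (C ?d)"
  have r0: "coeff r ?d = 0" using nz by (simp add: r_def a_def)
  have rd: "degree r \<le> ?d"
    unfolding r_def by (intro degree_diff_le) (auto simp: deg)
  have "gip l (\<lambda>x. poly r x * poly q x) = 0"
  proof (cases "r = 0")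
    case False
    with r0 rd have "degree r < ?d" by (metis le_neq_implies_less leading_coeff_0_iff)
    with less show ?thesis by simp
  qed (simp add: gip_def)
  moreover have "gip l (\<lambda>x. poly (C ?d) x * poly q x) = 0"
    using orth less.prems by simp
  moreover have "gip l (\<lambda>x. 1 * (poly r x * poly q x) + a * (poly (C ?d) x * poly q x))
      = 1 * gip l (\<lambda>x. poly r x * poly q x) + a * gip l (\<lambda>x. poly (C ?d) x * poly q x)"
    by (rule gip_linear) (use assms in \<open>auto intro!: continuous_intros\<close>)
  ultimately show ?case by (simp add: r_def algebra_simps)
qed

lemma is_gegenbauer_family_geg:
  assumes "l > 0"
  shows "is_gegenbauer_family l (geg l)"
proof -
  have "2 * l \<notin> \<int>\<^sub>\<le>\<^sub>0"
    using assms by (auto elim!: nonpos_Ints_cases)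
  then have "pochhammer (2 * l) n = Gamma (real n + 2 * l) / Gamma (2 * l)" for n
    by (simp add: pochhammer_Gamma add_ac)
  then show ?thesis
    unfolding is_gegenbauer_family_def gip_set_integral
    using geg_orth[OF assms] degree_geg[OF assms] by (simp add: geg_at_1)
qed

text \<open>With leading coefficients matched, \<open>r = C_n - a * geg_n\<close> has degree below
  \<open>n\<close> and is orthogonal to both of its terms, hence to itself, and is zero. The value
  at 1 then forces \<open>a = 1\<close>.\<close>

lemma is_gegenbauer_family_unique:
  assumes "l > 0" "is_gegenbauer_family l C"
  shows "C = geg l"
proof
  fix n
  note C = assms(2)[unfolded is_gegenbauer_family_def gip_set_integral]
  have at1: "poly (C n) 1 = poly (geg l n) 1" for n
    using C is_gegenbauer_family_geg[OF assms(1)] by (simp add: is_gegenbauer_family_def)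
  have at1pos: "poly (geg l n) 1 > 0"
    using assms(1) by (simp add: geg_at_1 pochhammer_pos)
  have C0: "C 0 \<noteq> 0" using at1[of 0] by auto
  have deg: "degree (C n) = n" for n using C by blast
  define a where "a = coeff (C n) n / coeff (geg l n) n"
  define r where "r = C n - smult a (geg l n)"
  have "r = 0"
  proof (rule ccontr)
    assume r: "r \<noteq> 0"
    have r0: "coeff r n = 0" using degree_geg[OF assms(1), of n] by (simp add: r_def a_def)
    have rd: "degree r \<le> n"
      unfolding r_def using deg degree_geg[OF assms(1)] by (intro degree_diff_le) auto
    have dr: "degree r < n"
      using r r0 rd by (metis le_neq_implies_less leading_coeff_0_iff)
    have "gip l (\<lambda>x. poly r x * poly (C n) x) = 0"
      by (rule orth_lower_degree[where C = C and n = n]) (use assms(1) C C0 dr in auto)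
    moreover have "gip l (\<lambda>x. poly r x * poly (geg l n) x) = 0"
      by (rule orth_lower_degree[where C = "geg l" and n = n])
         (use assms(1) geg_orth[OF assms(1)] degree_geg[OF assms(1)] dr in auto)
    moreover have "gip l (\<lambda>x. 1 * (poly r x * poly (C n) x) + (- a) * (poly r x * poly (geg l n) x))
      = 1 * gip l (\<lambda>x. poly r x * poly (C n) x) + (- a) * gip l (\<lambda>x. poly r x * poly (geg l n) x)"
      by (rule gip_linear) (use assms in \<open>auto intro!: continuous_intros\<close>)
    moreover have "(\<lambda>x. 1 * (poly r x * poly (C n) x) + (- a) * (poly r x * poly (geg l n) x)) = (\<lambda>x. (poly r x)\<^sup>2)"
      by (auto simp: r_def algebra_simps power2_eq_square)
    ultimately have "gip l (\<lambda>x. (poly r x)\<^sup>2) = 0" by simp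
    with gip_square_pos[OF assms(1) r] show False by simp
  qed
  then have eq: "C n = smult a (geg l n)" by (simp add: r_def)
  with at1[of n] at1pos have "a = 1" by simp
  with eq show "C n = geg l n" by simp
qed

lemma gegenbauer_eq_geg:
  assumes "l > 0"
  shows "gegenbauer l = geg l"
  unfolding gegenbauer_def
  using is_gegenbauer_family_geg[OF assms] is_gegenbauer_family_unique[OF assms] by blast

section \<open>Chebyshev polynomials of the second kind in the Gegenbauer basis\<close>

text \<open>Polymorphic, because the same recursion is used at real points of \<open>[-1,1]\<close>
  and at complex points of the ellipse.\<close>

fun chebU :: "nat \<Rightarrow> 'a::comm_ring_1 \<Rightarrow> 'a" where
  "chebU 0 x = 1"
| "chebU (Suc 0) x = 2 * x"
| "chebU (Suc (Suc n)) x = 2 * x * chebU (Suc n) x - chebU n x"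

lemma of_real_chebU:
  "of_real (chebU n x) = (chebU n (of_real x) :: 'a :: {real_algebra_1, comm_ring_1})"
  by (induction n rule: induct_nat_012) auto

lemma continuous_on_chebU [continuous_intros]:
  fixes f :: "'b::topological_space \<Rightarrow> 'a::{real_normed_algebra_1, comm_ring_1}"
  assumes "continuous_on S f"
  shows "continuous_on S (\<lambda>x. chebU n (f x))"
  by (induction n rule: induct_nat_012) (auto intro!: continuous_intros assms)

text \<open>The division-free form of \<open>(u^(n+1) - u^(-n-1)) / (u - 1/u)\<close>. It also holds
  at \<open>u = 1\<close> and \<open>u = -1\<close>, so the endpoints of \<open>[-1,1]\<close> need
  no separate treatment.\<close>

lemma chebU_joukowski_sum:
  fixes u :: "'a::field_char_0"
  assumes "u \<noteq> 0"
  shows "chebU n ((u + inverse u) / 2) = (\<Sum>j\<le>n. u ^ j * inverse u ^ (n - j))"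
proof -
  define S where "S n = (\<Sum>j\<le>n. u ^ j * inverse u ^ (n - j))" for n
  \<comment> \<open>Splitting off the last or the first summand gives two one-step recurrences, and
    their combination is the three-term one.\<close>
  have S1: "S (Suc n) = inverse u * S n + u ^ Suc n" for n
    by (simp add: S_def sum_distrib_left Suc_diff_le mult_ac)
  have S2: "S (Suc n) = u * S n + inverse u ^ Suc n" for n
    unfolding S_def sum.atMost_Suc_shift by (simp add: sum_distrib_left mult_ac)
  have "chebU n ((u + inverse u) / 2) = S n"
  proof (induction n rule: induct_nat_012)
    case (ge2 n)
    have "S (Suc (Suc n)) = (u + inverse u) * S (Suc n) - (u * S (Suc n) - u ^ Suc (Suc n))"
      using S1[of "Suc n"] by (simp add: algebra_simps)
    also have "u * S (Suc n) - u ^ Suc (Suc n) = S n"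
      unfolding S1[of n] using assms by (simp add: algebra_simps)
    finally show ?case by (simp add: ge2)
  qed (use S1[of 0] in \<open>auto simp: S_def\<close>)
  then show ?thesis by (simp add: S_def)
qed

lemma chebU_joukowski:
  fixes u :: "'a::field_char_0"
  assumes "u \<noteq> 0"
  shows "(u - inverse u) * chebU n ((u + inverse u) / 2) = u ^ Suc n - inverse u ^ Suc n"
proof -
  let ?v = "inverse u"
  have "u ^ Suc n - ?v ^ Suc n = (u - ?v) * (\<Sum>j<Suc n. ?v ^ (Suc n - Suc j) * u ^ j)"
    by (rule power_diff_sumr2)
  then show ?thesis
    unfolding chebU_joukowski_sum[OF assms] lessThan_Suc_atMost by (simp add: mult_ac)
qed

text \<open>With \<open>x = cos t\<close> and \<open>u = e^(it)\<close> each of the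
  \<open>n + 1\<close> summands has modulus 1.\<close>

lemma abs_chebU_le:
  fixes x :: real
  assumes "x \<in> {-1..1}"
  shows "\<bar>chebU n x\<bar> \<le> real n + 1"
proof -
  define u where "u = cis (arccos x)"
  have u: "norm u = 1" "u \<noteq> 0" by (auto simp: u_def)
  have "(u + inverse u) / 2 = of_real (cos (arccos x))"
    unfolding u_def by (simp add: complex_eq_iff)
  then have x: "(u + inverse u) / 2 = of_real x"
    using assms by simp
  have "\<bar>chebU n x\<bar> = norm (chebU n (of_real x :: complex))"
    by (simp flip: of_real_chebU)
  also have "\<dots> \<le> (\<Sum>j\<le>n. norm (u ^ j * inverse u ^ (n - j)))"
    unfolding x[symmetric] chebU_joukowski_sum[OF u(2)] by (rule norm_sum)
  also have "\<dots> = real n + 1"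
    using u by (simp add: norm_mult norm_power norm_inverse)
  finally show ?thesis .
qed

text \<open>The bound on \<open>U_m\<close> gives absolute convergence, and the three-term
  recurrence gives a linear equation for the sum.\<close>

lemma chebU_generating:
  fixes v :: complex
  assumes "x \<in> {-1..1}" "norm v < 1"
  shows "(\<lambda>m. of_real (chebU m x) * v ^ m) sums (1 / (1 - 2 * of_real x * v + v\<^sup>2))"
proof -
  define s where "s m = of_real (chebU m x) * v ^ m" for m
  have "summable (\<lambda>m. of_nat (Suc m) * norm v ^ m)"
    using geometric_deriv_sums[of "norm v"] assms(2) by (simp add: sums_iff)
  then have "summable s"
  proof (rule summable_comparison_test'[where N = 0])
    fix m show "norm (s m) \<le> of_nat (Suc m) * norm v ^ m"
      unfolding s_def norm_mult norm_power norm_of_real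
      using abs_chebU_le[OF assms(1), of m] by (intro mult_right_mono) auto
  qed
  then obtain S where S: "s sums S" by (auto simp: summable_def)
  then have S1: "(\<lambda>m. s (Suc m)) sums (S - 1)"
    by (subst sums_Suc_iff) (simp add: s_def)
  then have S2: "(\<lambda>m. s (Suc (Suc m))) sums (S - 1 - 2 * of_real x * v)"
    by (subst sums_Suc_iff) (simp add: s_def)
  have "(\<lambda>m. 2 * of_real x * v * s (Suc m) - v\<^sup>2 * s m) sums (2 * of_real x * v * (S - 1) - v\<^sup>2 * S)"
    by (intro sums_diff sums_mult S S1)
  moreover have "2 * of_real x * v * s (Suc m) - v\<^sup>2 * s m = s (Suc (Suc m))" for m
    by (simp add: s_def algebra_simps power2_eq_square)
  ultimately have "S - 1 - 2 * of_real x * v = 2 * of_real x * v * (S - 1) - v\<^sup>2 * S"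
    using S2 sums_unique2 by (simp only:) blast
  then have "S * (1 - 2 * of_real x * v + v\<^sup>2) = 1" by algebra
  \<comment> \<open>The preceding equation itself shows that the denominator is nonzero.\<close>
  then have "S = 1 / (1 - 2 * of_real x * v + v\<^sup>2)"
    by (metis eq_divide_eq mult_zero_right zero_neq_one)
  with S show ?thesis by (simp add: s_def[abs_def])
qed

lemma cauchy_kernel_expansion:
  fixes u :: complex
  assumes "x \<in> {-1..1}" "norm u > 1"
  shows "(\<lambda>m. 2 * inverse u ^ Suc m * of_real (chebU m x)) sums (1 / ((u + inverse u) / 2 - of_real x))"
proof -
  have u: "u \<noteq> 0" "norm (inverse u) < 1"
    using assms by (auto simp: norm_inverse inverse_less_1_iff)
  have "(\<lambda>m. 2 * inverse u * (of_real (chebU m x) * inverse u ^ m)) sums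
      (2 * inverse u * (1 / (1 - 2 * of_real x * inverse u + (inverse u)\<^sup>2)))"
    by (intro sums_mult chebU_generating assms u)
  moreover have "2 * inverse u * (1 / (1 - 2 * of_real x * inverse u + (inverse u)\<^sup>2))
      = 1 / ((u + inverse u) / 2 - of_real x)"
  proof -
    have "1 - 2 * of_real x * inverse u + (inverse u)\<^sup>2 = 2 * inverse u * ((u + inverse u) / 2 - of_real x)"
      using u(1) by (simp add: field_simps power2_eq_square)
    then show ?thesis using u(1) by simp
  qed
  ultimately show ?thesis by (simp add: mult_ac)
qed

definition geg_h :: "real \<Rightarrow> nat \<Rightarrow> real" where
  "geg_h l n = gip l (\<lambda>x. (poly (geg l n) x)\<^sup>2)"

lemma geg_h_pos: "l > 0 \<Longrightarrow> geg_h l n > 0"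
  unfolding geg_h_def by (rule gip_square_pos) (use degree_geg[of l n] in auto)

lemma gegenbauer_h_eq: "l > 0 \<Longrightarrow> gegenbauer_h l n = geg_h l n"
  by (simp add: gegenbauer_h_def gegenbauer_eq_geg gip_set_integral geg_h_def)

text \<open>The integral of \<open>x C_n C_(n+1)\<close> against the weight is evaluated twice, with
  \<open>x\<close> acting on either factor; orthogonality leaves one squared norm each time.
  \<open>(n + l) h_n\<close> is kept as a unit because it is the factor in
  \<open>cheb_geg_closed\<close>.\<close>

lemma geg_h_rec:
  assumes "l > 0"
  shows "(real n + 1) * ((real n + 1 + l) * geg_h l (Suc n)) = (real n + 2 * l) * ((real n + l) * geg_h l n)"
proof -
  have "2 * (real (Suc n) + l) * gip l (\<lambda>x. poly (geg l n) x * x * poly (geg l (Suc n)) x)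
      = (real n + 2 * l) * geg_h l n"
    by (subst gip_x_geg)
       (use assms geg_orth[OF assms] in \<open>auto intro!: continuous_intros simp: geg_h_def power2_eq_square simp del: geg.simps(3)\<close>)
  moreover have "2 * (real n + l) * gip l (\<lambda>x. poly (geg l (Suc n)) x * x * poly (geg l n) x)
      = (real n + 1) * geg_h l (Suc n)"
    by (subst gip_x_geg)
       (use assms geg_orth[OF assms] in \<open>auto intro!: continuous_intros simp: geg_h_def power2_eq_square simp del: geg.simps(3)\<close>)
  moreover have "(\<lambda>x. poly (geg l (Suc n)) x * x * poly (geg l n) x) = (\<lambda>x. poly (geg l n) x * x * poly (geg l (Suc n)) x)"
    by auto
  moreover define X where "X = gip l (\<lambda>x. poly (geg l n) x * x * poly (geg l (Suc n)) x)"
  ultimately have "2 * (1 + real n + l) * X = (real n + 2 * l) * geg_h l n"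
    "2 * (real n + l) * X = (real n + 1) * geg_h l (Suc n)"
    by simp_all
  then show ?thesis by algebra
qed

section \<open>Connection coefficients between the Chebyshev and Gegenbauer bases\<close>

text \<open>Up to the factor \<open>(n + l) h_n\<close> this is the integral of
  \<open>U_(n+2k) C_n\<close> against the weight. For \<open>l = 1\<close> the factor
  \<open>pochhammer (1 - l) k\<close> vanishes when \<open>k > 0\<close>, as it must since then
  \<open>C_n = U_n\<close>.\<close>

definition conn :: "real \<Rightarrow> nat \<Rightarrow> nat \<Rightarrow> real" where
  "conn l n k = fact (n + k) * pochhammer (1 - l) k / (fact k * pochhammer l (n + k + 1))"

text \<open>The diagonal case of the recurrence for \<open>cheb_geg_closed\<close>, where two of its
  four terms vanish.\<close>

lemma conn_0_rec:
  assumes "l > 0"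
  shows "(real (Suc n) + l) * conn l (Suc n) 0 = real (Suc n) * conn l n 0"
proof -
  have "pochhammer l (n + 1) > 0" using assms by (intro pochhammer_pos)
  then show ?thesis
    using assms by (simp add: conn_def pochhammer_Suc divide_simps)
qed

lemma conn_rec:
  assumes "l > 0"
  shows "(real n + l) * (conn l n (Suc k) + conn l n k)
    = (real n + 2 * l) * conn l (Suc n) k + real n * conn l (n - 1) (Suc k)"
proof -
  have a: "pochhammer l (n + Suc k + 1) = pochhammer l (n + k + 1) * (l + real n + real k + 1)"
    "pochhammer l (Suc n + k + 1) = pochhammer l (n + k + 1) * (l + real n + real k + 1)"
    "pochhammer (1 - l) (Suc k) = pochhammer (1 - l) k * (1 - l + real k)"
    "fact (n + Suc k) = (real n + real k + 1) * fact (n + k)"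
    "fact (Suc n + k) = (real n + real k + 1) * fact (n + k)"
    "fact (Suc k) = (real k + 1) * fact k"
    by (simp_all add: pochhammer_Suc add_ac)
  have nz: "l + real n + real k + 1 \<noteq> 0" "real k + 1 \<noteq> 0" "fact k \<noteq> (0::real)" "pochhammer l (n + k + 1) \<noteq> 0"
    using assms pochhammer_pos[OF assms, of "n + k + 1"] by auto
  \<comment> \<open>The factor \<open>real n\<close> makes the truncated subtraction harmless: it is
    0 exactly where \<open>n - 1\<close> is not a predecessor.\<close>
  have c: "real n * conn l (n - 1) (Suc k) = real n * (fact (n + k) * (pochhammer (1 - l) k * (1 - l + real k))
      / ((real k + 1) * fact k * pochhammer l (n + k + 1)))"
    by (cases n) (simp_all add: conn_def pochhammer_Suc)
  show ?thesis
    unfolding c unfolding conn_def a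
    using nz by (simp add: divide_simps) (simp add: algebra_simps)
qed

definition cheb_geg :: "real \<Rightarrow> nat \<Rightarrow> nat \<Rightarrow> real" where
  "cheb_geg l m n = gip l (\<lambda>x. chebU m x * poly (geg l n) x)"

lemma cheb_geg_rec:
  assumes "l > 0"
  shows "(real n + l) * (cheb_geg l (Suc (Suc m)) n + cheb_geg l m n) =
    (real n + 1) * cheb_geg l (Suc m) (Suc n)
    + (real n + 2 * l - 1) * (if n = 0 then 0 else cheb_geg l (Suc m) (n - 1))"
proof -
  have "cheb_geg l (Suc (Suc m)) n + cheb_geg l m n
      = gip l (\<lambda>x. 1 * (chebU (Suc (Suc m)) x * poly (geg l n) x) + 1 * (chebU m x * poly (geg l n) x))"
    unfolding cheb_geg_def by (subst gip_linear) (use assms in \<open>auto intro!: continuous_intros simp del: chebU.simps(3)\<close>)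
  also have "\<dots> = gip l (\<lambda>x. 2 * (chebU (Suc m) x * x * poly (geg l n) x) + 0 * x)"
    by (simp add: algebra_simps)
  also have "\<dots> = 2 * gip l (\<lambda>x. chebU (Suc m) x * x * poly (geg l n) x) + 0 * gip l (\<lambda>x. x)"
    by (rule gip_linear) (use assms in \<open>auto intro!: continuous_intros\<close>)
  finally have "(real n + l) * (cheb_geg l (Suc (Suc m)) n + cheb_geg l m n)
      = 2 * (real n + l) * gip l (\<lambda>x. chebU (Suc m) x * x * poly (geg l n) x)"
    by simp
  also note gip_x_geg[OF assms]
  finally show ?thesis
    unfolding cheb_geg_def[of l "Suc m"] by (simp add: continuous_on_chebU del: geg.simps chebU.simps)
qed

lemma cheb_geg_1:
  assumes "l > 0"
  shows "(real n + l) * cheb_geg l 1 n =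
    (real n + 1) * cheb_geg l 0 (Suc n) + (real n + 2 * l - 1) * (if n = 0 then 0 else cheb_geg l 0 (n - 1))"
proof -
  have "cheb_geg l 1 n = gip l (\<lambda>x. 2 * (chebU 0 x * x * poly (geg l n) x) + 0 * x)"
    by (simp add: cheb_geg_def algebra_simps)
  also have "\<dots> = 2 * gip l (\<lambda>x. chebU 0 x * x * poly (geg l n) x) + 0 * gip l (\<lambda>x. x)"
    by (rule gip_linear) (use assms in \<open>auto intro!: continuous_intros\<close>)
  finally have "(real n + l) * cheb_geg l 1 n = 2 * (real n + l) * gip l (\<lambda>x. chebU 0 x * x * poly (geg l n) x)"
    by simp
  also note gip_x_geg[OF assms]
  finally show ?thesis
    unfolding cheb_geg_def[of l 0] by (simp add: continuous_on_chebU)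
qed

text \<open>The two reasons for the value 0: \<open>C_n\<close> is orthogonal to lower degrees, and
  \<open>U_m\<close> and \<open>C_n\<close> have opposite parity when \<open>m - n\<close> is
  odd.\<close>

definition cheb_geg_closed :: "real \<Rightarrow> nat \<Rightarrow> nat \<Rightarrow> real" where
  "cheb_geg_closed l m n =
     (if n \<le> m \<and> even (m - n) then (real n + l) * geg_h l n * conn l n ((m - n) div 2) else 0)"

text \<open>With \<open>g n = (n + l) h_n\<close>, the relation
  \<open>(n + 1) g (n + 1) = (n + 2l) g n\<close> makes all four terms multiples of
  \<open>g n\<close>. What remains is \<open>conn_rec\<close>, and \<open>conn_0_rec\<close> on the
  diagonal \<open>k = 0\<close>.\<close>

lemma cheb_geg_closed_rec:
  assumes "l > 0"
  shows "(real n + l) * (cheb_geg_closed l (Suc (Suc m)) n + cheb_geg_closed l m n) =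
    (real n + 1) * cheb_geg_closed l (Suc m) (Suc n)
    + (real n + 2 * l - 1) * (if n = 0 then 0 else cheb_geg_closed l (Suc m) (n - 1))"
proof -
  define g where "g n = (real n + l) * geg_h l n" for n
  have E: "cheb_geg_closed l (n + 2 * k) n = g n * conn l n k" for n k
    by (simp add: cheb_geg_closed_def g_def)
  have E0: "cheb_geg_closed l m n = 0" if "\<And>k. m \<noteq> n + 2 * k" for m n
    using that[of "(m - n) div 2"] by (auto simp: cheb_geg_closed_def)
  have g: "(real n + 1) * g (Suc n) = (real n + 2 * l) * g n" for n
    using geg_h_rec[OF assms, of n] by (simp add: g_def add_ac)
  show ?thesis
  proof (cases "\<exists>k. Suc (Suc m) = n + 2 * k")
    case False
    then have "cheb_geg_closed l (Suc (Suc m)) n = 0" "cheb_geg_closed l m n = 0"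
      "cheb_geg_closed l (Suc m) (Suc n) = 0" "n > 0 \<Longrightarrow> cheb_geg_closed l (Suc m) (n - 1) = 0"
      by (intro E0; presburger)+
    then show ?thesis by auto
  next
    case True
    then obtain k where k: "Suc (Suc m) = n + 2 * k" by blast
    then have e1: "cheb_geg_closed l (Suc (Suc m)) n = g n * conn l n k"
      by (simp only: E)
    have e2: "(real n + 2 * l - 1) * (if n = 0 then 0 else cheb_geg_closed l (Suc m) (n - 1))
        = real n * g n * conn l (n - 1) k"
    proof (cases n)
      case (Suc j)
      with k have "Suc m = j + 2 * k" by simp
      then have "cheb_geg_closed l (Suc m) (n - 1) = g j * conn l j k"
        using Suc by (simp only: E diff_Suc_1)
      with g[of j] Suc show ?thesis by (simp add: add_ac)
    qed simp
    show ?thesis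
    proof (cases k)
      case 0
      then obtain j where j: "n = Suc j" using k by (cases n) auto
      have "cheb_geg_closed l m n = 0" "cheb_geg_closed l (Suc m) (Suc n) = 0"
        using 0 k by (auto simp: cheb_geg_closed_def)
      with 0 show ?thesis
        unfolding e1 e2 using conn_0_rec[OF assms, of j] by (simp add: j del: of_nat_Suc)
    next
      case (Suc k')
      have "m = n + 2 * k'" "Suc m = Suc n + 2 * k'" using k Suc by auto
      then have "cheb_geg_closed l m n = g n * conn l n k'"
        "cheb_geg_closed l (Suc m) (Suc n) = g (Suc n) * conn l (Suc n) k'"
        by (simp_all only: E)
      with g[of n] conn_rec[OF assms, of n k'] show ?thesis
        unfolding e1 e2 Suc by algebra
    qed
  qed
qed

text \<open>Both sides satisfy the same recurrence in \<open>m\<close> and agree in the rows 0 and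
  1; \<open>n\<close> stays quantified because the recurrence links neighbouring columns.\<close>

lemma cheb_geg_eq_closed:
  assumes "l > 0"
  shows "cheb_geg l m n = cheb_geg_closed l m n"
proof -
  have 0: "cheb_geg l 0 n = cheb_geg_closed l 0 n" for n
    using gw_integral_geg[OF assms, of n] assms
    by (auto simp: cheb_geg_def cheb_geg_closed_def gip_def geg_h_def conn_def)
  have "\<forall>n. cheb_geg l m n = cheb_geg_closed l m n"
  proof (induction m rule: induct_nat_012)
    case 1
    show ?case
    proof
      fix n
      have "(real n + l) * cheb_geg l (Suc 0) n = (real n + l) * cheb_geg_closed l (Suc 0) n"
      proof -
        consider "n = 0" | "n = 1" | "n \<ge> 2" by linarith
        then show ?thesis
        proof cases
          case 2
          then show ?thesis
            using cheb_geg_1[OF assms, of n] geg_h_rec[OF assms, of 0] conn_0_rec[OF assms, of 0] assms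
            unfolding 0 One_nat_def
            by (simp add: cheb_geg_closed_def)
        qed (use cheb_geg_1[OF assms, of n] in \<open>auto simp: 0 cheb_geg_closed_def\<close>)
      qed
      then show "cheb_geg l (Suc 0) n = cheb_geg_closed l (Suc 0) n"
        using assms by simp
    qed
  next
    case (ge2 m)
    show ?case
    proof
      fix n
      have "(real n + l) * (cheb_geg l (Suc (Suc m)) n + cheb_geg l m n)
          = (real n + l) * (cheb_geg_closed l (Suc (Suc m)) n + cheb_geg_closed l m n)"
        unfolding cheb_geg_rec[OF assms] cheb_geg_closed_rec[OF assms] using ge2 by simp
      then show "cheb_geg l (Suc (Suc m)) n = cheb_geg_closed l (Suc (Suc m)) n"
        using assms ge2 by simp
    qed
  qed (use 0 in simp)
  then show ?thesis by blast
qed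

lemma cheb_geg_diag:
  assumes "l > 0"
  shows "cheb_geg l n n = geg_h l n * (fact n / pochhammer l n)"
proof -
  have "pochhammer l n > 0" "l + real n > 0" using assms by (auto intro: pochhammer_pos)
  then show ?thesis
    unfolding cheb_geg_eq_closed[OF assms]
    by (simp add: cheb_geg_closed_def conn_def pochhammer_Suc add.commute)
qed

text \<open>Termwise integration of the kernel expansion against \<open>C_n\<close>, dominated by a
  multiple of \<open>(m + 1) |u|^(-m)\<close>. Only the indices \<open>m = n + 2 k\<close>
  contribute, so the power \<open>u^(-n-1)\<close> can be pulled out.\<close>

lemma stieltjes_geg_sums:
  fixes u :: complex
  assumes "l > 0" "norm u > 1"
  shows "(\<lambda>k. of_real (2 * (real n + l) * geg_h l n) * inverse u ^ Suc n * (of_real (conn l n k) * (inverse u)\<^sup>2 ^ k))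
     sums (\<integral>x. of_real (poly (geg l n) x) * of_real (gw l x) / ((u + inverse u) / 2 - of_real x) \<partial>lborel)"
proof -
  define P where "P x = poly (geg l n) x" for x
  define f where "f m x = 2 * inverse u ^ Suc m * (of_real (chebU m x * P x) * of_real (gw l x))" for m x
  have contP: "continuous_on A P" for A
    unfolding P_def by (intro continuous_intros)
  have u1: "norm (inverse u) < 1" "u \<noteq> 0"
    using assms by (auto simp: norm_inverse inverse_less_1_iff)
  obtain B where B: "\<And>x. x \<in> {-1..1} \<Longrightarrow> \<bar>P x\<bar> \<le> B"
    using compact_continuous_image[OF contP[of "{-1..1}"], THEN compact_imp_bounded]
    unfolding bounded_iff by (metis compact_Icc image_eqI real_norm_def)
  have int: "integrable lborel (f m)" for m
    unfolding f_def
    by (intro integrable_mult_right integrable_mult_gw[OF assms(1)])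
       (auto intro!: continuous_intros contP simp: continuous_on_of_real)
  have bd: "norm (f m x) \<le> 2 * norm (inverse u) * (of_nat (Suc m) * norm (inverse u) ^ m) * (B * gw l x)" for m x
  proof (cases "x \<in> {-1..1}")
    case True
    have "norm (f m x) = 2 * norm (inverse u) * (norm (inverse u) ^ m) * (\<bar>chebU m x\<bar> * \<bar>P x\<bar> * gw l x)"
      by (simp add: f_def norm_mult norm_power gw_nonneg abs_mult norm_divide)
    also have "\<dots> \<le> 2 * norm (inverse u) * (norm (inverse u) ^ m) * (of_nat (Suc m) * B * gw l x)"
      using abs_chebU_le[OF True, of m] B[OF True]
      by (intro mult_left_mono mult_right_mono mult_mono) (auto simp: gw_nonneg)
    finally show ?thesis by (simp add: mult_ac)
  qed (simp add: gw_eq_0 f_def)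
  have geo: "summable (\<lambda>m. of_nat (Suc m) * norm (inverse u) ^ m)"
    using geometric_deriv_sums[of "norm (inverse u)"] u1 by (simp add: sums_iff)
  have s: "(\<lambda>m. integral\<^sup>L lborel (f m)) sums (\<integral>x. (\<Sum>m. f m x) \<partial>lborel)"
  proof (rule sums_integral[OF int])
    show "AE x in lborel. summable (\<lambda>m. norm (f m x))"
    proof (intro AE_I2)
      fix x
      show "summable (\<lambda>m. norm (f m x))"
        by (rule summable_comparison_test'[where N = 0 and
              g = "\<lambda>m. 2 * norm (inverse u) * (of_nat (Suc m) * norm (inverse u) ^ m) * (B * gw l x)"])
           (use bd in \<open>auto intro!: summable_mult summable_mult2 geo simp del: of_nat_Suc\<close>)
    qed
    show "summable (\<lambda>m. \<integral>x. norm (f m x) \<partial>lborel)"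
    proof (rule summable_comparison_test'[where N = 0])
      show "summable (\<lambda>m. 2 * norm (inverse u) * (of_nat (Suc m) * norm (inverse u) ^ m) * (B * (\<integral>x. gw l x \<partial>lborel)))"
        by (intro summable_mult summable_mult2 geo)
      fix m
      have "(\<integral>x. norm (f m x) \<partial>lborel) \<le>
         (\<integral>x. 2 * norm (inverse u) * (of_nat (Suc m) * norm (inverse u) ^ m) * (B * gw l x) \<partial>lborel)"
        by (intro integral_mono integrable_norm int integrable_mult_right integrable_gw assms bd)
      then show "norm (\<integral>x. norm (f m x) \<partial>lborel) \<le>
         2 * norm (inverse u) * (of_nat (Suc m) * norm (inverse u) ^ m) * (B * (\<integral>x. gw l x \<partial>lborel))"
        by simp
    qed
  qed
  have "(\<Sum>m. f m x) = of_real (P x) * of_real (gw l x) / ((u + inverse u) / 2 - of_real x)" for x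
  proof (cases "x \<in> {-1..1}")
    case True
    have "(\<lambda>m. of_real (P x) * of_real (gw l x) * (2 * inverse u ^ Suc m * of_real (chebU m x)))
       sums (of_real (P x) * of_real (gw l x) * (1 / ((u + inverse u) / 2 - of_real x)))"
      by (intro sums_mult cauchy_kernel_expansion True assms)
    moreover have "of_real (P x) * of_real (gw l x) * (2 * inverse u ^ Suc m * of_real (chebU m x)) = f m x" for m
      by (simp add: f_def mult_ac)
    ultimately show ?thesis by (simp add: sums_iff)
  qed (simp add: gw_eq_0 f_def)
  with s have s: "(\<lambda>m. integral\<^sup>L lborel (f m)) sums
      (\<integral>x. of_real (P x) * of_real (gw l x) / ((u + inverse u) / 2 - of_real x) \<partial>lborel)"
    by simp
  have If: "integral\<^sup>L lborel (f m) = 2 * inverse u ^ Suc m * of_real (cheb_geg l m n)" for m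
  proof -
    have "integral\<^sup>L lborel (f m) = 2 * inverse u ^ Suc m * (\<integral>x. of_real (chebU m x * P x * gw l x) \<partial>lborel)"
      unfolding f_def by (simp del: power_Suc)
    also have "(\<integral>x. of_real (chebU m x * P x * gw l x) \<partial>lborel) = complex_of_real (cheb_geg l m n)"
      unfolding cheb_geg_def gip_def P_def by (rule integral_complex_of_real)
    finally show ?thesis .
  qed
  have "strict_mono (\<lambda>k. n + 2 * k)" by (auto simp: strict_mono_def)
  then have "(\<lambda>k. integral\<^sup>L lborel (f (n + 2 * k))) sums
      (\<integral>x. of_real (P x) * of_real (gw l x) / ((u + inverse u) / 2 - of_real x) \<partial>lborel)"
  proof (subst sums_mono_reindex)
    fix m assume m: "m \<notin> range (\<lambda>k. n + 2 * k)"
    have "cheb_geg_closed l m n = 0"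
    proof -
      have "m \<noteq> n + 2 * ((m - n) div 2)" using m by blast
      then show ?thesis by (auto simp: cheb_geg_closed_def)
    qed
    then show "integral\<^sup>L lborel (f m) = 0"
      by (simp add: If cheb_geg_eq_closed[OF assms(1)])
  qed (use s in auto)
  moreover have "integral\<^sup>L lborel (f (n + 2 * k)) =
      of_real (2 * (real n + l) * geg_h l n) * inverse u ^ Suc n * (of_real (conn l n k) * (inverse u)\<^sup>2 ^ k)" for k
  proof -
    have "inverse u ^ Suc (n + 2 * k) = inverse u ^ Suc n * (inverse u)\<^sup>2 ^ k"
      by (simp only: add_Suc[symmetric] power_add power_mult)
    then show ?thesis
      unfolding If cheb_geg_eq_closed[OF assms(1)]
      by (simp only:) (simp add: cheb_geg_closed_def del: power_Suc)
  qed
  ultimately show ?thesis by (simp add: P_def del: of_real_mult)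
qed

section \<open>Euler's integral and the constants\<close>

lemma pochhammer_one_minus_eq_gchoose:
  fixes l :: "'a::field_char_0"
  shows "pochhammer (1 - l) k / fact k = (- 1) ^ k * ((l - 1) gchoose k)"
  by (simp add: gbinomial_pochhammer flip: power_mult_distrib)

text \<open>The quotient \<open>(n + k)! / (l)_(n+k+1)\<close> is the moment of order
  \<open>n + k\<close> of \<open>(1 - t)^(l-1)\<close> on \<open>[0,1]\<close>; the other factor is
  the coefficient of \<open>w^k\<close> in \<open>(1 - w)^(l-1)\<close>.\<close>

lemma conn_eq_Beta:
  assumes "l > 0"
  shows "conn l n k = pochhammer (1 - l) k / fact k * Beta (real (n + k) + 1) l"
proof -
  have "l \<notin> \<int>\<^sub>\<le>\<^sub>0"
    using assms by (auto elim!: nonpos_Ints_cases)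
  then have "pochhammer l (n + k + 1) = Gamma (real (n + k) + 1 + l) / Gamma l"
    by (simp add: pochhammer_Gamma add_ac)
  moreover have "Gamma (real (n + k) + 1) = fact (n + k)"
    using Gamma_fact[of "n + k", where 'a = real] by (simp add: add_ac)
  moreover have "Gamma l > 0" using assms by simp
  ultimately show ?thesis
    by (simp add: conn_def Beta_def)
qed

text \<open>The series equals Euler's integral \<open>\<integral>\<^sub>0\<^sup>1 t\<^sup>n (1 - t)\<^bsup>l-1\<^esup> (1 - t w)\<^bsup>l-1\<^esup> dt\<close>.\<close>

lemma norm_conn_series_le:
  fixes w :: complex
  assumes "l > 0" "norm w < 1" and s: "(\<lambda>k. of_real (conn l n k) * w ^ k) sums S"
  shows "norm S \<le> Beta (real n + 1) l *
    (if l \<ge> 1 then (1 + norm w) powr (l - 1) else (1 - norm w) powr (l - 1))"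
proof -
  define K where "K = (if l \<ge> 1 then (1 + norm w) powr (l - 1) else (1 - norm w) powr (l - 1))"
  define b where "b k = pochhammer (1 - l) k / fact k" for k
  define \<beta> where "\<beta> k t = indicator {0..1} t * (t powr (real (n + k) + 1 - 1) * (1 - t) powr (l - 1))" for k t
  define f where "f k t = of_real (b k * \<beta> k t) * w ^ k" for k t
  have \<beta>: "integrable lborel (\<beta> k)" "(\<integral>t. \<beta> k t \<partial>lborel) = Beta (real (n + k) + 1) l" for k
    unfolding \<beta>_def using beta_weight_lborel[of "real (n + k) + 1" l] assms(1) by simp_all
  have \<beta>_nonneg: "\<beta> k t \<ge> 0" for k t by (simp add: \<beta>_def)
  \<comment> \<open>\<open>0 powr a = 0\<close> for every \<open>a\<close>, so both sides vanish at
    \<open>t = 0\<close>, also for \<open>k = 0\<close>.\<close>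
  have \<beta>_eq: "\<beta> k t = \<beta> 0 t * t ^ k" for k t
  proof (cases "t > 0")
    case True
    then show ?thesis by (simp add: \<beta>_def powr_realpow[symmetric] powr_add)
  qed (auto simp: \<beta>_def indicator_def)
  have bc: "of_real (b k) = (- 1) ^ k * ((of_real l - 1 :: complex) gchoose k)" for k
    using pochhammer_of_real[of "1 - l" k, where 'a = complex] pochhammer_one_minus_eq_gchoose[of "of_real l :: complex" k]
    by (simp add: b_def)
  have binom: "(\<lambda>k. of_real (b k) * z ^ k) sums ((1 - z) powr of_real (l - 1))" if "norm z < 1" for z :: complex
    using gen_binomial_complex[of "- z" "of_real l - 1"] that
    by (simp add: bc power_minus' mult_ac)
  \<comment> \<open>Convergence at the real point halfway between \<open>|w|\<close> and 1 gives
    absolute convergence at \<open>w\<close>.\<close>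
  have abs: "summable (\<lambda>k. norm (of_real (b k) * w ^ k))"
  proof (rule powser_insidea)
    show "summable (\<lambda>k. of_real (b k) * complex_of_real ((1 + norm w) / 2) ^ k)"
      using binom[of "of_real ((1 + norm w) / 2)"] assms(2) by (simp add: sums_iff del: of_real_divide of_real_add)
    show "norm w < norm (complex_of_real ((1 + norm w) / 2))"
      using assms(2) by (simp del: of_real_divide of_real_add)
  qed
  have bd: "norm (f k t) \<le> norm (of_real (b k) * w ^ k) * \<beta> 0 t" for k t
  proof (cases "t \<in> {0..1}")
    case True
    then have "t ^ k \<le> 1" by (simp add: power_le_one)
    with True have "\<beta> k t \<le> \<beta> 0 t"
      unfolding \<beta>_eq[of k] using \<beta>_nonneg[of 0 t] by (simp add: mult_left_le)
    then show ?thesis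
      using \<beta>_nonneg[of k t] by (simp add: f_def norm_mult abs_mult mult_left_mono mult_right_mono mult_ac)
  qed (simp add: f_def \<beta>_def)
  have int: "integrable lborel (f k)" for k
    unfolding f_def using \<beta>(1) by simp
  have ae: "AE t in lborel. summable (\<lambda>k. norm (f k t))"
  proof (intro AE_I2)
    fix t
    show "summable (\<lambda>k. norm (f k t))"
      by (rule summable_comparison_test'[where N = 0 and g = "\<lambda>k. norm (of_real (b k) * w ^ k) * \<beta> 0 t"])
         (use bd abs in \<open>auto intro: summable_mult2\<close>)
  qed
  have si: "summable (\<lambda>k. \<integral>t. norm (f k t) \<partial>lborel)"
  proof (rule summable_comparison_test'[where N = 0])
    show "summable (\<lambda>k. norm (of_real (b k) * w ^ k) * (\<integral>t. \<beta> 0 t \<partial>lborel))"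
      by (intro summable_mult2 abs)
    fix k
    have "(\<integral>t. norm (f k t) \<partial>lborel) \<le> (\<integral>t. norm (of_real (b k) * w ^ k) * \<beta> 0 t \<partial>lborel)"
      by (intro integral_mono integrable_norm int integrable_mult_right \<beta> bd)
    then show "norm (\<integral>t. norm (f k t) \<partial>lborel) \<le> norm (of_real (b k) * w ^ k) * (\<integral>t. \<beta> 0 t \<partial>lborel)"
      by simp
  qed
  have "(\<lambda>k. integral\<^sup>L lborel (f k)) sums (\<integral>t. (\<Sum>k. f k t) \<partial>lborel)"
    by (rule sums_integral[OF int ae si])
  moreover have "integral\<^sup>L lborel (f k) = of_real (conn l n k) * w ^ k" for k
  proof -
    have "integral\<^sup>L lborel (f k) = (\<integral>t. complex_of_real (b k * \<beta> k t) \<partial>lborel) * w ^ k"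
      unfolding f_def by (rule integral_mult_left_zero)
    also have "(\<integral>t. complex_of_real (b k * \<beta> k t) \<partial>lborel) = of_real (\<integral>t. b k * \<beta> k t \<partial>lborel)"
      by (rule integral_complex_of_real)
    also have "(\<integral>t. b k * \<beta> k t \<partial>lborel) = conn l n k"
      by (simp add: \<beta> conn_eq_Beta[OF assms(1)] b_def)
    finally show ?thesis .
  qed
  ultimately have S: "S = (\<integral>t. (\<Sum>k. f k t) \<partial>lborel)"
    using s sums_unique2 by (simp only:) blast
  have pt: "norm (\<Sum>k. f k t) \<le> K * \<beta> 0 t" for t
  proof (cases "t \<in> {0..1}")
    case True
    define z where "z = of_real t * w"
    have nz: "norm z \<le> norm w"
      using True by (simp add: z_def norm_mult mult_left_le_one_le)
    have "(\<lambda>k. of_real (\<beta> 0 t) * (of_real (b k) * z ^ k)) sums (of_real (\<beta> 0 t) * (1 - z) powr of_real (l - 1))"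
      by (intro sums_mult binom) (use nz assms in auto)
    moreover have "of_real (\<beta> 0 t) * (of_real (b k) * z ^ k) = f k t" for k
      unfolding f_def \<beta>_eq[of k t] z_def by (simp add: power_mult_distrib mult_ac)
    ultimately have "(\<Sum>k. f k t) = of_real (\<beta> 0 t) * (1 - z) powr of_real (l - 1)"
      by (simp add: sums_iff)
    then have "norm (\<Sum>k. f k t) = \<beta> 0 t * norm (1 - z) powr (l - 1)"
      using \<beta>_nonneg[of 0 t] by (simp add: norm_mult norm_powr_real_powr')
    \<comment> \<open>The modulus of \<open>1 - z\<close> lies between \<open>1 - |w|\<close> and
      \<open>1 + |w|\<close>; the sign of \<open>l - 1\<close> decides which end gives the larger
      power.\<close>
    also have "norm (1 - z) powr (l - 1) \<le> K"
    proof (cases "l \<ge> 1")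
      case True
      have "norm (1 - z) \<le> 1 + norm w"
        using norm_triangle_ineq4[of 1 z] nz by simp
      with True show ?thesis by (simp add: K_def powr_mono2)
    next
      case False
      have "1 - norm w \<le> norm (1 - z)"
        using norm_triangle_ineq2[of 1 z] nz by simp
      with False show ?thesis using assms(2) by (simp add: K_def powr_mono2')
    qed
    finally show ?thesis using \<beta>_nonneg[of 0 t] by (simp add: mult_left_mono mult.commute[of K])
  qed (simp add: f_def \<beta>_def)
  have "norm S \<le> (\<integral>t. K * \<beta> 0 t \<partial>lborel)"
    unfolding S
  proof (rule Bochner_Integration.integral_norm_bound_integral)
    show "integrable lborel (\<lambda>t. \<Sum>k. f k t)"
      by (rule integrable_suminf[OF int ae si])
  qed (use \<beta> pt in auto)
  then show ?thesis by (simp add: \<beta> K_def mult.commute)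
qed

lemma Beta_fact_pochhammer:
  assumes "l > 0"
  shows "(real n + l) * Beta (real n + 1) l = fact n / pochhammer l n"
proof -
  have "(real n + l) * Beta (real n + 1) l = (real n + l) * conn l n 0"
    by (simp add: conn_eq_Beta[OF assms])
  also have "\<dots> = fact n / pochhammer l n"
    using assms by (simp add: conn_def pochhammer_Suc add.commute)
  finally show ?thesis .
qed

definition geg_S :: "real \<Rightarrow> real \<Rightarrow> real" where
  "geg_S l r = (if l \<ge> 1 then (1 + r powi (-2)) powr (l - 1) else (1 - r powi (-2)) powr (l - 1))"

lemma norm_stieltjes_geg_le:
  fixes u :: complex
  assumes "l > 0" "norm u = r" "r > 1"
  shows "norm (\<integral>x. of_real (poly (geg l n) x) * of_real (gw l x) / ((u + inverse u) / 2 - of_real x) \<partial>lborel)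
     \<le> 2 * geg_h l n * (fact n / pochhammer l n) * geg_S l r / r ^ Suc n"
proof -
  define c where "c = of_real (2 * (real n + l) * geg_h l n) * inverse u ^ Suc n"
  define I where "I = (\<integral>x. of_real (poly (geg l n) x) * of_real (gw l x) / ((u + inverse u) / 2 - of_real x) \<partial>lborel)"
  have h: "geg_h l n > 0" using geg_h_pos[OF assms(1)] .
  have u0: "u \<noteq> 0" using assms by auto
  have "2 * (real n + l) * geg_h l n > 0" using h assms(1) by simp
  then have nA: "norm (complex_of_real (2 * (real n + l) * geg_h l n)) = 2 * (real n + l) * geg_h l n"
    by (simp only: norm_of_real abs_of_pos)
  have "complex_of_real (2 * (real n + l) * geg_h l n) \<noteq> 0"
    using \<open>2 * (real n + l) * geg_h l n > 0\<close>
    by (metis less_irrefl of_real_eq_0_iff)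
  then have c0: "c \<noteq> 0" unfolding c_def by (rule no_zero_divisors) (use u0 in simp)
  have s: "(\<lambda>k. c * (of_real (conn l n k) * (inverse u)\<^sup>2 ^ k)) sums I"
    unfolding c_def I_def by (rule stieltjes_geg_sums) (use assms in auto)
  then have "(\<lambda>k. inverse c * (c * (of_real (conn l n k) * (inverse u)\<^sup>2 ^ k))) sums (inverse c * I)"
    by (rule sums_mult)
  then have s': "(\<lambda>k. of_real (conn l n k) * (inverse u)\<^sup>2 ^ k) sums (I / c)"
    using c0 by (simp add: field_simps)
  have w: "norm ((inverse u)\<^sup>2) = r powi (-2)"
    using assms by (simp add: norm_power norm_inverse power_int_minus power_inverse)
  have w1: "r powi (-2) < 1"
    using assms by (simp add: power_int_minus inverse_less_1_iff)
  have "norm (I / c) \<le> Beta (real n + 1) l * geg_S l r"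
    using norm_conn_series_le[OF assms(1) _ s'] w1 unfolding w geg_S_def by simp
  then have "norm I \<le> norm c * (Beta (real n + 1) l * geg_S l r)"
    using c0 by (simp add: norm_divide divide_simps mult_ac)
  also have "norm c = 2 * (real n + l) * geg_h l n / r ^ Suc n"
    unfolding c_def norm_mult[of _ "inverse u ^ Suc n"] nA
    using assms by (simp add: norm_power norm_inverse power_inverse divide_inverse del: power_Suc)
  also have "2 * (real n + l) * geg_h l n / r ^ Suc n * (Beta (real n + 1) l * geg_S l r)
     = 2 * geg_h l n * ((real n + l) * Beta (real n + 1) l) * geg_S l r / r ^ Suc n"
    by (simp add: mult_ac)
  finally show ?thesis unfolding Beta_fact_pochhammer[OF assms(1)] I_def .
qed

section \<open>Comparison of n!/(l)_n with a power of n\<close>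

lemma ln_Gamma_chord:
  fixes x y z :: real
  assumes "0 < x" "x < y" "y < z"
  shows "(ln (Gamma y) - ln (Gamma x)) / (y - x) \<le> (ln (Gamma z) - ln (Gamma y)) / (z - y)"
  using convex_on_slope_le[OF log_convex_Gamma_real, of x z y] assms by (simp add: field_simps)

text \<open>Log-convexity compares slopes of \<open>ln Gamma\<close> on adjacent intervals. For
  \<open>l > 1\<close> the slope \<open>ln n\<close> on \<open>[n, n+1]\<close> bounds the one on
  \<open>[n+1, n+l]\<close> from below. For \<open>l < 1\<close> the slope on
  \<open>[n+l, n+1]\<close> is at most \<open>ln (n + 1) <= ln n + ln 2\<close>, and the surplus
  \<open>(1 - l) ln 2\<close> has to fit into the exponential constant.\<close>

lemma Gamma_ratio_upper:
  assumes "l > 0" "n > 0"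
  shows "fact n / pochhammer l n \<le> Gamma l * real n powr (1 - l) *
     exp (if l \<ge> 1 then 1 / 12 else 1 / 12 + (1 - l) / (2 * l))"
proof -
  define E where "E = (if l \<ge> 1 then 1 / 12 else 1 / 12 + (1 - l) / (2 * l))"
  have G: "ln (Gamma (real n + 1)) - ln (Gamma (real n)) = ln (real n)"
  proof -
    have np: "real n \<notin> \<int>\<^sub>\<le>\<^sub>0" using assms by (auto elim!: nonpos_Ints_cases)
    then have "Gamma (real n + 1) = real n * Gamma (real n)" by (rule Gamma_plus1)
    then show ?thesis using assms np by (simp add: ln_mult Gamma_eq_zero_iff)
  qed
  have G1: "ln (Gamma (real n + 2)) - ln (Gamma (real n + 1)) = ln (real n + 1)"
  proof -
    have np: "real n + 1 \<notin> \<int>\<^sub>\<le>\<^sub>0" by (auto elim!: nonpos_Ints_cases)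
    then have "Gamma (real n + 1 + 1) = (real n + 1) * Gamma (real n + 1)" by (rule Gamma_plus1)
    then show ?thesis using np by (simp add: ln_mult Gamma_eq_zero_iff add_ac)
  qed
  have main: "ln (Gamma (real n + 1)) - ln (Gamma (real n + l)) \<le> (1 - l) * ln (real n) + E"
  proof (cases "l \<ge> 1")
    case True
    show ?thesis
    proof (cases "l = 1")
      case False
      with True have l: "l > 1" by simp
      have "ln (real n) \<le> (ln (Gamma (real n + l)) - ln (Gamma (real n + 1))) / (l - 1)"
        using ln_Gamma_chord[of "real n" "real n + 1" "real n + l"] assms l G by simp
      then have "(l - 1) * ln (real n) \<le> ln (Gamma (real n + l)) - ln (Gamma (real n + 1))"
        using l by (simp add: field_simps)
      then show ?thesis by (simp add: E_def l less_imp_le algebra_simps)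
    qed (simp add: E_def)
  next
    case False
    then have "(ln (Gamma (real n + 1)) - ln (Gamma (real n + l))) / (1 - l) \<le> ln (real n + 1)"
      using ln_Gamma_chord[of "real n + l" "real n + 1" "real n + 2"] assms G1 by simp
    then have "ln (Gamma (real n + 1)) - ln (Gamma (real n + l)) \<le> (1 - l) * ln (real n + 1)"
      using False by (simp add: field_simps)
    also have "ln (real n + 1) \<le> ln (real n) + ln 2"
    proof -
      have "ln (real n) + ln 2 = ln (real n * 2)"
        using assms by (simp add: ln_mult)
      then show ?thesis using assms by simp
    qed
    then have "(1 - l) * ln (real n + 1) \<le> (1 - l) * ln (real n) + (1 - l) * ln 2"
      using False by (simp flip: distrib_left)
    also have "(1 - l) * ln 2 \<le> E"
    proof -
      \<comment> \<open>\<open>ln 2 < 7/10\<close>. If \<open>l >= 7/12\<close>, then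
        \<open>(1 - l) (7/10 - 1/2) <= 1/12\<close>; otherwise \<open>1 / (2 l) > 7/10\<close>
        suffices.\<close>
      have "(1 - l) * ln 2 \<le> (1 - l) * (7 / 10)"
        using False ln2_le_25_over_36 by (intro mult_left_mono) auto
      also have "\<dots> \<le> 1 / 12 + (1 - l) / (2 * l)"
      proof (cases "l \<ge> 7 / 12")
        case True
        have "(1 - l) / 2 \<le> (1 - l) / (2 * l)"
          using False assms(1) by (intro divide_left_mono) auto
        moreover have "(1 - l) * (7 / 10) \<le> 1 / 12 + (1 - l) / 2"
          using True by argo
        ultimately show ?thesis by linarith
      next
        case False
        then have "7 / 10 \<le> 1 / (2 * l)" using assms(1) by (simp add: field_simps)
        then have "(1 - l) * (7 / 10) \<le> (1 - l) * (1 / (2 * l))"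
          using False by (intro mult_left_mono) auto
        then show ?thesis by simp
      qed
      finally show ?thesis using False by (simp add: E_def)
    qed
    finally show ?thesis by simp
  qed
  have "l \<notin> \<int>\<^sub>\<le>\<^sub>0"
    using assms by (auto elim!: nonpos_Ints_cases)
  then have "fact n / pochhammer l n = Gamma l * (Gamma (real n + 1) / Gamma (real n + l))"
    using Gamma_fact[of n, where 'a = real] by (simp add: pochhammer_Gamma add_ac)
  also have "Gamma (real n + 1) / Gamma (real n + l) = exp (ln (Gamma (real n + 1)) - ln (Gamma (real n + l)))"
    using assms by (simp add: exp_diff)
  also have "\<dots> \<le> exp ((1 - l) * ln (real n) + E)"
    using main by simp
  also have "\<dots> = real n powr (1 - l) * exp E"
    using assms by (simp add: powr_def exp_add)
  finally show ?thesis
    using assms by (simp add: E_def mult_left_mono mult.assoc)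
qed

text \<open>At \<open>n = 0\<close> the ratio is 1 and equality holds;
  \<open>real n powr (1 - l)\<close> would be 0 there, hence the separate constant
  \<open>Dbar\<close>.\<close>

lemma coeff_constant_le:
  assumes "l > 0" "r > 1"
  shows "fact n / pochhammer l n * geg_S l r / r
     \<le> (if n = 0 then Dbar l r else real n powr (1 - l) * Dconst l r)"
proof (cases "n = 0")
  case False
  have S: "geg_S l r / r \<ge> 0" using assms by (simp add: geg_S_def)
  have "fact n / pochhammer l n * (geg_S l r / r)
    \<le> Gamma l * real n powr (1 - l) * exp (if l \<ge> 1 then 1 / 12 else 1 / 12 + (1 - l) / (2 * l)) * (geg_S l r / r)"
    using Gamma_ratio_upper[OF assms(1), of n] False by (intro mult_right_mono S) auto
  also have "\<dots> = real n powr (1 - l) * Dconst l r"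
    by (simp add: Dconst_def geg_S_def)
  finally show ?thesis using False by simp
qed (simp add: geg_S_def Dbar_def)

text \<open>\<open>Gamma_series l n\<close> tends to \<open>Gamma l\<close>, and the factor
  \<open>1 + l / n\<close>, which tends to 1, removes the last factor of
  \<open>pochhammer l (n + 1)\<close>. Half of the limit is eventually a lower bound.\<close>

lemma Gamma_ratio_lower:
  assumes "l > 0"
  shows "\<forall>\<^sub>F n in sequentially. Gamma l / 2 * real n powr (1 - l) \<le> fact n / pochhammer l n"
proof -
  have G: "Gamma l > 0" using assms by simp
  have "(\<lambda>n. Gamma_series l n * (1 + l / real n)) \<longlonglongrightarrow> Gamma l * (1 + 0)"
    by (rule tendsto_intros real_tendsto_divide_at_top Gamma_series_LIMSEQ filterlim_real_sequentially)+
  then have "\<forall>\<^sub>F n in sequentially. Gamma_series l n * (1 + l / real n) > Gamma l / 2"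
    using G by (intro order_tendstoD(1)) auto
  then show ?thesis
    using eventually_gt_at_top[of 0]
  proof eventually_elim
    case (elim n)
    have p: "pochhammer l n > 0" using assms by (rule pochhammer_pos)
    have n: "real n powr l = real n powr (l - 1) * real n"
      using elim(2) powr_add[of "real n" "l - 1" 1] by simp
    have "Gamma_series l n * (1 + l / real n) = fact n / pochhammer l n * real n powr (l - 1)"
    proof -
      have "exp (l * ln (real n)) = real n powr (l - 1) * real n"
        using elim(2) n by (simp add: powr_def)
      moreover have "1 + l / real n = (l + real n) / real n"
        using elim(2) by (simp add: field_simps)
      moreover have "l + real n \<noteq> 0" using assms by simp
      ultimately show ?thesis
        using elim(2) p by (simp add: Gamma_series_def pochhammer_Suc)
    qed
    with elim(1) have "Gamma l / 2 * real n powr (1 - l)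
       \<le> fact n / pochhammer l n * real n powr (l - 1) * real n powr (1 - l)"
      by (intro mult_right_mono) auto
    also have "\<dots> = fact n / pochhammer l n"
      using elim(2) by (simp add: mult.assoc flip: powr_add)
    finally show ?case .
  qed
qed

section \<open>Bernstein ellipses\<close>

text \<open>The closed region bounded by the ellipse, described through its foci -1 and 1; in this
  form convexity and the interior follow from the triangle inequality.\<close>

definition filled_ellipse :: "real \<Rightarrow> complex set" where
  "filled_ellipse r = {z. norm (z - 1) + norm (z + 1) \<le> r + inverse r}"

text \<open>The two differences are \<open>(u - 1)^2 / (2 u)\<close> and
  \<open>(u + 1)^2 / (2 u)\<close>, and the parallelogram law adds up the squares.\<close>

lemma joukowski_focal_sum:
  fixes u :: complex
  assumes "u \<noteq> 0"
  shows "norm ((u + inverse u) / 2 - 1) + norm ((u + inverse u) / 2 + 1) = norm u + inverse (norm u)"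
proof -
  have "(u + inverse u) / 2 - 1 = (u - 1)\<^sup>2 / (2 * u)" "(u + inverse u) / 2 + 1 = (u + 1)\<^sup>2 / (2 * u)"
    using assms by (auto simp: field_simps power2_eq_square)
  then have "norm ((u + inverse u) / 2 - 1) + norm ((u + inverse u) / 2 + 1)
      = ((norm (u - 1))\<^sup>2 + (norm (u + 1))\<^sup>2) / (2 * norm u)"
    by (simp add: norm_divide norm_mult norm_power add_divide_distrib)
  also have "(norm (u - 1))\<^sup>2 + (norm (u + 1))\<^sup>2 = 2 * ((norm u)\<^sup>2 + 1)"
    unfolding cmod_power2 by (simp add: power2_eq_square algebra_simps)
  finally show ?thesis using assms by (simp add: field_simps power2_eq_square)
qed

lemma bernstein_ellipse_focal:
  assumes "r > 1"
  shows "bernstein_ellipse r = {z. norm (z - 1) + norm (z + 1) = r + inverse r}"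
proof (intro Set.set_eqI iffI)
  fix z assume "z \<in> bernstein_ellipse r"
  then obtain u where u: "norm u = r" "z = (u + inverse u) / 2"
    by (auto simp: bernstein_ellipse_def)
  with assms have "u \<noteq> 0" by auto
  from joukowski_focal_sum[OF this] u show "z \<in> {z. norm (z - 1) + norm (z + 1) = r + inverse r}"
    by (simp only: mem_Collect_eq)
next
  fix z :: complex assume z: "z \<in> {z. norm (z - 1) + norm (z + 1) = r + inverse r}"
  \<comment> \<open>A root of \<open>u^2 - 2 z u + 1 = 0\<close>. The other root is
    \<open>1/u\<close>, and one of the two has modulus \<open>r\<close>.\<close>
  define u where "u = z + csqrt (z\<^sup>2 - 1)"
  have "(u - z)\<^sup>2 = z\<^sup>2 - 1" by (simp add: u_def)
  then have q: "u * u + 1 = 2 * z * u" by (simp add: power2_eq_square algebra_simps)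
  then have u0: "u \<noteq> 0" by auto
  have zu: "z = (u + inverse u) / 2" using q u0 by (simp add: field_simps)
  define s where "s = norm u"
  have s: "s > 0" using u0 by (simp add: s_def)
  have "s + inverse s = r + inverse r"
    using z joukowski_focal_sum[OF u0] by (simp add: zu s_def)
  then have "(s - r) * (s * r - 1) = 0" using s assms by (simp add: field_simps)
  then consider "s = r" | "s * r = 1" by auto
  then show "z \<in> bernstein_ellipse r"
  proof cases
    case 1
    then show ?thesis using zu by (auto simp: bernstein_ellipse_def s_def)
  next
    case 2
    then have "inverse s = r" using s by (simp add: field_simps)
    then have "norm (inverse u) = r" by (simp add: norm_inverse s_def)
    moreover have "z = (inverse u + inverse (inverse u)) / 2" using zu by (simp add: add.commute)
    ultimately show ?thesis by (auto simp: bernstein_ellipse_def)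
  qed
qed

lemma two_less_plus_inverse:
  fixes r :: real
  assumes "r > 1"
  shows "2 < r + inverse r"
proof -
  have "0 < (r - 1)\<^sup>2 / r" using assms by simp
  also have "(r - 1)\<^sup>2 / r = r + inverse r - 2"
    using assms by (simp add: field_simps power2_eq_square)
  finally show ?thesis by simp
qed

lemma focal_sum_convex:
  fixes x y :: complex
  assumes "0 \<le> s" "s \<le> 1"
  shows "norm ((1 - s) *\<^sub>R x + s *\<^sub>R y - 1) + norm ((1 - s) *\<^sub>R x + s *\<^sub>R y + 1)
    \<le> (1 - s) * (norm (x - 1) + norm (x + 1)) + s * (norm (y - 1) + norm (y + 1))"
proof -
  have "(1 - s) *\<^sub>R x + s *\<^sub>R y - 1 = (1 - s) *\<^sub>R (x - 1) + s *\<^sub>R (y - 1)"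
    "(1 - s) *\<^sub>R x + s *\<^sub>R y + 1 = (1 - s) *\<^sub>R (x + 1) + s *\<^sub>R (y + 1)"
    by (simp_all add: algebra_simps)
  then have "norm ((1 - s) *\<^sub>R x + s *\<^sub>R y - 1) \<le> (1 - s) * norm (x - 1) + s * norm (y - 1)"
    "norm ((1 - s) *\<^sub>R x + s *\<^sub>R y + 1) \<le> (1 - s) * norm (x + 1) + s * norm (y + 1)"
    using norm_triangle_ineq[of "(1 - s) *\<^sub>R (x - 1)" "s *\<^sub>R (y - 1)"]
      norm_triangle_ineq[of "(1 - s) *\<^sub>R (x + 1)" "s *\<^sub>R (y + 1)"] assms
    by simp_all
  then show ?thesis by (simp add: algebra_simps)
qed

text \<open>\<open>s z\<close> lies on the segment from \<open>z\<close> to 0, where the focal sum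
  is only \<open>2 < r + 1/r\<close>. Scaling thus moves boundary points strictly inside, which the
  slices in several variables rely on.\<close>

lemma filled_ellipse_shrink:
  assumes "r > 1" "z \<in> filled_ellipse r" "0 \<le> s" "s < 1"
  shows "norm (of_real s * z - 1) + norm (of_real s * z + 1) < r + inverse r"
proof -
  have "norm (of_real s * z - 1) + norm (of_real s * z + 1)
      \<le> (1 - s) * 2 + s * (norm (z - 1) + norm (z + 1))"
    using focal_sum_convex[of s 0 z] assms by (simp add: scaleR_conv_of_real)
  also have "\<dots> \<le> (1 - s) * 2 + s * (r + inverse r)"
    using assms by (intro add_left_mono mult_left_mono) (auto simp: filled_ellipse_def)
  also have "\<dots> < (1 - s) * (r + inverse r) + s * (r + inverse r)"
    using two_less_plus_inverse[OF assms(1)] assms by (intro add_strict_right_mono mult_strict_left_mono) auto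
  finally show ?thesis by (simp add: algebra_simps)
qed

lemma convex_filled_ellipse: "convex (filled_ellipse r)"
  unfolding convex_alt
proof (intro ballI allI impI)
  fix x y s assume x: "x \<in> filled_ellipse r" and y: "y \<in> filled_ellipse r" and s: "0 \<le> s \<and> s \<le> (1::real)"
  have "norm ((1 - s) *\<^sub>R x + s *\<^sub>R y - 1) + norm ((1 - s) *\<^sub>R x + s *\<^sub>R y + 1)
    \<le> (1 - s) * (norm (x - 1) + norm (x + 1)) + s * (norm (y - 1) + norm (y + 1))"
    using s by (intro focal_sum_convex) auto
  also have "\<dots> \<le> (1 - s) * (r + inverse r) + s * (r + inverse r)"
  proof (rule add_mono)
    show "(1 - s) * (norm (x - 1) + norm (x + 1)) \<le> (1 - s) * (r + inverse r)"
      using x s by (intro mult_left_mono) (auto simp: filled_ellipse_def)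
    show "s * (norm (y - 1) + norm (y + 1)) \<le> s * (r + inverse r)"
      using y s by (intro mult_left_mono) (auto simp: filled_ellipse_def)
  qed
  finally show "(1 - s) *\<^sub>R x + s *\<^sub>R y \<in> filled_ellipse r"
    by (simp add: filled_ellipse_def algebra_simps)
qed

lemma compact_filled_ellipse: "compact (filled_ellipse r)"
proof -
  have "closed (filled_ellipse r)"
    unfolding filled_ellipse_def by (intro closed_Collect_le continuous_intros)
  moreover have "norm z \<le> r + inverse r" if "z \<in> filled_ellipse r" for z
  proof -
    have "norm (2 * z) \<le> norm (z - 1) + norm (z + 1)"
      using norm_triangle_ineq[of "z - 1" "z + 1"] by simp
    with that have "2 * norm z \<le> r + inverse r" by (simp add: filled_ellipse_def norm_mult)
    then show ?thesis using norm_ge_zero[of z] by linarith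
  qed
  then have "bounded (filled_ellipse r)" by (auto simp: bounded_iff)
  ultimately show ?thesis by (simp add: compact_eq_bounded_closed)
qed

lemma interior_filled_ellipse:
  assumes "r > 1"
  shows "interior (filled_ellipse r) = {z. norm (z - 1) + norm (z + 1) < r + inverse r}"
proof
  show "{z. norm (z - 1) + norm (z + 1) < r + inverse r} \<subseteq> interior (filled_ellipse r)"
    by (rule interior_maximal) (auto simp: filled_ellipse_def intro!: open_Collect_less continuous_intros)
  show "interior (filled_ellipse r) \<subseteq> {z. norm (z - 1) + norm (z + 1) < r + inverse r}"
  proof
    fix z assume "z \<in> interior (filled_ellipse r)"
    then obtain e where e: "e > 0" "cball z e \<subseteq> filled_ellipse r"
      by (meson mem_interior_cball)
    \<comment> \<open>Chosen so that \<open>(1 + d) z\<close> stays in the ball; \<open>z\<close> is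
      then a strict shrinking of a point of the region. The added 1 covers
      \<open>z = 0\<close>.\<close>
    define d where "d = e / (norm z + 1)"
    have d: "d > 0" using e by (simp add: d_def add_nonneg_pos)
    have "norm (of_real d * z) \<le> d * (norm z + 1)"
      using d by (simp add: norm_mult)
    also have "\<dots> = e"
    proof -
      have "norm z + 1 > 0" by (simp add: add_nonneg_pos)
      then show ?thesis by (simp add: d_def)
    qed
    finally have "norm (of_real d * z) \<le> e" .
    then have "z + of_real d * z \<in> cball z e" by (simp add: dist_norm)
    with e have "z + of_real d * z \<in> filled_ellipse r" by blast
    then have "norm (of_real (1 / (1 + d)) * (z + of_real d * z) - 1)
        + norm (of_real (1 / (1 + d)) * (z + of_real d * z) + 1) < r + inverse r"
      using d assms by (intro filled_ellipse_shrink) auto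
    moreover have "of_real (1 / (1 + d)) * (z + of_real d * z) = z"
    proof -
      have "z + of_real d * z = of_real (1 + d) * z"
        by (simp add: algebra_simps)
      moreover have "complex_of_real (1 + d) \<noteq> 0"
        using d unfolding of_real_eq_0_iff by simp
      ultimately show ?thesis by (simp only: of_real_divide of_real_1) simp
    qed
    ultimately show "z \<in> {z. norm (z - 1) + norm (z + 1) < r + inverse r}" by simp
  qed
qed

text \<open>The ellipse is the frontier of a bounded convex set, and the inside of such a frontier
  is the interior of the set; the Jordan curve theorem is thereby avoided.\<close>

lemma inside_bernstein_ellipse:
  assumes "r > 1"
  shows "inside (bernstein_ellipse r) = {z. norm (z - 1) + norm (z + 1) < r + inverse r}"
proof -
  have "frontier (filled_ellipse r) = bernstein_ellipse r"
    unfolding frontier_def interior_filled_ellipse[OF assms] bernstein_ellipse_focal[OF assms]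
    using compact_filled_ellipse[of r, THEN compact_imp_closed] by (auto simp: filled_ellipse_def)
  then show ?thesis
    using inside_frontier_eq_interior[OF compact_imp_bounded[OF compact_filled_ellipse] convex_filled_ellipse[of r]]
      interior_filled_ellipse[OF assms] by simp
qed

lemma ellipse_Un_inside:
  assumes "r > 1"
  shows "bernstein_ellipse r \<union> inside (bernstein_ellipse r) = filled_ellipse r"
  unfolding inside_bernstein_ellipse[OF assms] unfolding bernstein_ellipse_focal[OF assms]
  by (auto simp: filled_ellipse_def)

lemma interval_in_inside:
  assumes "r > 1" "x \<in> {-1..1}"
  shows "of_real x \<in> inside (bernstein_ellipse r)"
proof -
  have "norm (complex_of_real x - 1) = 1 - x" "norm (complex_of_real x + 1) = 1 + x"
    using assms(2) norm_of_real[of "x - 1", where 'a = complex] norm_of_real[of "x + 1", where 'a = complex]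
    by auto
  then show ?thesis
    using two_less_plus_inverse[OF assms(1)] by (simp add: inside_bernstein_ellipse[OF assms(1)])
qed

lemma interval_notin_ellipse:
  assumes "r > 1" "x \<in> {-1..1}"
  shows "of_real x \<notin> bernstein_ellipse r"
  using interval_in_inside[OF assms] inside_no_overlap[of "bernstein_ellipse r"] by blast

text \<open>\<open>a\<close> and \<open>1/a\<close> are the two preimages of \<open>x\<close> under
  \<open>u \<mapsto> (u + 1/u) / 2\<close>, both on the unit circle. The factorization serves the
  distance estimate as well as the winding number.\<close>

lemma joukowski_minus_real_factor:
  fixes u :: complex
  assumes "x \<in> {-1..1}" "u \<noteq> 0"
  defines "a \<equiv> cis (arccos x)"
  shows "2 * u * ((u + inverse u) / 2 - of_real x) = (u - a) * (u - inverse a)"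
proof -
  have "a \<noteq> 0" by (simp add: a_def)
  have "a + inverse a = of_real (2 * x)"
    using assms(1) by (simp add: a_def complex_eq_iff)
  then have "(u - a) * (u - inverse a) = u * u - of_real (2 * x) * u + 1"
    using \<open>a \<noteq> 0\<close> by (simp add: algebra_simps) (metis distrib_left mult.assoc mult.commute)
  then show ?thesis using assms(2) by (simp add: field_simps)
qed

lemma dist_ellipse_interval:
  fixes u :: complex
  assumes "x \<in> {-1..1}" "norm u = r" "r > 1"
  shows "(r - 1)\<^sup>2 / (2 * r) \<le> norm ((u + inverse u) / 2 - of_real x)"
proof -
  define a where "a = cis (arccos x)"
  have u0: "u \<noteq> 0" using assms by auto
  have "r - 1 \<le> norm (u - a)" "r - 1 \<le> norm (u - inverse a)"
    using norm_triangle_ineq2[of u a] norm_triangle_ineq2[of u "inverse a"] assms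
    by (auto simp: a_def norm_inverse)
  then have "(r - 1)\<^sup>2 \<le> norm ((u - a) * (u - inverse a))"
    using assms by (simp add: norm_mult power2_eq_square mult_mono)
  also have "\<dots> = 2 * r * norm ((u + inverse u) / 2 - of_real x)"
    unfolding joukowski_minus_real_factor[OF assms(1) u0, symmetric] a_def
    by (simp add: norm_mult assms)
  finally show ?thesis using assms by (simp add: field_simps)
qed

section \<open>The parametrised ellipse and Cauchy's formula on it\<close>

definition bern_circle :: "real \<Rightarrow> real \<Rightarrow> complex" where
  "bern_circle r t = of_real r * exp (2 * of_real pi * \<i> * of_real t)"

text \<open>The chain rule through \<open>u\<close>: the product of \<open>2 pi i u\<close> and
  \<open>(1 - u^(-2)) / 2\<close>.\<close>

definition bern_deriv :: "real \<Rightarrow> real \<Rightarrow> complex" where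
  "bern_deriv r t = of_real pi * \<i> * (bern_circle r t - inverse (bern_circle r t))"

lemma norm_bern_circle: "r > 0 \<Longrightarrow> norm (bern_circle r t) = r"
  by (simp add: bern_circle_def norm_mult)

lemma bern_circle_nonzero: "r > 0 \<Longrightarrow> bern_circle r t \<noteq> 0"
  by (simp add: bern_circle_def)

lemma bernstein_path_eq: "bernstein_path r t = (bern_circle r t + inverse (bern_circle r t)) / 2"
  by (simp add: bernstein_path_def bern_circle_def Let_def)

lemma bern_circle_deriv:
  "(bern_circle r has_vector_derivative (2 * of_real pi * \<i> * bern_circle r t)) (at t within S)"
proof -
  have "((\<lambda>z. of_real r * exp (2 * of_real pi * \<i> * z)) has_field_derivative
      (2 * of_real pi * \<i> * bern_circle r t)) (at (of_real t))"
    unfolding bern_circle_def by (auto intro!: derivative_eq_intros)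
  then show ?thesis
    unfolding bern_circle_def[abs_def] by (rule has_vector_derivative_real_field)
qed

lemma bernstein_path_deriv:
  assumes "r > 0"
  shows "(bernstein_path r has_vector_derivative bern_deriv r t) (at t within S)"
proof -
  have "((\<lambda>w. (w + inverse w) / 2) has_field_derivative
      (1 - inverse (bern_circle r t) * inverse (bern_circle r t)) / 2) (at (bern_circle r t))"
    using bern_circle_nonzero[OF assms] by (auto intro!: derivative_eq_intros)
  then have "(((\<lambda>w. (w + inverse w) / 2) \<circ> bern_circle r) has_vector_derivative
      2 * of_real pi * \<i> * bern_circle r t * ((1 - inverse (bern_circle r t) * inverse (bern_circle r t)) / 2)) (at t within S)"
    by (rule field_vector_diff_chain_within[OF bern_circle_deriv has_field_derivative_at_within])
  moreover have "(\<lambda>w. (w + inverse w) / 2) \<circ> bern_circle r = bernstein_path r"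
    by (auto simp: bernstein_path_eq)
  moreover have "2 * of_real pi * \<i> * bern_circle r t * ((1 - inverse (bern_circle r t) * inverse (bern_circle r t)) / 2)
      = bern_deriv r t"
    using bern_circle_nonzero[OF assms, of t] by (simp add: bern_deriv_def field_simps)
  ultimately show ?thesis by simp
qed

lemma continuous_on_bern_circle: "continuous_on S (bern_circle r)"
  unfolding bern_circle_def[abs_def] by (intro continuous_intros)

lemma continuous_on_bernstein_path: "r > 0 \<Longrightarrow> continuous_on S (bernstein_path r)"
  unfolding bernstein_path_eq[abs_def]
  by (intro continuous_intros continuous_on_bern_circle) (simp_all add: bern_circle_nonzero)

lemma continuous_on_bern_deriv: "r > 0 \<Longrightarrow> continuous_on S (bern_deriv r)"
  unfolding bern_deriv_def[abs_def]
  by (intro continuous_intros continuous_on_bern_circle) (simp_all add: bern_circle_nonzero)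

lemma bernstein_path_in_ellipse:
  assumes "r > 0"
  shows "bernstein_path r t \<in> bernstein_ellipse r"
  using norm_bern_circle[OF assms, of t] by (auto simp: bernstein_ellipse_def bernstein_path_eq)

lemma bernstein_length_eq:
  assumes "r > 0"
  shows "bernstein_length r = integral {0..1} (\<lambda>t. norm (bern_deriv r t))"
  unfolding bernstein_length_def
proof (rule integral_cong)
  fix t :: real assume "t \<in> {0..1}"
  then show "norm (vector_derivative (bernstein_path r) (at t within {0..1})) = norm (bern_deriv r t)"
    using vector_derivative_within_cbox[OF _ _ bernstein_path_deriv[OF assms], of 0 1 t] by simp
qed

lemma bernstein_length_lborel:
  assumes "r > 0"
  shows "integrable lborel (\<lambda>t. indicator {0..1} t * norm (bern_deriv r t))"
    "(\<integral>t. indicator {0..1} t * norm (bern_deriv r t) \<partial>lborel) = bernstein_length r"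
proof -
  have c: "continuous_on {0..1} (\<lambda>t. norm (bern_deriv r t))"
    by (intro continuous_intros continuous_on_bern_deriv assms)
  then have i: "set_integrable lborel {0..1} (\<lambda>t. norm (bern_deriv r t))"
    by (rule borel_integrable_atLeastAtMost')
  then show "integrable lborel (\<lambda>t. indicator {0..1} t * norm (bern_deriv r t))"
    by (simp add: set_integrable_def)
  show "(\<integral>t. indicator {0..1} t * norm (bern_deriv r t) \<partial>lborel) = bernstein_length r"
    using set_borel_integral_eq_integral(2)[OF i] bernstein_length_eq[OF assms]
    by (simp add: set_lebesgue_integral_def)
qed

lemma bernstein_length_nonneg: "r > 0 \<Longrightarrow> bernstein_length r \<ge> 0"
  unfolding bernstein_length_lborel(2)[symmetric] by (intro integral_nonneg_AE) simp

lemma valid_path_bernstein: "r > 0 \<Longrightarrow> valid_path (bernstein_path r)"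
  unfolding valid_path_def
  by (intro C1_differentiable_imp_piecewise)
     (auto simp: C1_differentiable_on_def intro!: exI[of _ "bern_deriv r"] bernstein_path_deriv continuous_on_bern_deriv)

text \<open>In the variable \<open>u\<close> the form \<open>dz / (z - x)\<close> becomes
  \<open>(1/(u - a) + 1/(u - 1/a) - 1/u) du\<close>. All three poles lie in the disc of radius
  \<open>r\<close>, so the integral is \<open>2 pi i (1 + 1 - 1)\<close>.\<close>

lemma winding_number_bernstein:
  assumes "r > 1" "x \<in> {-1..1}"
  shows "winding_number (bernstein_path r) (of_real x) = 1"
proof -
  define a where "a = cis (arccos x)"
  define C where "C = circlepath 0 r"
  have r0: "r > 0" using assms by simp
  have C: "C t = bern_circle r t" for t
    by (simp add: C_def circlepath bern_circle_def)
  have C': "vector_derivative C (at t) = 2 * of_real pi * \<i> * bern_circle r t" for t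
    using bern_circle_deriv[of r t UNIV] by (intro vector_derivative_at) (simp add: C[abs_def])
  have circ: "((\<lambda>w. 1 / (w - b)) has_contour_integral (2 * of_real pi * \<i>)) C" if "norm b < r" for b
    using Cauchy_integral_circlepath_simple[of "\<lambda>_. 1" 0 r b] that by (simp add: C_def)
  have na: "norm a < r" "norm (inverse a) < r" using assms by (simp_all add: a_def norm_inverse)
  have "((\<lambda>w. 1 / (w - a) + 1 / (w - inverse a) - 1 / (w - 0)) has_contour_integral
      (2 * of_real pi * \<i> + 2 * of_real pi * \<i> - 2 * of_real pi * \<i>)) C"
    by (intro has_contour_integral_diff has_contour_integral_add circ na) (use r0 in simp)
  then have "((\<lambda>t. (1 / (C t - a) + 1 / (C t - inverse a) - 1 / (C t - 0)) * vector_derivative C (at t))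
       has_integral 2 * of_real pi * \<i>) {0..1}"
    by (simp add: has_contour_integral mult_ac)
  moreover have "(1 / (C t - a) + 1 / (C t - inverse a) - 1 / (C t - 0)) * vector_derivative C (at t)
      = 1 / (bernstein_path r t - of_real x) * vector_derivative (bernstein_path r) (at t)" for t
  proof -
    define u where "u = bern_circle r t"
    have u0: "u \<noteq> 0" using bern_circle_nonzero[OF r0] by (simp add: u_def)
    have nu: "norm u = r" using norm_bern_circle[OF r0] by (simp add: u_def)
    have ne: "u - a \<noteq> 0" "u - inverse a \<noteq> 0" using na nu by auto
    have a0: "a \<noteq> 0" by (simp add: a_def)
    note fac = joukowski_minus_real_factor[OF assms(2) u0, folded a_def]
    have nz: "(u + inverse u) / 2 - of_real x \<noteq> 0" using fac ne by auto
    have d: "vector_derivative (bernstein_path r) (at t) = of_real pi * \<i> * (u - inverse u)"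
      using vector_derivative_at[OF bernstein_path_deriv[OF r0, of t UNIV]] by (simp add: bern_deriv_def u_def)
    have "(1 / (u - a) + 1 / (u - inverse a) - 1 / u) * u = (u * u - 1) / ((u - a) * (u - inverse a))"
      using ne u0 a0 by (simp add: divide_simps) (simp add: algebra_simps)
    also have "\<dots> = (u * u - 1) / (2 * u * ((u + inverse u) / 2 - of_real x))"
      by (simp only: fac)
    also have "\<dots> = (u - inverse u) / 2 / ((u + inverse u) / 2 - of_real x)"
    proof -
      have "(u * u - 1) = 2 * u * ((u - inverse u) / 2)" using u0 by (simp add: field_simps)
      then show ?thesis using u0 by simp
    qed
    finally have eq: "(1 / (u - a) + 1 / (u - inverse a) - 1 / u) * u = (u - inverse u) / 2 / ((u + inverse u) / 2 - of_real x)" .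
    have "(1 / (u - a) + 1 / (u - inverse a) - 1 / (u - 0)) * (2 * of_real pi * \<i> * u)
        = 2 * of_real pi * \<i> * ((1 / (u - a) + 1 / (u - inverse a) - 1 / u) * u)"
      by (simp only: mult_ac diff_zero)
    also have "\<dots> = 1 / ((u + inverse u) / 2 - of_real x) * (of_real pi * \<i> * (u - inverse u))"
    proof -
      have "2 * p * q * (w / 2 / K) = 1 / K * (p * q * w)" for p q w K :: complex
        by simp
      then show ?thesis unfolding eq .
    qed
    finally show ?thesis
      unfolding C' d unfolding C bernstein_path_eq u_def[symmetric] .
  qed
  ultimately have "((\<lambda>w. 1 / (w - of_real x)) has_contour_integral 2 * of_real pi * \<i>) (bernstein_path r)"
    by (simp add: has_contour_integral)
  moreover have "of_real x \<notin> path_image (bernstein_path r)"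
    using interval_notin_ellipse[OF assms] by (simp add: path_image_bernstein_path[OF r0])
  ultimately show ?thesis
    using valid_path_bernstein[OF r0] by (simp add: winding_number_valid_path contour_integral_unique)
qed

text \<open>The weak form of Cauchy's formula fits here: it asks for continuity on the closed convex
  region and differentiability in its interior only.\<close>

lemma cauchy_formula_bernstein:
  assumes r: "r > 1" and x: "x \<in> {-1..1}" and cont: "continuous_on (filled_ellipse r) \<phi>"
    and hol: "\<phi> holomorphic_on inside (bernstein_ellipse r)"
  shows "(\<integral>t. indicator {0..1} t *\<^sub>R (\<phi> (bernstein_path r t) * bern_deriv r t / (bernstein_path r t - of_real x)) \<partial>lborel)
     = 2 * of_real pi * \<i> * \<phi> (of_real x)"
proof -
  have r0: "r > 0" using r by simp
  have int: "interior (filled_ellipse r) = inside (bernstein_ellipse r)"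
    by (simp add: interior_filled_ellipse[OF r] inside_bernstein_ellipse[OF r])
  have xin: "of_real x \<in> inside (bernstein_ellipse r)"
    by (rule interval_in_inside[OF r x])
  have sub: "path_image (bernstein_path r) \<subseteq> filled_ellipse r - {of_real x}"
    using interval_notin_ellipse[OF r x] ellipse_Un_inside[OF r]
    by (auto simp: path_image_bernstein_path[OF r0])
  have "((\<lambda>w. \<phi> w / (w - of_real x)) has_contour_integral
      (2 * pi * \<i> * winding_number (bernstein_path r) (of_real x) * \<phi> (of_real x))) (bernstein_path r)"
  proof (rule Cauchy_integral_formula_weak[where S = "filled_ellipse r" and k = "{}"])
    show "\<phi> field_differentiable at z" if "z \<in> interior (filled_ellipse r) - {}" for z
      using that hol holomorphic_on_imp_differentiable_at[OF hol] by (auto simp: int[symmetric])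
    show "pathfinish (bernstein_path r) = pathstart (bernstein_path r)"
      by (simp add: pathfinish_def pathstart_def bernstein_path_def)
  qed (use sub xin in \<open>auto simp: convex_filled_ellipse cont int valid_path_bernstein[OF r0]\<close>)
  then have "((\<lambda>t. \<phi> (bernstein_path r t) / (bernstein_path r t - of_real x) * bern_deriv r t)
     has_integral (2 * of_real pi * \<i> * \<phi> (of_real x))) {0..1}"
    unfolding has_contour_integral vector_derivative_at[OF bernstein_path_deriv[OF r0, of _ UNIV]]
      winding_number_bernstein[OF r x] by simp
  then have "((\<lambda>t. \<phi> (bernstein_path r t) * bern_deriv r t / (bernstein_path r t - of_real x))
     has_integral (2 * of_real pi * \<i> * \<phi> (of_real x))) {0..1}"
    by (simp add: mult_ac)
  moreover have "continuous_on {0..1} (\<lambda>t. \<phi> (bernstein_path r t) * bern_deriv r t / (bernstein_path r t - of_real x))"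
  proof (intro continuous_intros continuous_on_bern_deriv continuous_on_bernstein_path r0
      continuous_on_compose2[OF cont])
    show "bernstein_path r ` {0..1} \<subseteq> filled_ellipse r"
      using bernstein_path_in_ellipse[OF r0] ellipse_Un_inside[OF r] by auto
    show "\<forall>t\<in>{0..1}. bernstein_path r t - of_real x \<noteq> 0"
      using interval_notin_ellipse[OF r x] bernstein_path_in_ellipse[OF r0] by (metis eq_iff_diff_eq_0)
  qed
  then have "set_integrable lborel {0..1} (\<lambda>t. \<phi> (bernstein_path r t) * bern_deriv r t / (bernstein_path r t - of_real x))"
    by (rule borel_integrable_atLeastAtMost')
  ultimately show ?thesis
    using set_borel_integral_eq_integral(2) integral_unique
    unfolding set_lebesgue_integral_def by metis
qed

section \<open>One-variable coefficients as integrals over the ellipse\<close>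

text \<open>With the \<open>Q_n\<close> of the overview this is \<open>Q_n(z) dz / (2 pi i)\<close>
  pulled back to the parameter interval and extended by 0.\<close>

definition geg_kernel :: "real \<Rightarrow> real \<Rightarrow> nat \<Rightarrow> real \<Rightarrow> complex" where
  "geg_kernel l r n t = of_real (indicator {0..1} t) * bern_deriv r t / (2 * of_real pi * \<i> * of_real (geg_h l n)) *
     (\<integral>x. of_real (poly (geg l n) x) * of_real (gw l x) / (bernstein_path r t - of_real x) \<partial>lborel)"

lemma geg_kernel_measurable [measurable]:
  assumes "r > 0"
  shows "geg_kernel l r n \<in> borel_measurable borel"
proof -
  have [measurable]: "bernstein_path r \<in> borel_measurable borel" "bern_deriv r \<in> borel_measurable borel"
    by (intro borel_measurable_continuous_onI continuous_on_bernstein_path continuous_on_bern_deriv assms)+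
  have [measurable]: "poly (geg l n) \<in> borel_measurable borel"
    by (intro borel_measurable_continuous_onI continuous_intros)
  show ?thesis unfolding geg_kernel_def[abs_def] by measurable
qed

lemma norm_geg_kernel_le:
  assumes "l > 0" "r > 1"
  shows "norm (geg_kernel l r n t)
    \<le> indicator {0..1} t * norm (bern_deriv r t) * (fact n / pochhammer l n * geg_S l r / (pi * r ^ Suc n))"
proof -
  have h: "geg_h l n > 0" using geg_h_pos[OF assms(1)] .
  have "norm (geg_kernel l r n t) = indicator {0..1} t * norm (bern_deriv r t) / (2 * pi * geg_h l n) *
     norm (\<integral>x. of_real (poly (geg l n) x) * of_real (gw l x) / (bernstein_path r t - of_real x) \<partial>lborel)"
    using h by (simp add: geg_kernel_def norm_mult norm_divide)
  also have "\<dots> \<le> indicator {0..1} t * norm (bern_deriv r t) / (2 * pi * geg_h l n) *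
      (2 * geg_h l n * (fact n / pochhammer l n) * geg_S l r / r ^ Suc n)"
    unfolding bernstein_path_eq
    by (intro mult_left_mono norm_stieltjes_geg_le) (use assms h norm_bern_circle[of r t] in auto)
  also have "\<dots> = indicator {0..1} t * norm (bern_deriv r t) * (fact n / pochhammer l n * geg_S l r / (pi * r ^ Suc n))"
    using h by (simp add: field_simps)
  finally show ?thesis .
qed

text \<open>The estimate of the \<open>L^1\<close> norm is the one-variable form of the bound; the
  length of the ellipse arises from integrating the norm of \<open>bern_deriv\<close>.\<close>

lemma integrable_geg_kernel:
  assumes "l > 0" "r > 1"
  shows "integrable lborel (geg_kernel l r n)"
    and "(\<integral>t. norm (geg_kernel l r n t) \<partial>lborel)
       \<le> bernstein_length r / (pi * r ^ n) * (if n = 0 then Dbar l r else real n powr (1 - l) * Dconst l r)"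
proof -
  have r0: "r > 0" using assms by simp
  let ?c = "fact n / pochhammer l n * geg_S l r / (pi * r ^ Suc n)"
  have maj: "integrable lborel (\<lambda>t. indicator {0..1} t * norm (bern_deriv r t) * ?c)"
    by (intro integrable_mult_left bernstein_length_lborel(1) r0)
  have [measurable]: "geg_kernel l r n \<in> borel_measurable borel"
    using r0 by (rule geg_kernel_measurable)
  show int: "integrable lborel (geg_kernel l r n)"
  proof (rule Bochner_Integration.integrable_bound[OF maj])
    show "AE t in lborel. norm (geg_kernel l r n t) \<le> norm (indicator {0..1} t * norm (bern_deriv r t) * ?c)"
      unfolding real_norm_def by (intro AE_I2 order_trans[OF norm_geg_kernel_le[OF assms] abs_ge_self])
  qed measurable
  have "(\<integral>t. norm (geg_kernel l r n t) \<partial>lborel)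
      \<le> (\<integral>t. indicator {0..1} t * norm (bern_deriv r t) * ?c \<partial>lborel)"
    by (intro integral_mono integrable_norm int maj norm_geg_kernel_le assms)
  also have "\<dots> = bernstein_length r * ?c"
    unfolding integral_mult_left_zero bernstein_length_lborel(2)[OF r0] ..
  also have "\<dots> = bernstein_length r / (pi * r ^ n) * (fact n / pochhammer l n * geg_S l r / r)"
    by (simp add: field_simps)
  also have "\<dots> \<le> bernstein_length r / (pi * r ^ n) * (if n = 0 then Dbar l r else real n powr (1 - l) * Dconst l r)"
    using bernstein_length_nonneg[OF r0] r0 by (intro mult_left_mono coeff_constant_le assms) auto
  finally show "(\<integral>t. norm (geg_kernel l r n t) \<partial>lborel)
       \<le> bernstein_length r / (pi * r ^ n) * (if n = 0 then Dbar l r else real n powr (1 - l) * Dconst l r)" .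
qed

lemma lborel_pair_integrable_mult:
  fixes f g :: "real \<Rightarrow> real"
  assumes f: "integrable lborel f" and g: "integrable lborel g"
  shows "integrable (lborel \<Otimes>\<^sub>M lborel) (\<lambda>(x, t). f x * g t)"
proof (rule lborel_pair.Fubini_integrable)
  have [measurable]: "f \<in> borel_measurable borel" "g \<in> borel_measurable borel"
    using f g by auto
  show "(\<lambda>(x, t). f x * g t) \<in> borel_measurable (lborel \<Otimes>\<^sub>M lborel)"
    by measurable
  show "integrable lborel (\<lambda>x. \<integral>t. norm (case (x, t) of (x, t) \<Rightarrow> f x * g t) \<partial>lborel)"
    using f by (simp add: abs_mult)
  show "AE x in lborel. integrable lborel (\<lambda>t. case (x, t) of (x, t) \<Rightarrow> f x * g t)"
    using g by simp
qed

text \<open>Cauchy's formula is inserted for the value at \<open>x\<close> and the integrals are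
  exchanged. The denominator stays away from 0 by \<open>dist_ellipse_interval\<close>, so the
  integrand is dominated by a tensor product.\<close>

lemma geg_coeff_eq_kernel_integral:
  assumes l: "l > 0" and r: "r > 1" and cont: "continuous_on (filled_ellipse r) \<phi>"
    and hol: "\<phi> holomorphic_on inside (bernstein_ellipse r)"
  shows "(\<integral>x. \<phi> (of_real x) * of_real (poly (geg l n) x * gw l x / geg_h l n) \<partial>lborel)
     = (\<integral>t. \<phi> (bernstein_path r t) * geg_kernel l r n t \<partial>lborel)"
proof -
  have r0: "r > 0" using r by simp
  have h: "geg_h l n > 0" using geg_h_pos[OF l] .
  define P where "P x = poly (geg l n) x * gw l x" for x
  define \<psi> where "\<psi> t = indicator {0..1} t *\<^sub>R (\<phi> (bernstein_path r t) * bern_deriv r t)" for t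
  define c where "c = 2 * of_real pi * \<i> * complex_of_real (geg_h l n)"
  have c0: "c \<noteq> 0" using h by (simp add: c_def)
  define f where "f x t = \<psi> t / c * (of_real (P x) / (bernstein_path r t - of_real x))" for x t
  have contg: "continuous_on {0..1} (\<lambda>t. \<phi> (bernstein_path r t) * bern_deriv r t)"
  proof (intro continuous_intros continuous_on_bern_deriv continuous_on_bernstein_path r0
      continuous_on_compose2[OF cont])
    show "bernstein_path r ` {0..1} \<subseteq> filled_ellipse r"
      using bernstein_path_in_ellipse[OF r0] ellipse_Un_inside[OF r] by auto
  qed
  obtain M where M: "norm (\<phi> (bernstein_path r t) * bern_deriv r t) \<le> M" if "t \<in> {0..1}" for t
    using compact_continuous_image[OF contg, THEN compact_imp_bounded]
    unfolding bounded_iff by (metis (no_types, lifting) compact_Icc image_eqI)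
  have [measurable]: "\<psi> \<in> borel_measurable borel"
    unfolding \<psi>_def using contg by (intro borel_measurable_continuous_on_indicator) auto
  have [measurable]: "bernstein_path r \<in> borel_measurable borel"
    by (intro borel_measurable_continuous_onI continuous_on_bernstein_path r0)
  have Pint: "integrable lborel P"
    using integrable_mult_gw[OF l, of "poly (geg l n)"] by (simp add: P_def[abs_def] continuous_intros)
  then have [measurable]: "P \<in> borel_measurable borel" by auto
  \<comment> \<open>\<open>M\<close> bounds \<open>\<phi>\<close> times the derivative of the path,
    and \<open>2 r / (r - 1)^2\<close> is the reciprocal of the distance bound.\<close>
  define K where "K = M / norm c * (2 * r / (r - 1)\<^sup>2)"
  have bd: "norm (f x t) \<le> K * (\<bar>P x\<bar> * indicator {0..1} t)" for x t
  proof (cases "t \<in> {0..1} \<and> x \<in> {-1..1}")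
    case True
    have "0 < (r - 1)\<^sup>2 / (2 * r)" using r by simp
    moreover have "(r - 1)\<^sup>2 / (2 * r) \<le> norm (bernstein_path r t - of_real x)"
      unfolding bernstein_path_eq using True r by (intro dist_ellipse_interval norm_bern_circle) auto
    ultimately have "1 / norm (bernstein_path r t - of_real x) \<le> 1 / ((r - 1)\<^sup>2 / (2 * r))"
      by (intro divide_left_mono mult_pos_pos) auto
    then have 1: "1 / norm (bernstein_path r t - of_real x) \<le> 2 * r / (r - 1)\<^sup>2" by simp
    have 2: "norm (\<psi> t) \<le> M" using M[of t] True by (simp add: \<psi>_def)
    have "norm (f x t) = norm (\<psi> t) / norm c * (\<bar>P x\<bar> * (1 / norm (bernstein_path r t - of_real x)))"
      by (simp add: f_def norm_mult norm_divide)
    also have "\<dots> \<le> M / norm c * (\<bar>P x\<bar> * (2 * r / (r - 1)\<^sup>2))"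
      using 1 2 r order_trans[OF norm_ge_zero 2] by (intro mult_mono divide_right_mono mult_left_mono) auto
    finally show ?thesis using True by (simp add: K_def mult_ac)
  next
    case False
    then have "\<psi> t = 0 \<or> P x = 0" by (auto simp: \<psi>_def P_def gw_eq_0)
    then show ?thesis using False by (auto simp: f_def P_def gw_eq_0)
  qed
  have "integrable lborel (indicator {0..1::real} :: real \<Rightarrow> real)" by simp
  with Pint have "integrable (lborel \<Otimes>\<^sub>M lborel) (\<lambda>(x, t). \<bar>P x\<bar> * (indicator {0..1::real} t :: real))"
    by (intro lborel_pair_integrable_mult integrable_abs)
  then have "integrable (lborel \<Otimes>\<^sub>M lborel) (\<lambda>z. K * (case z of (x, t) \<Rightarrow> \<bar>P x\<bar> * (indicator {0..1::real} t :: real)))"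
    by (rule integrable_mult_right)
  then have "integrable (lborel \<Otimes>\<^sub>M lborel) (case_prod f)"
  proof (rule Bochner_Integration.integrable_bound)
    show "case_prod f \<in> borel_measurable (lborel \<Otimes>\<^sub>M lborel)"
      unfolding f_def by measurable
    show "AE z in lborel \<Otimes>\<^sub>M lborel. norm (case_prod f z) \<le>
        norm (K * (case z of (x, t) \<Rightarrow> \<bar>P x\<bar> * (indicator {0..1::real} t :: real)))"
      unfolding real_norm_def by (intro AE_I2) (auto intro: order_trans[OF bd abs_ge_self])
  qed
  then have "(\<integral>t. (\<integral>x. f x t \<partial>lborel) \<partial>lborel) = (\<integral>x. (\<integral>t. f x t \<partial>lborel) \<partial>lborel)"
    by (rule lborel_pair.Fubini_integral)
  moreover have "(\<integral>x. f x t \<partial>lborel) = \<phi> (bernstein_path r t) * geg_kernel l r n t" for t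
  proof -
    have "(\<integral>x. f x t \<partial>lborel) = \<psi> t / c * (\<integral>x. of_real (P x) / (bernstein_path r t - of_real x) \<partial>lborel)"
      unfolding f_def by (rule integral_mult_right_zero)
    also have "\<psi> t / c = \<phi> (bernstein_path r t) * (of_real (indicator {0..1} t) * bern_deriv r t / c)"
      by (simp add: \<psi>_def scaleR_conv_of_real)
    finally show ?thesis by (simp add: geg_kernel_def c_def P_def mult.assoc)
  qed
  moreover have "(\<integral>t. f x t \<partial>lborel) = \<phi> (of_real x) * of_real (poly (geg l n) x * gw l x / geg_h l n)" for x
  proof (cases "x \<in> {-1..1}")
    case True
    have "(\<integral>t. f x t \<partial>lborel) =
       (\<integral>t. of_real (P x) / c * (indicator {0..1} t *\<^sub>R (\<phi> (bernstein_path r t) * bern_deriv r t / (bernstein_path r t - of_real x))) \<partial>lborel)"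
      by (rule Bochner_Integration.integral_cong) (simp_all add: f_def \<psi>_def scaleR_conv_of_real)
    also have "\<dots> = of_real (P x) / c * (2 * of_real pi * \<i> * \<phi> (of_real x))"
      unfolding integral_mult_right_zero cauchy_formula_bernstein[OF r True cont hol] ..
    also have "\<dots> = \<phi> (of_real x) * of_real (P x / geg_h l n)"
      using h by (simp add: c_def)
    finally show ?thesis by (simp add: P_def)
  qed (simp add: f_def P_def gw_eq_0)
  ultimately show ?thesis by simp
qed

section \<open>Several variables\<close>

lemma borel_measurable_vec_lambda:
  fixes f :: "'d::finite \<Rightarrow> 'a \<Rightarrow> 'b::euclidean_space"
  assumes "\<And>j. f j \<in> borel_measurable M"
  shows "(\<lambda>t. \<chi> j. f j t) \<in> borel_measurable M"
  by (subst borel_measurable_euclidean_space)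
     (auto simp: inner_vec_def intro!: borel_measurable_sum borel_measurable_inner assms)

text \<open>Both measures give a box the product of its side lengths. Through this identity an
  integral over \<open>real^'d\<close> can be taken coordinate by coordinate.\<close>

lemma lborel_vec_eq_distr:
  "(lborel :: (real^'d) measure) = distr (Pi\<^sub>M UNIV (\<lambda>_. lborel)) borel (\<lambda>x. \<chi> j. x j)"
proof (rule lborel_eqI)
  interpret product_sigma_finite "\<lambda>_::'d. lborel :: real measure" by standard
  have meas: "(\<lambda>x. \<chi> j. x j :: real^'d) \<in> Pi\<^sub>M UNIV (\<lambda>_. lborel) \<rightarrow>\<^sub>M borel"
    by (intro borel_measurable_vec_lambda) measurable
  fix l u :: "real^'d" assume le: "\<And>b. b \<in> Basis \<Longrightarrow> l \<bullet> b \<le> u \<bullet> b"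
  have le': "l $ j \<le> u $ j" for j
    using le[of "axis j 1"] by (simp add: inner_axis axis_in_Basis_iff)
  have "(\<lambda>x. \<chi> j. x j) -` box l u \<inter> space (Pi\<^sub>M UNIV (\<lambda>_. lborel)) = (Pi\<^sub>E UNIV (\<lambda>j. {l $ j<..<u $ j}))"
    by (auto simp: mem_box_cart space_PiM PiE_def Pi_def)
  then have "emeasure (distr (Pi\<^sub>M UNIV (\<lambda>_. lborel)) borel (\<lambda>x. \<chi> j. x j)) (box l u)
      = (\<Prod>j\<in>UNIV. emeasure lborel {l $ j<..<u $ j})"
    using meas by (simp add: emeasure_distr emeasure_PiM)
  also have "\<dots> = ennreal (\<Prod>j\<in>UNIV. u $ j - l $ j)"
    using le' by (simp add: prod_ennreal)
  also have "(\<Prod>j\<in>UNIV. u $ j - l $ j) = (\<Prod>b\<in>Basis. (u - l) \<bullet> b)"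
  proof -
    have "(Basis :: (real^'d) set) = (\<lambda>j. axis j 1) ` UNIV"
      by (auto simp: Basis_vec_def)
    then have "(\<Prod>b\<in>Basis. (u - l) \<bullet> b) = (\<Prod>b\<in>(\<lambda>j. axis j 1) ` UNIV. (u - l) \<bullet> b)"
      by (rule arg_cong)
    also have "\<dots> = (\<Prod>j\<in>UNIV. (u - l) \<bullet> axis j 1)"
      by (subst prod.reindex) (auto simp: inj_on_def axis_eq_axis)
    finally show ?thesis by (simp add: inner_axis)
  qed
  finally show "emeasure (distr (Pi\<^sub>M UNIV (\<lambda>_. lborel)) borel (\<lambda>x. \<chi> j. x j)) (box l u)
      = ennreal (\<Prod>b\<in>Basis. (u - l) \<bullet> b)" .
qed simp

definition vupd :: "'a^'d \<Rightarrow> 'd \<Rightarrow> 'a \<Rightarrow> 'a^'d" where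
  "vupd z i w = (\<chi> j. if j = i then w else z $ j)"

lemma integrable_bounded_mult_prod:
  fixes g :: "complex^'d \<Rightarrow> complex" and p :: "'d \<Rightarrow> real \<Rightarrow> complex"
  assumes g: "g \<in> borel_measurable borel" "\<And>z. norm (g z) \<le> B"
    and p: "\<And>j. p j \<in> borel_measurable borel" and w: "\<And>j. integrable lborel (w j)"
  shows "integrable (Pi\<^sub>M UNIV (\<lambda>_. lborel)) (\<lambda>x. g (\<chi> j. p j (x j)) * (\<Prod>j\<in>UNIV. w j (x j)))"
proof -
  interpret product_sigma_finite "\<lambda>_::'d. lborel :: real measure" by standard
  have [measurable]: "p j \<in> borel_measurable lborel" for j using p by simp
  have int: "integrable (Pi\<^sub>M UNIV (\<lambda>_. lborel)) (\<lambda>x. \<Prod>j\<in>UNIV. w j (x j))"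
    by (rule product_integrable_prod) (use w in auto)
  have m: "(\<lambda>x. g (\<chi> j. p j (x j))) \<in> borel_measurable (Pi\<^sub>M UNIV (\<lambda>_. lborel))"
    by (rule measurable_compose[OF borel_measurable_vec_lambda g(1)]) measurable
  show ?thesis
  proof (rule Bochner_Integration.integrable_bound)
    show "integrable (Pi\<^sub>M UNIV (\<lambda>_. lborel)) (\<lambda>x. of_real B * (\<Prod>j\<in>UNIV. w j (x j)))"
      using int by (rule integrable_mult_right)
    show "(\<lambda>x. g (\<chi> j. p j (x j)) * (\<Prod>j\<in>UNIV. w j (x j))) \<in> borel_measurable (Pi\<^sub>M UNIV (\<lambda>_. lborel))"
      using m borel_measurable_integrable[OF int] by (rule borel_measurable_times)
    show "AE x in Pi\<^sub>M UNIV (\<lambda>_. lborel). norm (g (\<chi> j. p j (x j)) * (\<Prod>j\<in>UNIV. w j (x j)))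
        \<le> norm (of_real B * (\<Prod>j\<in>UNIV. w j (x j)))"
      unfolding norm_mult norm_of_real
      by (intro AE_I2 mult_right_mono) (auto intro: order_trans[OF g(2) abs_ge_self])
  qed
qed

text \<open>One coordinate at a time, a linear functional given by integration along \<open>p i\<close> against \<open>v i\<close>
  is replaced by the equal functional given by integration along \<open>q i\<close> against \<open>w i\<close>.\<close>

lemma PiM_replace_functionals:
  fixes f :: "complex^'d \<Rightarrow> complex" and p q v w :: "'d \<Rightarrow> real \<Rightarrow> complex" and Z :: "'d \<Rightarrow> complex set"
  defines "K \<equiv> {z. \<forall>j. z $ j \<in> Z j}"
  defines "g \<equiv> \<lambda>z. if z \<in> K then f z else 0"
  assumes g: "g \<in> borel_measurable borel" "\<And>z. norm (g z) \<le> B"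
    and p: "\<And>j. p j \<in> borel_measurable borel" and q: "\<And>j. q j \<in> borel_measurable borel"
    and v: "\<And>j. integrable lborel (v j)" and w: "\<And>j. integrable lborel (w j)"
    and pZ: "\<And>j x. v j x \<noteq> 0 \<Longrightarrow> p j x \<in> Z j" and qZ: "\<And>j x. w j x \<noteq> 0 \<Longrightarrow> q j x \<in> Z j"
    and Z: "\<And>j. Z j \<noteq> {}"
    and eq: "\<And>i z. z \<in> K \<Longrightarrow> (\<integral>x. f (vupd z i (p i x)) * v i x \<partial>lborel) = (\<integral>t. f (vupd z i (q i t)) * w i t \<partial>lborel)"
  shows "(\<integral>x. g (\<chi> j. p j (x j)) * (\<Prod>j\<in>UNIV. v j (x j)) \<partial>Pi\<^sub>M UNIV (\<lambda>_. lborel))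
    = (\<integral>x. g (\<chi> j. q j (x j)) * (\<Prod>j\<in>UNIV. w j (x j)) \<partial>Pi\<^sub>M UNIV (\<lambda>_. lborel))"
proof -
  interpret product_sigma_finite "\<lambda>_::'d. lborel :: real measure" by standard
  \<comment> \<open>Hybrid integrands: the coordinates in \<open>S\<close> are already replaced, the
    others not yet.\<close>
  define a where "a S j = (if j \<in> S then q j else p j)" for S j
  define b where "b S j = (if j \<in> S then w j else v j)" for S j
  have a: "a S j \<in> borel_measurable borel" for S j
    using p q by (simp add: a_def)
  have b: "integrable lborel (b S j)" for S j
    using v w by (simp add: b_def)
  have abZ: "b S j x \<noteq> 0 \<Longrightarrow> a S j x \<in> Z j" for S j x
    using pZ qZ by (auto simp: a_def b_def split: if_splits)
  define F where "F S x = g (\<chi> j. a S j (x j)) * (\<Prod>j\<in>UNIV. b S j (x j))" for S x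
  have int: "integrable (Pi\<^sub>M UNIV (\<lambda>_. lborel)) (F S)" for S
    unfolding F_def by (rule integrable_bounded_mult_prod[OF g a b])
  have split: "integral\<^sup>L (Pi\<^sub>M UNIV (\<lambda>_. lborel)) (F S)
      = (\<integral>x. (\<integral>y. F S (x(i := y)) \<partial>lborel) \<partial>Pi\<^sub>M (UNIV - {i}) (\<lambda>_. lborel))" for S i
    using product_integral_insert[of "UNIV - {i}" i "F S"] int[of S] by (simp add: insert_absorb)
  have step: "(\<integral>y. F S (x(i := y)) \<partial>lborel) = (\<integral>y. F (insert i S) (x(i := y)) \<partial>lborel)"
    if iS: "i \<notin> S" for S i x
  proof -
    define c where "c = (\<Prod>j\<in>UNIV - {i}. b S j (x j))"
    have c': "c = (\<Prod>j\<in>UNIV - {i}. b (insert i S) j (x j))"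
      unfolding c_def by (rule prod.cong) (auto simp: b_def)
    have prods: "(\<Prod>j\<in>UNIV. b T j ((x(i := y)) j)) = b T i y * (\<Prod>j\<in>UNIV - {i}. b T j (x j))" for T y
    proof -
      have "(\<Prod>j\<in>UNIV - {i}. b T j ((x(i := y)) j)) = (\<Prod>j\<in>UNIV - {i}. b T j (x j))"
        by (rule prod.cong) auto
      then show ?thesis
        using prod.remove[of UNIV i "\<lambda>j. b T j ((x(i := y)) j)"] by simp
    qed
    \<comment> \<open>Only a placeholder: \<open>vupd\<close> overwrites coordinate
      \<open>i\<close>, but \<open>z\<close> has to lie in \<open>K\<close> for
      \<open>eq\<close>.\<close>
    obtain e where e: "e \<in> Z i" using Z[of i] by blast
    define z where "z = (\<chi> j. if j = i then e else a S j (x j))"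
    have upd: "(\<chi> j. a S j ((x(i := y)) j)) = vupd z i (p i y)"
      "(\<chi> j. a (insert i S) j ((x(i := y)) j)) = vupd z i (q i y)" for y
      using iS by (auto simp: vupd_def z_def a_def vec_eq_iff)
    have bi: "b S i = v i" "b (insert i S) i = w i"
      using iS by (auto simp: b_def)
    have F: "F S (x(i := y)) = c * (g (vupd z i (p i y)) * v i y)"
      "F (insert i S) (x(i := y)) = c * (g (vupd z i (q i y)) * w i y)" for y
      unfolding F_def prods upd bi c_def[symmetric] c'[symmetric] by (simp_all add: mult_ac)
    show ?thesis
    proof (cases "c = 0")
      case False
      \<comment> \<open>A nonzero \<open>c\<close> means nonzero weights in all other coordinates,
        so these lie in their sets \<open>Z j\<close> and the slice equation applies.\<close>
      then have "b S j (x j) \<noteq> 0" if "j \<noteq> i" for j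
        using that by (auto simp: c_def)
      then have zK: "z \<in> K"
        using abZ[of S] e by (auto simp: K_def z_def)
      then have upK: "vupd z i y \<in> K \<longleftrightarrow> y \<in> Z i" for y
        by (auto simp: K_def vupd_def)
      have gf: "g (vupd z i (p i y)) * v i y = f (vupd z i (p i y)) * v i y"
        "g (vupd z i (q i y)) * w i y = f (vupd z i (q i y)) * w i y" for y
        using pZ[of i y] qZ[of i y] by (auto simp: g_def upK)
      show ?thesis
        unfolding F gf integral_mult_right_zero eq[OF zK, of i] ..
    qed (simp add: F)
  qed
  have "integral\<^sup>L (Pi\<^sub>M UNIV (\<lambda>_. lborel)) (F {}) = integral\<^sup>L (Pi\<^sub>M UNIV (\<lambda>_. lborel)) (F S)" if "finite S" for S
    using that
  proof induction
    case (insert i S)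
    then show ?case unfolding split[of _ i] using step by simp
  qed simp
  from this[of UNIV] show ?thesis by (simp add: F_def[abs_def] a_def b_def)
qed

section \<open>The coefficient as an integral over the polyellipse\<close>

definition filled_polyellipse :: "real^'d \<Rightarrow> (complex^'d) set" where
  "filled_polyellipse \<rho> = {z. \<forall>j. z $ j \<in> filled_ellipse (\<rho> $ j)}"

lemma compact_filled_polyellipse: "compact (filled_polyellipse (\<rho> :: real^'d))"
proof -
  have "closed ((\<lambda>z :: complex^'d. z $ j) -` filled_ellipse (\<rho> $ j))" for j
    by (intro closed_vimage compact_imp_closed[OF compact_filled_ellipse] continuous_intros)
  then have "closed (filled_polyellipse \<rho>)"
    unfolding filled_polyellipse_def by (intro closed_Collect_all) (simp add: vimage_def)
  moreover have "bounded (filled_polyellipse \<rho>)"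
  proof -
    have "\<exists>B. \<forall>w\<in>filled_ellipse (\<rho> $ j). norm w \<le> B" for j
      using compact_imp_bounded[OF compact_filled_ellipse] by (auto simp: bounded_iff)
    then obtain B where B: "\<And>j w. w \<in> filled_ellipse (\<rho> $ j) \<Longrightarrow> norm w \<le> B j" by metis
    have "norm z \<le> (\<Sum>j\<in>UNIV. B j)" if "z \<in> filled_polyellipse \<rho>" for z
    proof -
      have "norm z \<le> (\<Sum>j\<in>UNIV. norm (z $ j))"
        unfolding norm_vec_def by (rule L2_set_le_sum) simp
      also have "\<dots> \<le> (\<Sum>j\<in>UNIV. B j)"
        using that B by (intro sum_mono) (auto simp: filled_polyellipse_def)
      finally show ?thesis .
    qed
    then show ?thesis by (auto simp: bounded_iff)
  qed
  ultimately show ?thesis by (simp add: compact_eq_bounded_closed)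
qed

text \<open>Nothing is known about \<open>f\<close> outside \<open>K\<close>; cutting it off there
  gives a bounded Borel function on the whole space.\<close>

lemma bounded_measurable_restrict:
  fixes f :: "'a::euclidean_space \<Rightarrow> complex"
  assumes "compact K" "continuous_on K f"
  obtains B where "(\<lambda>z. if z \<in> K then f z else 0) \<in> borel_measurable borel"
    "\<And>z. norm (if z \<in> K then f z else 0) \<le> B"
proof -
  obtain B where B: "\<And>z. z \<in> K \<Longrightarrow> norm (f z) \<le> B"
    using compact_continuous_image[OF assms(2,1), THEN compact_imp_bounded]
    unfolding bounded_iff by auto
  have "(\<lambda>z. indicator K z *\<^sub>R f z) \<in> borel_measurable borel"
    using assms by (intro borel_measurable_continuous_on_indicator) (auto intro: borel_compact)
  also have "(\<lambda>z. indicator K z *\<^sub>R f z) = (\<lambda>z. if z \<in> K then f z else 0)"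
    by auto
  finally show ?thesis
    using B by (intro that[of "max B 0"]) (auto intro: order_trans max.cobounded1)
qed

definition geg_weight_fun :: "real \<Rightarrow> nat \<Rightarrow> real \<Rightarrow> complex" where
  "geg_weight_fun l n x = of_real (poly (geg l n) x * gw l x / geg_h l n)"

lemma integrable_geg_weight_fun:
  assumes "l > 0"
  shows "integrable lborel (geg_weight_fun l n)"
proof -
  have "integrable lborel (\<lambda>x. poly (geg l n) x * gw l x)"
    using integrable_mult_gw[OF assms, of "poly (geg l n)"] by (simp add: continuous_intros)
  then have "integrable lborel (\<lambda>x. poly (geg l n) x * gw l x / geg_h l n)"
    by (rule integrable_divide_zero)
  then show ?thesis
    unfolding geg_weight_fun_def[abs_def] by (rule integrable_of_real)
qed

lemma geg_weight_fun_nonzero: "geg_weight_fun l n x \<noteq> 0 \<Longrightarrow> x \<in> {-1..1}"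
  using gw_eq_0[of x l] by (auto simp: geg_weight_fun_def)

text \<open>The factor \<open>1 / h_k\<close> is distributed over the coordinates, and the cutoff of
  \<open>f\<close> is invisible where the weights are nonzero.\<close>

lemma gegenbauer_coeff_PiM:
  fixes f :: "complex^'d \<Rightarrow> complex" and \<rho> :: "real^'d"
  assumes l: "l > 0" and \<rho>: "\<And>i. \<rho> $ i > 1" and cont: "continuous_on (filled_polyellipse \<rho>) f"
  shows "gegenbauer_coeff l f k = (\<integral>x. (if (\<chi> j. of_real (x j)) \<in> filled_polyellipse \<rho> then f (\<chi> j. of_real (x j)) else 0)
     * (\<Prod>j\<in>UNIV. geg_weight_fun l (k $ j) (x j)) \<partial>Pi\<^sub>M UNIV (\<lambda>_. lborel))"
proof -
  define g where "g z = (if z \<in> filled_polyellipse \<rho> then f z else 0)" for z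
  have g [measurable]: "g \<in> borel_measurable borel"
    using bounded_measurable_restrict[OF compact_filled_polyellipse cont] unfolding g_def by metis
  have h: "geg_h l n > 0" for n using geg_h_pos[OF l] .
  define G where "G x = g (\<chi> j. of_real (x $ j)) * (\<Prod>j\<in>UNIV. geg_weight_fun l (k $ j) (x $ j))" for x :: "real^'d"
  have int: "indicator hypercube x *\<^sub>R (f (\<chi> j. of_real (x $ j)) * of_real (mgegenbauer l k x) * of_real (mgegenbauer_weight l x))
      = of_real (mgegenbauer_h l k) * G x" for x
  proof (cases "x \<in> hypercube")
    case True
    then have x: "x $ j \<in> {-1..1}" for j by (auto simp: hypercube_def)
    then have "(\<chi> j. complex_of_real (x $ j)) \<in> filled_polyellipse \<rho>"
      using interval_in_inside[OF \<rho>] ellipse_Un_inside[OF \<rho>] by (force simp: filled_polyellipse_def)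
    moreover have "gegenbauer_weight l (x $ j) = gw l (x $ j)" for j
      using x by (simp add: gw_def)
    ultimately show ?thesis
      using True h
      by (simp add: G_def g_def mgegenbauer_def mgegenbauer_weight_def mgegenbauer_h_def gegenbauer_eq_geg[OF l]
          gegenbauer_h_eq[OF l] geg_weight_fun_def prod_dividef prod.distrib less_imp_neq[symmetric])
  next
    case False
    then obtain j where "x $ j \<notin> {-1..1}" by (auto simp: hypercube_def)
    then have "geg_weight_fun l (k $ j) (x $ j) = 0" using geg_weight_fun_nonzero by blast
    then have "G x = 0" by (auto simp: G_def)
    then show ?thesis using False by simp
  qed
  have [measurable]: "geg_weight_fun l n \<in> borel_measurable borel" for n
    using integrable_geg_weight_fun[OF l, of n] by auto
  have "(\<lambda>x. g (\<chi> j. of_real (x $ j))) \<in> borel_measurable borel"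
    by (rule measurable_compose[OF borel_measurable_vec_lambda g]) measurable
  then have Gm: "G \<in> borel_measurable borel"
    unfolding G_def by measurable
  have pos: "mgegenbauer_h l k > 0"
    unfolding mgegenbauer_h_def using h by (intro prod_pos) (simp add: gegenbauer_h_eq[OF l])
  have meas: "(\<lambda>x. \<chi> j. x j :: real^'d) \<in> Pi\<^sub>M UNIV (\<lambda>_. lborel) \<rightarrow>\<^sub>M borel"
    by (intro borel_measurable_vec_lambda) measurable
  have "gegenbauer_coeff l f k = (\<integral>x. G x \<partial>lborel)"
    unfolding gegenbauer_coeff_def set_lebesgue_integral_def int using pos by simp
  also have "\<dots> = (\<integral>x. G (\<chi> j. x j) \<partial>Pi\<^sub>M UNIV (\<lambda>_. lborel))"
    unfolding lborel_vec_eq_distr by (rule integral_distr[OF meas Gm])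
  finally show ?thesis by (simp add: G_def g_def)
qed

text \<open>The other coordinates of \<open>z\<close> may lie on the boundary, where \<open>f\<close> is only continuous, so the slice is
  obtained as a uniform limit of the slices of \<open>z \<mapsto> f (s z)\<close> as \<open>s\<close> increases to 1.\<close>

lemma slice_holomorphic:
  fixes f :: "complex^'d \<Rightarrow> complex" and \<rho> :: "real^'d"
  assumes \<rho>: "\<And>i. \<rho> $ i > 1" and an: "manalytic_on f (polyellipse_inside \<rho>)"
    and cont: "continuous_on (filled_polyellipse \<rho>) f" and z: "z \<in> filled_polyellipse \<rho>"
  shows "(\<lambda>w. f (vupd z i w)) holomorphic_on inside (bernstein_ellipse (\<rho> $ i))"
proof -
  let ?I = "inside (bernstein_ellipse (\<rho> $ i))"
  define s where "s n = 1 - inverse (real (Suc n))" for n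
  have s: "0 \<le> s n" "s n < 1" for n by (auto simp: s_def inverse_le_1_iff)
  have openI: "open ?I"
    unfolding inside_bernstein_ellipse[OF \<rho>] by (intro open_Collect_less continuous_intros)
  have IK: "vupd z i w \<in> filled_polyellipse \<rho>" if "w \<in> ?I" for w
    using that z ellipse_Un_inside[OF \<rho>, of i] by (auto simp: filled_polyellipse_def vupd_def)
  have shrink: "s n *\<^sub>R y \<in> polyellipse_inside \<rho>" if "y \<in> filled_polyellipse \<rho>" for n y
  proof -
    have "(s n *\<^sub>R y) $ j = of_real (s n) * y $ j" for j
      by (simp add: scaleR_conv_of_real[where 'a = complex])
    then show ?thesis
      using that filled_ellipse_shrink[OF \<rho> _ s(1)[of n] s(2)[of n]]
      by (simp add: filled_polyellipse_def polyellipse_inside_def inside_bernstein_ellipse[OF \<rho>] del: vector_scaleR_component)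
  qed
  have inK: "y \<in> filled_polyellipse \<rho>" if "y \<in> polyellipse_inside \<rho>" for y
    using that ellipse_Un_inside[OF \<rho>] by (auto simp: filled_polyellipse_def polyellipse_inside_def)
  show ?thesis
  proof (rule holomorphic_uniform_sequence[OF openI, where f = "\<lambda>n w. f (s n *\<^sub>R vupd z i w)"])
    fix n
    show "(\<lambda>w. f (s n *\<^sub>R vupd z i w)) holomorphic_on ?I"
      unfolding holomorphic_on_open[OF openI]
    proof
      fix w assume w: "w \<in> ?I"
      obtain a where a: "(f has_derivative (\<lambda>h. \<Sum>j\<in>UNIV. a $ j * h $ j)) (at (s n *\<^sub>R vupd z i w))"
        using an shrink[OF IK[OF w], of n] centre_in_ball unfolding manalytic_on_def by blast
      have lin: "(\<lambda>w. s n *\<^sub>R vupd z i w) = (\<lambda>w. s n *\<^sub>R vupd z i 0 + s n *\<^sub>R axis i w)"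
        by (auto simp: vec_eq_iff vupd_def axis_def)
      have "bounded_linear (\<lambda>h. s n *\<^sub>R axis i h :: complex^'d)"
        by (intro bounded_linear_const_scaleR linear_conv_bounded_linear[THEN iffD1] linearI)
           (auto simp: vec_eq_iff axis_def)
      then have "((\<lambda>h. s n *\<^sub>R axis i h :: complex^'d) has_derivative (\<lambda>h. s n *\<^sub>R axis i h)) (at w)"
        by (rule bounded_linear_imp_has_derivative)
      from has_derivative_add[OF has_derivative_const this, of "s n *\<^sub>R vupd z i 0"]
      have "((\<lambda>w. s n *\<^sub>R vupd z i w) has_derivative (\<lambda>h. s n *\<^sub>R axis i h)) (at w)"
        unfolding lin by simp
      from has_derivative_compose[OF this a]
      have "((\<lambda>w. f (s n *\<^sub>R vupd z i w)) has_derivative (\<lambda>h. \<Sum>j\<in>UNIV. a $ j * (s n *\<^sub>R axis i h) $ j)) (at w)" .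
      \<comment> \<open>Only the direction \<open>axis i\<close> enters, so the derivative is
        multiplication by one complex number, that is, complex differentiability in
        \<open>w\<close>.\<close>
      also have "(\<lambda>h. \<Sum>j\<in>UNIV. a $ j * (s n *\<^sub>R axis i h) $ j) = (*) (a $ i * of_real (s n))"
        by (auto simp: axis_def if_distrib scaleR_conv_of_real[where 'a = complex] mult_ac cong: if_cong)
      finally show "\<exists>f'. ((\<lambda>w. f (s n *\<^sub>R vupd z i w)) has_field_derivative f') (at w)"
        unfolding has_field_derivative_def by blast
    qed
  next
    fix x assume x: "x \<in> ?I"
    then obtain d where d: "d > 0" "cball x d \<subseteq> ?I"
      using openI open_contains_cball by blast
    obtain B where B: "\<And>y. y \<in> filled_polyellipse \<rho> \<Longrightarrow> norm y \<le> B"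
      using compact_imp_bounded[OF compact_filled_polyellipse] unfolding bounded_iff by metis
    have uc: "uniformly_continuous_on (filled_polyellipse \<rho>) f"
      by (rule compact_uniformly_continuous[OF cont compact_filled_polyellipse])
    \<comment> \<open>Uniform continuity on the compact closed polyellipse: scaling a point by
      \<open>s n\<close> shifts it by at most \<open>B / (n + 1)\<close>.\<close>
    have "uniform_limit ?I (\<lambda>n w. f (s n *\<^sub>R vupd z i w)) (\<lambda>w. f (vupd z i w)) sequentially"
    proof (rule uniform_limitI)
      fix e :: real assume "e > 0"
      then obtain \<delta> where \<delta>: "\<delta> > 0"
        "\<And>y y'. y \<in> filled_polyellipse \<rho> \<Longrightarrow> y' \<in> filled_polyellipse \<rho> \<Longrightarrow> dist y' y < \<delta> \<Longrightarrow> dist (f y') (f y) < e"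
        using uc unfolding uniformly_continuous_on_def by metis
      have "(\<lambda>n. inverse (real (Suc n)) * B) \<longlonglongrightarrow> 0 * B"
        by (intro tendsto_intros LIMSEQ_inverse_real_of_nat)
      then have "\<forall>\<^sub>F n in sequentially. inverse (real (Suc n)) * B < \<delta>"
        using \<delta>(1) by (intro order_tendstoD(2)) auto
      then show "\<forall>\<^sub>F n in sequentially. \<forall>w\<in>?I. dist (f (s n *\<^sub>R vupd z i w)) (f (vupd z i w)) < e"
      proof eventually_elim
        case (elim n)
        show ?case
        proof
          fix w assume w: "w \<in> ?I"
          have "s n *\<^sub>R vupd z i w - vupd z i w = - (inverse (real (Suc n)) *\<^sub>R vupd z i w)"
            by (simp add: s_def algebra_simps)
          then have "dist (s n *\<^sub>R vupd z i w) (vupd z i w) = inverse (real (Suc n)) * norm (vupd z i w)"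
            by (simp add: dist_norm)
          also have "\<dots> \<le> inverse (real (Suc n)) * B"
            by (intro mult_left_mono B IK w) auto
          also have "\<dots> < \<delta>" by fact
          finally show "dist (f (s n *\<^sub>R vupd z i w)) (f (vupd z i w)) < e"
            by (intro \<delta>(2) IK w inK shrink)
        qed
      qed
    qed
    then show "\<exists>d>0. cball x d \<subseteq> ?I \<and>
        uniform_limit (cball x d) (\<lambda>n w. f (s n *\<^sub>R vupd z i w)) (\<lambda>w. f (vupd z i w)) sequentially"
      using d uniform_limit_on_subset by blast
  qed
qed

lemma polyellipse_subset:
  assumes "\<And>i. \<rho> $ i > 1"
  shows "polyellipse \<rho> \<subseteq> filled_polyellipse \<rho>"
  using ellipse_Un_inside[OF assms] by (auto simp: polyellipse_def filled_polyellipse_def)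

lemma analytic_inside_polyellipse_iff:
  assumes "\<And>i. \<rho> $ i > 1"
  shows "analytic_inside_polyellipse \<rho> f \<longleftrightarrow>
    manalytic_on f (polyellipse_inside \<rho>) \<and> continuous_on (filled_polyellipse \<rho>) f"
  unfolding analytic_inside_polyellipse_def filled_polyellipse_def ellipse_Un_inside[OF assms] ..

lemma norm_le_max_on_polyellipse:
  assumes "\<And>i. \<rho> $ i > 1" "continuous_on (filled_polyellipse \<rho>) f" "z \<in> polyellipse \<rho>"
  shows "norm (f z) \<le> max_on_polyellipse \<rho> f"
proof -
  have "bounded (f ` polyellipse \<rho>)"
    using compact_continuous_image[OF assms(2) compact_filled_polyellipse, THEN compact_imp_bounded]
      polyellipse_subset[OF assms(1)] by (meson bounded_subset image_mono)
  then have "bdd_above ((\<lambda>z. norm (f z)) ` polyellipse \<rho>)"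
    by (auto simp: bounded_iff bdd_above_def)
  then show ?thesis
    unfolding max_on_polyellipse_def using assms(3) by (intro cSUP_upper)
qed

text \<open>Written as a single product over all coordinates, the bound has the shape of a product
  of \<open>L^1\<close> estimates of the kernels.\<close>

lemma gegenbauer_coeff_bound_eq:
  "gegenbauer_coeff_bound l \<rho> f k = max_on_polyellipse \<rho> f *
     (\<Prod>j\<in>UNIV. bernstein_length (\<rho> $ j) / (pi * (\<rho> $ j) ^ (k $ j)) *
       (if k $ j = 0 then Dbar l (\<rho> $ j) else real (k $ j) powr (1 - l) * Dconst l (\<rho> $ j)))"
  for \<rho> :: "real^'d"
proof -
  have "(\<Prod>j\<in>UNIV. if k $ j = 0 then Dbar l (\<rho> $ j) else real (k $ j) powr (1 - l) * Dconst l (\<rho> $ j))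
     = (\<Prod>i\<in>{i. k $ i = 0}. Dbar l (\<rho> $ i)) *
       (\<Prod>j\<in>{j. k $ j \<noteq> 0}. real (k $ j) powr (1 - l) * Dconst l (\<rho> $ j))"
    by (subst prod.If_cases) (auto simp: Compl_eq)
  then show ?thesis
    unfolding gegenbauer_coeff_bound_def polyellipse_length_def prod.distrib prod_dividef
    by (simp add: prod.distrib)
qed

text \<open>After the replacement \<open>f\<close> is evaluated only on the polyellipse, where its
  maximum bounds it, and the remaining integral of a product splits into one-dimensional
  ones.\<close>

lemma gegenbauer_coeff_upper:
  fixes \<rho> :: "real^'d"
  assumes l: "l > 0" and \<rho>: "\<And>i. \<rho> $ i > 1" and f: "analytic_inside_polyellipse \<rho> f"
  shows "norm (gegenbauer_coeff l f k) \<le> gegenbauer_coeff_bound l \<rho> f k"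
proof -
  interpret product_sigma_finite "\<lambda>_::'d. lborel :: real measure" by standard
  let ?K = "filled_polyellipse \<rho>"
  have \<rho>0: "\<rho> $ j > 0" for j using \<rho>[of j] by simp
  have cont: "continuous_on ?K f" and an: "manalytic_on f (polyellipse_inside \<rho>)"
    using f by (auto simp: analytic_inside_polyellipse_iff[OF \<rho>])
  define g where "g z = (if z \<in> ?K then f z else 0)" for z
  obtain B where g: "g \<in> borel_measurable borel" "\<And>z. norm (g z) \<le> B"
    using bounded_measurable_restrict[OF compact_filled_polyellipse cont] unfolding g_def by metis
  define q where "q j = bernstein_path (\<rho> $ j)" for j
  define w where "w j = geg_kernel l (\<rho> $ j) (k $ j)" for j
  define M where "M = max_on_polyellipse \<rho> f"
  have wint: "integrable lborel (w j)" for j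
    unfolding w_def by (rule integrable_geg_kernel[OF l \<rho>])
  have qE: "q j t \<in> bernstein_ellipse (\<rho> $ j)" for j t
    unfolding q_def by (rule bernstein_path_in_ellipse[OF \<rho>0])
  have qm: "q j \<in> borel_measurable borel" for j
    unfolding q_def by (intro borel_measurable_continuous_onI continuous_on_bernstein_path \<rho>0)
  have "gegenbauer_coeff l f k = (\<integral>x. g (\<chi> j. of_real (x j)) * (\<Prod>j\<in>UNIV. geg_weight_fun l (k $ j) (x j)) \<partial>Pi\<^sub>M UNIV (\<lambda>_. lborel))"
    unfolding g_def by (rule gegenbauer_coeff_PiM[OF l \<rho> cont])
  also have "\<dots> = (\<integral>x. g (\<chi> j. q j (x j)) * (\<Prod>j\<in>UNIV. w j (x j)) \<partial>Pi\<^sub>M UNIV (\<lambda>_. lborel))"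
    unfolding g_def
  proof (rule PiM_replace_functionals[where f = f and B = B and p = "\<lambda>j x. of_real x" and v = "\<lambda>j. geg_weight_fun l (k $ j)"
        and q = q and w = w and Z = "\<lambda>j. filled_ellipse (\<rho> $ j)", folded filled_polyellipse_def])
    fix i :: 'd and z assume z: "z \<in> ?K"
    have "continuous_on (filled_ellipse (\<rho> $ i)) (\<lambda>w. f (vupd z i w))"
    proof (rule continuous_on_compose2[OF cont])
      show "continuous_on (filled_ellipse (\<rho> $ i)) (vupd z i)"
        unfolding vupd_def by (intro continuous_on_vec_lambda, rename_tac j, case_tac "j = i") auto
      show "vupd z i ` filled_ellipse (\<rho> $ i) \<subseteq> ?K"
        using z by (auto simp: filled_polyellipse_def vupd_def)
    qed
    then show "(\<integral>x. f (vupd z i (of_real x)) * geg_weight_fun l (k $ i) x \<partial>lborel) =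
        (\<integral>t. f (vupd z i (q i t)) * w i t \<partial>lborel)"
      unfolding geg_weight_fun_def q_def w_def
      by (rule geg_coeff_eq_kernel_integral[OF l \<rho> _ slice_holomorphic[OF \<rho> an cont z]])
  next
    fix j show "filled_ellipse (\<rho> $ j) \<noteq> {}"
      using qE[of j 0] ellipse_Un_inside[OF \<rho>, of j] by auto
  next
    fix j :: 'd and x assume "geg_weight_fun l (k $ j) x \<noteq> 0"
    then show "complex_of_real x \<in> filled_ellipse (\<rho> $ j)"
      using interval_in_inside[OF \<rho>] ellipse_Un_inside[OF \<rho>, of j] geg_weight_fun_nonzero by blast
  next
    fix j x show "q j x \<in> filled_ellipse (\<rho> $ j)"
      using qE[of j x] ellipse_Un_inside[OF \<rho>, of j] by auto
  qed (use g[unfolded g_def[abs_def]] qm wint integrable_geg_weight_fun[OF l] in auto)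
  finally have eq: "gegenbauer_coeff l f k =
     (\<integral>x. g (\<chi> j. q j (x j)) * (\<Prod>j\<in>UNIV. w j (x j)) \<partial>Pi\<^sub>M UNIV (\<lambda>_. lborel))" .
  have qP: "(\<chi> j. q j (x j)) \<in> polyellipse \<rho>" for x
    using qE by (simp add: polyellipse_def)
  then have gM: "norm (g (\<chi> j. q j (x j))) \<le> M" for x
    using norm_le_max_on_polyellipse[OF \<rho> cont qP] polyellipse_subset[OF \<rho>]
    by (auto simp: g_def M_def)
  have M0: "M \<ge> 0" using gM norm_ge_zero order_trans by blast
  have int: "integrable (Pi\<^sub>M UNIV (\<lambda>_. lborel)) (\<lambda>x. g (\<chi> j. q j (x j)) * (\<Prod>j\<in>UNIV. w j (x j)))"
    by (rule integrable_bounded_mult_prod[OF g qm wint])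
  have "norm (gegenbauer_coeff l f k)
      \<le> (\<integral>x. norm (g (\<chi> j. q j (x j)) * (\<Prod>j\<in>UNIV. w j (x j))) \<partial>Pi\<^sub>M UNIV (\<lambda>_. lborel))"
    unfolding eq by (rule integral_norm_bound)
  also have "\<dots> \<le> (\<integral>x. M * (\<Prod>j\<in>UNIV. norm (w j (x j))) \<partial>Pi\<^sub>M UNIV (\<lambda>_. lborel))"
  proof (rule integral_mono[OF integrable_norm[OF int]])
    show "integrable (Pi\<^sub>M UNIV (\<lambda>_. lborel)) (\<lambda>x. M * (\<Prod>j\<in>UNIV. norm (w j (x j))))"
      by (intro integrable_mult_right product_integrable_prod integrable_norm wint) auto
    show "norm (g (\<chi> j. q j (x j)) * (\<Prod>j\<in>UNIV. w j (x j))) \<le> M * (\<Prod>j\<in>UNIV. norm (w j (x j)))" for x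
      unfolding norm_mult prod_norm[symmetric] using gM by (intro mult_right_mono) (auto intro: prod_nonneg)
  qed
  also have "\<dots> = M * (\<Prod>j\<in>UNIV. \<integral>t. norm (w j t) \<partial>lborel)"
    using product_integral_prod[of UNIV "\<lambda>j t. norm (w j t)"] wint by simp
  also have "\<dots> \<le> gegenbauer_coeff_bound l \<rho> f k"
    unfolding gegenbauer_coeff_bound_eq M_def[symmetric]
    using integrable_geg_kernel(2)[OF l \<rho>]
    by (intro mult_left_mono prod_mono M0) (auto simp: w_def)
  finally show ?thesis .
qed

section \<open>Optimality\<close>

lemma chebU_field_differentiable:
  fixes z :: complex
  shows "chebU n field_differentiable at z"
proof (induction n rule: induct_nat_012)
  case (ge2 n)
  then show ?case
    unfolding chebU.simps(3)[abs_def] by (intro derivative_intros)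
qed (auto simp: chebU.simps(1,2)[abs_def] intro!: derivative_intros)

lemma norm_chebU_ellipse_le:
  assumes "r > 1" "z \<in> bernstein_ellipse r"
  shows "norm (chebU n z) \<le> 2 * r / (r - inverse r) * r ^ n"
proof -
  obtain u where u: "norm u = r" "z = (u + inverse u) / 2"
    using assms(2) by (auto simp: bernstein_ellipse_def)
  have u0: "u \<noteq> 0" using u assms by auto
  have ri: "inverse r < 1" "inverse r > 0" using assms by (auto simp: inverse_less_1_iff)
  have "(r - inverse r) * norm (chebU n z) \<le> norm (u - inverse u) * norm (chebU n z)"
    using norm_triangle_ineq2[of u "inverse u"] u by (intro mult_right_mono) (auto simp: norm_inverse)
  also have "\<dots> = norm (u ^ Suc n - inverse u ^ Suc n)"
    unfolding u(2) norm_mult[symmetric] chebU_joukowski[OF u0] ..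
  also have "\<dots> \<le> r ^ Suc n + inverse r ^ Suc n"
    using norm_triangle_ineq4[of "u ^ Suc n" "inverse u ^ Suc n"] u
    by (simp add: norm_power norm_inverse del: power_Suc)
  also have "inverse r ^ Suc n \<le> r ^ Suc n"
    using ri assms by (intro power_mono) auto
  finally have "(r - inverse r) * norm (chebU n z) \<le> 2 * r * r ^ n" by simp
  moreover have "r - inverse r > 0" using ri assms by linarith
  ultimately show ?thesis by (simp add: field_simps)
qed

text \<open>At the vertex \<open>u = r\<close> the numerator \<open>r^(n+1) - r^(-n-1)\<close> is
  positive. This makes the maximum of the extremal functions positive.\<close>

lemma chebU_ellipse_vertex_nonzero:
  assumes "r > 1"
  shows "chebU n ((of_real r + inverse (of_real r)) / 2 :: complex) \<noteq> 0"
proof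
  assume *: "chebU n ((of_real r + inverse (of_real r)) / 2 :: complex) = 0"
  have "complex_of_real r ^ Suc n = inverse (of_real r) ^ Suc n"
    using chebU_joukowski[of "complex_of_real r" n] * assms by (simp del: power_Suc)
  then have "norm (complex_of_real r ^ Suc n) = norm (inverse (complex_of_real r) ^ Suc n)"
    by (rule arg_cong)
  then have "r ^ Suc n = inverse r ^ Suc n"
    using assms by (simp add: norm_power norm_inverse del: power_Suc)
  moreover have "r ^ Suc n > 1" "inverse r ^ Suc n < 1"
    using assms by (auto simp: one_less_power power_less_one_iff inverse_less_1_iff simp del: power_Suc)
  ultimately show False by simp
qed

definition mchebU :: "nat^'d \<Rightarrow> complex^'d \<Rightarrow> complex" where
  "mchebU k z = (\<Prod>j\<in>UNIV. chebU (k $ j) (z $ j))"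

lemma manalytic_on_mchebU: "manalytic_on (mchebU k) S"
  for k :: "nat^'d"
  unfolding manalytic_on_def
proof (intro ballI exI[of _ "1::real"] conjI)
  fix w :: "complex^'d"
  define D where "D j = deriv (chebU (k $ j)) (w $ j)" for j
  have "((\<lambda>z. chebU (k $ j) (z $ j)) has_derivative (\<lambda>h. D j * h $ j)) (at w)" for j
  proof -
    have "(chebU (k $ j) has_field_derivative D j) (at (w $ j))"
      unfolding D_def using chebU_field_differentiable by (simp add: field_differentiable_derivI)
    then have "(chebU (k $ j) has_derivative (*) (D j)) (at (w $ j))"
      by (simp add: has_field_derivative_def)
    moreover have "((\<lambda>z :: complex^'d. z $ j) has_derivative (\<lambda>h. h $ j)) (at w)"
      by (rule bounded_linear_imp_has_derivative[OF bounded_linear_vec_nth])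
    ultimately show ?thesis using has_derivative_compose by blast
  qed
  then have "((\<lambda>z. \<Prod>j\<in>UNIV. chebU (k $ j) (z $ j)) has_derivative
      (\<lambda>h. \<Sum>i\<in>UNIV. D i * h $ i * (\<Prod>j\<in>UNIV - {i}. chebU (k $ j) (w $ j)))) (at w)"
    by (rule has_derivative_prod)
  then show "\<exists>a. (mchebU k has_derivative (\<lambda>h. \<Sum>j\<in>UNIV. a $ j * h $ j)) (at w)"
    by (intro exI[of _ "\<chi> i. D i * (\<Prod>j\<in>UNIV - {i}. chebU (k $ j) (w $ j))"])
       (simp add: mchebU_def[abs_def] mult_ac)
qed simp

lemma continuous_on_mchebU: "continuous_on S (mchebU k)"
  unfolding mchebU_def by (intro continuous_intros)

lemma analytic_inside_mchebU:
  assumes "\<And>i. \<rho> $ i > 1"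
  shows "analytic_inside_polyellipse \<rho> (mchebU k)"
  using analytic_inside_polyellipse_iff[OF assms] manalytic_on_mchebU continuous_on_mchebU by blast

text \<open>The integrand is a product of one-variable functions, and each one-dimensional integral
  is a diagonal value of \<open>cheb_geg\<close> divided by \<open>geg_h\<close>.\<close>

lemma gegenbauer_coeff_mchebU:
  fixes k :: "nat^'d"
  assumes l: "l > 0"
  shows "gegenbauer_coeff l (mchebU k) k = of_real (\<Prod>j\<in>UNIV. fact (k $ j) / pochhammer l (k $ j))"
proof -
  interpret product_sigma_finite "\<lambda>_::'d. lborel :: real measure" by standard
  \<comment> \<open>The coefficient does not depend on a polyellipse; any radii above 1 serve for
    \<open>gegenbauer_coeff_PiM\<close>.\<close>
  define \<rho> :: "real^'d" where "\<rho> = (\<chi> j. 2)"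
  have \<rho>: "\<rho> $ i > 1" for i by (simp add: \<rho>_def)
  define F where "F j x = chebU (k $ j) (complex_of_real x) * geg_weight_fun l (k $ j) x" for j x
  have int: "integrable lborel (F j)" for j
  proof -
    have "integrable lborel (\<lambda>x. (chebU (k $ j) (complex_of_real x) *
        of_real (poly (geg l (k $ j)) x / geg_h l (k $ j))) * of_real (gw l x))"
      by (intro integrable_mult_gw l continuous_intros) (use geg_h_pos[OF l] in \<open>auto simp: less_imp_neq[symmetric]\<close>)
    then show ?thesis by (simp add: F_def[abs_def] geg_weight_fun_def mult_ac)
  qed
  have val: "(\<integral>x. F j x \<partial>lborel) = of_real (fact (k $ j) / pochhammer l (k $ j))" for j
  proof -
    let ?n = "k $ j"
    have h: "geg_h l ?n > 0" using geg_h_pos[OF l] .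
    have "(\<integral>x. F j x \<partial>lborel) = (\<integral>x. complex_of_real (chebU ?n x * poly (geg l ?n) x * gw l x / geg_h l ?n) \<partial>lborel)"
      by (simp add: F_def geg_weight_fun_def of_real_chebU mult_ac)
    also have "\<dots> = of_real (\<integral>x. chebU ?n x * poly (geg l ?n) x * gw l x / geg_h l ?n \<partial>lborel)"
      by (rule integral_complex_of_real)
    also have "(\<integral>x. chebU ?n x * poly (geg l ?n) x * gw l x / geg_h l ?n \<partial>lborel) = cheb_geg l ?n ?n / geg_h l ?n"
      by (simp add: cheb_geg_def gip_def)
    finally show ?thesis using h by (simp add: cheb_geg_diag[OF l])
  qed
  have "gegenbauer_coeff l (mchebU k) k =
    (\<integral>x. (if (\<chi> j. of_real (x j)) \<in> filled_polyellipse \<rho> then mchebU k (\<chi> j. of_real (x j)) else 0)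
     * (\<Prod>j\<in>UNIV. geg_weight_fun l (k $ j) (x j)) \<partial>Pi\<^sub>M UNIV (\<lambda>_. lborel))"
    by (rule gegenbauer_coeff_PiM[OF l \<rho> continuous_on_mchebU])
  also have "\<dots> = (\<integral>x. (\<Prod>j\<in>UNIV. F j (x j)) \<partial>Pi\<^sub>M UNIV (\<lambda>_. lborel))"
  proof (rule Bochner_Integration.integral_cong[OF refl])
    fix x :: "'d \<Rightarrow> real"
    show "(if (\<chi> j. of_real (x j)) \<in> filled_polyellipse \<rho> then mchebU k (\<chi> j. of_real (x j)) else 0)
     * (\<Prod>j\<in>UNIV. geg_weight_fun l (k $ j) (x j)) = (\<Prod>j\<in>UNIV. F j (x j))"
    proof (cases "\<forall>j. x j \<in> {-1..1}")
      case True
      then have "(\<chi> j. complex_of_real (x j)) \<in> filled_polyellipse \<rho>"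
        using interval_in_inside[OF \<rho>] ellipse_Un_inside[OF \<rho>] by (force simp: filled_polyellipse_def)
      then show ?thesis by (simp add: mchebU_def F_def prod.distrib)
    next
      case False
      then obtain j where "geg_weight_fun l (k $ j) (x j) = 0"
        using geg_weight_fun_nonzero by blast
      then have "(\<Prod>j\<in>UNIV. geg_weight_fun l (k $ j) (x j)) = 0" "(\<Prod>j\<in>UNIV. F j (x j)) = 0"
        by (auto simp: F_def prod_zero_iff)
      then show ?thesis by (simp only: mult_zero_right)
    qed
  qed
  also have "\<dots> = (\<Prod>j\<in>UNIV. \<integral>x. F j x \<partial>lborel)"
    by (rule product_integral_prod) (use int in auto)
  finally show ?thesis by (simp add: val)
qed

lemma max_on_polyellipse_mchebU:
  fixes \<rho> :: "real^'d"
  assumes \<rho>: "\<And>i. \<rho> $ i > 1"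
  shows "max_on_polyellipse \<rho> (mchebU k) > 0"
    and "max_on_polyellipse \<rho> (mchebU k) \<le> (\<Prod>j\<in>UNIV. 2 * \<rho> $ j / (\<rho> $ j - inverse (\<rho> $ j)) * (\<rho> $ j) ^ (k $ j))"
proof -
  define z :: "complex^'d" where "z = (\<chi> j. (of_real (\<rho> $ j) + inverse (of_real (\<rho> $ j))) / 2)"
  have z: "z \<in> polyellipse \<rho>"
  proof -
    have "z $ j \<in> bernstein_ellipse (\<rho> $ j)" for j
      unfolding bernstein_ellipse_def
      by (rule CollectI, rule exI[of _ "of_real (\<rho> $ j)"]) (use \<rho>[of j] in \<open>simp add: z_def\<close>)
    then show ?thesis by (simp add: polyellipse_def)
  qed
  have "mchebU k z \<noteq> 0"
    using chebU_ellipse_vertex_nonzero[OF \<rho>] by (simp add: mchebU_def z_def)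
  then show "max_on_polyellipse \<rho> (mchebU k) > 0"
    using norm_le_max_on_polyellipse[OF \<rho> continuous_on_mchebU z, of k]
    by (meson less_le_trans zero_less_norm_iff)
  show "max_on_polyellipse \<rho> (mchebU k) \<le> (\<Prod>j\<in>UNIV. 2 * \<rho> $ j / (\<rho> $ j - inverse (\<rho> $ j)) * (\<rho> $ j) ^ (k $ j))"
    unfolding max_on_polyellipse_def
  proof (rule cSUP_least)
    fix y assume "y \<in> polyellipse \<rho>"
    then show "norm (mchebU k y) \<le> (\<Prod>j\<in>UNIV. 2 * \<rho> $ j / (\<rho> $ j - inverse (\<rho> $ j)) * (\<rho> $ j) ^ (k $ j))"
      unfolding mchebU_def prod_norm[symmetric]
      by (intro prod_mono conjI norm_chebU_ellipse_le \<rho>) (auto simp: polyellipse_def)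
  qed (use z in blast)
qed

text \<open>For \<open>mchebU k\<close> the maximum on the polyellipse grows at most like
  \<open>rho^k\<close>, which cancels the factor \<open>rho^(-k)\<close> of the bound. What is left
  to compare is the power \<open>1 - l\<close> of \<open>k_j\<close> with
  \<open>k_j! / (l)_(k_j)\<close>.\<close>

lemma gegenbauer_coeff_lower:
  fixes \<rho> :: "real^'d"
  assumes l: "l > 0" and \<rho>: "\<And>i. \<rho> $ i > 1"
  shows "\<exists>c>0. \<exists>N. \<forall>k. (\<forall>j. N \<le> k $ j) \<longrightarrow>
    c * gegenbauer_coeff_bound l \<rho> (mchebU k) k \<le> norm (gegenbauer_coeff l (mchebU k) k)"
proof -
  obtain N0 where N0: "\<And>n. n \<ge> N0 \<Longrightarrow> Gamma l / 2 * real n powr (1 - l) \<le> fact n / pochhammer l n"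
    using Gamma_ratio_lower[OF l] by (auto simp: eventually_sequentially)
  \<comment> \<open>At least 1, so that no \<open>k $ j\<close> is 0 and only \<open>Dconst\<close>
    occurs in the bound.\<close>
  define N where "N = max N0 1"
  define A where "A j = 2 * \<rho> $ j / (\<rho> $ j - inverse (\<rho> $ j))" for j
  define L where "L j = bernstein_length (\<rho> $ j)" for j
  define D where "D j = Dconst l (\<rho> $ j)" for j
  \<comment> \<open>\<open>A j\<close> bounds the growth of the Chebyshev factor, \<open>pi\<close>,
    \<open>L j\<close> and \<open>D j\<close> come from the bound, and \<open>Gamma l / 2\<close>
    from \<open>Gamma_ratio_lower\<close>. \<open>L j + 1\<close> is positive although
    \<open>L j\<close> is only known to be nonnegative.\<close>
  define c where "c j = (Gamma l / 2) * pi / (A j * (L j + 1) * D j)" for j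
  have inv: "inverse (\<rho> $ j) < 1" "\<rho> $ j > 0" for j
    using \<rho>[of j] by (auto simp: inverse_less_1_iff)
  have A: "A j > 0" for j
    using \<rho>[of j] inv[of j] by (auto simp: A_def intro!: divide_pos_pos)
  have L: "L j \<ge> 0" for j
    unfolding L_def by (rule bernstein_length_nonneg[OF inv(2)])
  have D: "D j > 0" for j
  proof -
    define p where "p = (\<rho> $ j) powi (-2)"
    have "p < 1" "p > 0"
      unfolding p_def using \<rho>[of j] by (simp_all add: power_int_minus inverse_less_1_iff)
    then show ?thesis using l inv[of j] by (simp add: D_def Dconst_def flip: p_def)
  qed
  have c: "c j > 0" for j
    unfolding c_def using l A[of j] L[of j] D[of j] by (intro divide_pos_pos mult_pos_pos) auto
  show ?thesis
  proof (intro exI[of _ "\<Prod>j\<in>UNIV. c j"] exI[of _ N] conjI allI impI)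
    show "(\<Prod>j\<in>UNIV. c j) > 0" using c by (intro prod_pos) auto
    fix k :: "nat^'d" assume k: "\<forall>j. N \<le> k $ j"
    let ?b = "\<lambda>j. L j / (pi * (\<rho> $ j) ^ (k $ j)) * (real (k $ j) powr (1 - l) * D j)"
    have k0: "k $ j \<noteq> 0" "k $ j \<ge> N0" for j using k[rule_format, of j] by (auto simp: N_def)
    have b: "?b j \<ge> 0" for j
      using L[of j] D[of j] inv[of j] by (intro mult_nonneg_nonneg divide_nonneg_nonneg) auto
    have "gegenbauer_coeff_bound l \<rho> (mchebU k) k = max_on_polyellipse \<rho> (mchebU k) * (\<Prod>j\<in>UNIV. ?b j)"
      unfolding gegenbauer_coeff_bound_eq by (simp add: L_def D_def k0(1))
    also have "\<dots> \<le> (\<Prod>j\<in>UNIV. A j * (\<rho> $ j) ^ (k $ j)) * (\<Prod>j\<in>UNIV. ?b j)"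
      using max_on_polyellipse_mchebU(2)[OF \<rho>, of k] b unfolding A_def
      by (intro mult_right_mono prod_nonneg) auto
    finally have "(\<Prod>j\<in>UNIV. c j) * gegenbauer_coeff_bound l \<rho> (mchebU k) k
        \<le> (\<Prod>j\<in>UNIV. c j) * ((\<Prod>j\<in>UNIV. A j * (\<rho> $ j) ^ (k $ j)) * (\<Prod>j\<in>UNIV. ?b j))"
      using c by (intro mult_left_mono prod_nonneg) (auto simp: less_imp_le)
    also have "\<dots> = (\<Prod>j\<in>UNIV. c j * (A j * (\<rho> $ j) ^ (k $ j) * ?b j))"
      by (simp only: prod.distrib)
    also have "\<dots> \<le> (\<Prod>j\<in>UNIV. fact (k $ j) / pochhammer l (k $ j))"
    proof (rule prod_mono, intro conjI)
      fix j :: 'd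
      show "0 \<le> c j * (A j * (\<rho> $ j) ^ (k $ j) * ?b j)"
        using c[of j] A[of j] inv[of j] L[of j] D[of j]
        by (intro mult_nonneg_nonneg divide_nonneg_nonneg) auto
      have "c j * (A j * (\<rho> $ j) ^ (k $ j) * ?b j) = Gamma l / 2 * real (k $ j) powr (1 - l) * (L j / (L j + 1))"
        using A[of j] L[of j] D[of j] inv[of j] by (simp add: c_def divide_simps)
      also have "\<dots> \<le> Gamma l / 2 * real (k $ j) powr (1 - l) * 1"
        using L[of j] l by (intro mult_left_mono) auto
      also have "\<dots> \<le> fact (k $ j) / pochhammer l (k $ j)"
        using N0[OF k0(2)] by simp
      finally show "c j * (A j * (\<rho> $ j) ^ (k $ j) * ?b j) \<le> fact (k $ j) / pochhammer l (k $ j)" .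
    qed
    also have "\<dots> = norm (gegenbauer_coeff l (mchebU k) k)"
      unfolding gegenbauer_coeff_mchebU[OF l] norm_of_real
      by (rule abs_of_nonneg[symmetric]) (use pochhammer_pos[OF l] in \<open>auto intro!: prod_nonneg simp: less_imp_le\<close>)
    finally show "(\<Prod>j\<in>UNIV. c j) * gegenbauer_coeff_bound l \<rho> (mchebU k) k
        \<le> norm (gegenbauer_coeff l (mchebU k) k)" .
  qed
qed

text \<open>Optimality is uniform: \<open>c\<close> and \<open>N\<close> are fixed before
  \<open>k\<close>, while \<open>f\<close> may vary with \<open>k\<close>. Positivity of the maximum
  rules out functions vanishing on the polyellipse, for which the lower estimate would be
  trivial.\<close>

theorem theorem3p1:
  fixes lam :: real and \<rho> :: "real^'d"
  assumes "lam > 0" and "\<And>i. \<rho> $ i > 1"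
  shows "(\<forall>f. analytic_inside_polyellipse \<rho> f \<longrightarrow>
            (\<forall>k. norm (gegenbauer_coeff lam f k) \<le> gegenbauer_coeff_bound lam \<rho> f k))
       \<and> (\<exists>c>0. \<exists>N. \<forall>k. (\<forall>j. N \<le> k $ j) \<longrightarrow>
            (\<exists>f. analytic_inside_polyellipse \<rho> f \<and> max_on_polyellipse \<rho> f > 0 \<and>
                 c * gegenbauer_coeff_bound lam \<rho> f k \<le> norm (gegenbauer_coeff lam f k)))"
  using gegenbauer_coeff_upper[OF assms] gegenbauer_coeff_lower[OF assms]
    analytic_inside_mchebU[OF assms(2)] max_on_polyellipse_mchebU(1)[OF assms(2)]
  by blast

end
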